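(* Assume Dickson's conjecture (D). Then $T^*_{+,\Pr}$ (and $T_{+,\Pr}$) is supersimple of $U$-rank $1$; more precisely, working in a monster model $\mathfrak{C}$ of $T^*_{+,\Pr}$, for every small set $A\subseteq\mathfrak{C}$, every tuple $a$ from $\mathfrak{C}$ and every formula $\varphi(x,a)$ with $x$ a single variable, if $\varphi(x,a)$ forks over $A$ then $\varphi(x,a)$ is algebraic, i.e., $\varphi(x,a)\vdash\bigvee_{i<k}x=c_i$ for some finitely many $c_i\in\mathfrak{C}$.
   Context: $\Pr$ is the set of prime numbers together with their negations; $T_{+,\Pr}=\mathrm{Th}(\mathbb{Z},+,0,1,\Pr)$. $L^*=\{+,-,0,1,\Pr,\Pr_n,P_n : 2\le n<\omega\}$, and $T^*_{+,\Pr}$ is the complete theory of the $L^*$-structure with universe $\mathbb{Z}$ where $+,0,1$ are as usual, $-$ is unary negation, $P_n(x)$ holds iff $x\equiv 0\pmod n$, and $\Pr_n(x)$ holds iff $P_n(x)$ and $\Pr(x/n)$. Dickson's conjecture (D): for every $k\ge 1$ and every sequence of linear maps $f_i(x)=a_ix+b_i$ ($i<k$) with $a_i,b_i$ non-negative integers and $a_i\ge 1$, if no integer $n>1$ divides $\prod_{i<k} f_i(s)$ for every non-negative integer $s$, then there are infinitely many natural numbers $m$ such that $f_i(m)$ is prime for all $i<k$. *)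

theory Defs
  imports Main "HOL-Computational_Algebra.Primes"
begin

section \<open>First-order logic with equality\<close>

datatype 'f tm = TVar nat | TApp 'f "'f tm list"

datatype ('f, 'r) fm =
    FEq "'f tm" "'f tm"
  | FRel 'r "'f tm list"
  | FNeg "('f, 'r) fm"
  | FConj "('f, 'r) fm" "('f, 'r) fm"
  | FEx nat "('f, 'r) fm"

text \<open>A symbol belongs to a language iff it is assigned an arity, so that sublanguages can
  share their symbol types.\<close>

record ('f, 'r) lang =
  fun_arity :: "'f \<Rightarrow> nat option"
  rel_arity :: "'r \<Rightarrow> nat option"

text \<open>The universe of a structure is the whole type \<open>'a\<close>. Symbols outside the language
  under consideration, and argument lists of the wrong length, are interpreted arbitrarily;
  they never occur in a formula of the language.\<close>

record ('f, 'r, 'a) fo_struct =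
  fun_interp :: "'f \<Rightarrow> 'a list \<Rightarrow> 'a"
  rel_interp :: "'r \<Rightarrow> 'a list \<Rightarrow> bool"

primrec tm_in :: "('f, 'r) lang \<Rightarrow> 'f tm \<Rightarrow> bool" where
  "tm_in L (TVar x) \<longleftrightarrow> True"
| "tm_in L (TApp f ts) \<longleftrightarrow>
     fun_arity L f = Some (length ts) \<and> list_all (tm_in L) ts"

primrec fm_in :: "('f, 'r) lang \<Rightarrow> ('f, 'r) fm \<Rightarrow> bool" where
  "fm_in L (FEq s t) \<longleftrightarrow> tm_in L s \<and> tm_in L t"
| "fm_in L (FRel r ts) \<longleftrightarrow> rel_arity L r = Some (length ts) \<and> list_all (tm_in L) ts"
| "fm_in L (FNeg \<phi>) \<longleftrightarrow> fm_in L \<phi>"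
| "fm_in L (FConj \<phi> \<psi>) \<longleftrightarrow> fm_in L \<phi> \<and> fm_in L \<psi>"
| "fm_in L (FEx x \<phi>) \<longleftrightarrow> fm_in L \<phi>"

primrec tm_vars :: "'f tm \<Rightarrow> nat set" where
  "tm_vars (TVar x) = {x}"
| "tm_vars (TApp f ts) = \<Union> (set (map tm_vars ts))"

primrec fm_free :: "('f, 'r) fm \<Rightarrow> nat set" where
  "fm_free (FEq s t) = tm_vars s \<union> tm_vars t"
| "fm_free (FRel r ts) = (\<Union>t\<in>set ts. tm_vars t)"
| "fm_free (FNeg \<phi>) = fm_free \<phi>"
| "fm_free (FConj \<phi> \<psi>) = fm_free \<phi> \<union> fm_free \<psi>"
| "fm_free (FEx x \<phi>) = fm_free \<phi> - {x}"

primrec tm_val :: "('f, 'r, 'a) fo_struct \<Rightarrow> (nat \<Rightarrow> 'a) \<Rightarrow> 'f tm \<Rightarrow> 'a" where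
  "tm_val M v (TVar x) = v x"
| "tm_val M v (TApp f ts) = fun_interp M f (map (tm_val M v) ts)"

primrec sat :: "('f, 'r, 'a) fo_struct \<Rightarrow> (nat \<Rightarrow> 'a) \<Rightarrow> ('f, 'r) fm \<Rightarrow> bool" where
  "sat M v (FEq s t) \<longleftrightarrow> tm_val M v s = tm_val M v t"
| "sat M v (FRel r ts) \<longleftrightarrow> rel_interp M r (map (tm_val M v) ts)"
| "sat M v (FNeg \<phi>) \<longleftrightarrow> \<not> sat M v \<phi>"
| "sat M v (FConj \<phi> \<psi>) \<longleftrightarrow> sat M v \<phi> \<and> sat M v \<psi>"
| "sat M v (FEx x \<phi>) \<longleftrightarrow> (\<exists>c. sat M (v(x := c)) \<phi>)"

definition formulas :: "('f, 'r) lang \<Rightarrow> nat \<Rightarrow> ('f, 'r) fm set" where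
  "formulas L n = {\<phi>. fm_in L \<phi> \<and> fm_free \<phi> \<subseteq> {..<n}}"

text \<open>The \<open>i\<close>-th entry of the list is assigned to the variable \<open>i\<close>; this is used only for
  \<open>\<phi> \<in> formulas L (length xs)\<close>, whose truth value depends on no other variable.\<close>

definition holds :: "('f, 'r, 'a) fo_struct \<Rightarrow> ('f, 'r) fm \<Rightarrow> 'a list \<Rightarrow> bool" where
  "holds M \<phi> xs \<longleftrightarrow> sat M (\<lambda>i. xs ! i) \<phi>"

definition Th :: "('f, 'r) lang \<Rightarrow> ('f, 'r, 'a) fo_struct \<Rightarrow> ('f, 'r) fm set" where
  "Th L M = {\<sigma> \<in> formulas L 0. holds M \<sigma> []}"

definition models :: "('f, 'r, 'a) fo_struct \<Rightarrow> ('f, 'r) fm set \<Rightarrow> bool" where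
  "models M T \<longleftrightarrow> (\<forall>\<sigma>\<in>T. holds M \<sigma> [])"


section \<open>Types and monster models\<close>

text \<open>A pair \<open>(\<phi>, a)\<close> stands for the formula \<open>\<phi>(x, a)\<close> in the variables
  \<open>x = (x\<^sub>0, \<dots>, x\<^sub>m\<^sub>-\<^sub>1)\<close>, the parameters \<open>a\<close> being substituted for the next
  \<open>length a\<close> variables.\<close>

type_synonym ('f, 'r, 'a) pfm = "('f, 'r) fm \<times> 'a list"

definition pformulas :: "('f, 'r) lang \<Rightarrow> nat \<Rightarrow> 'a set \<Rightarrow> ('f, 'r, 'a) pfm set" where
  "pformulas L m A = {(\<phi>, a). set a \<subseteq> A \<and> \<phi> \<in> formulas L (m + length a)}"

definition realizes :: "('f, 'r, 'a) fo_struct \<Rightarrow> 'a list \<Rightarrow> ('f, 'r, 'a) pfm set \<Rightarrow> bool" where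
  "realizes M b p \<longleftrightarrow> (\<forall>(\<phi>, a)\<in>p. holds M \<phi> (b @ a))"

definition tp ::
  "('f, 'r) lang \<Rightarrow> ('f, 'r, 'a) fo_struct \<Rightarrow> 'a list \<Rightarrow> 'a set \<Rightarrow> ('f, 'r, 'a) pfm set" where
  "tp L M b A = {(\<phi>, a) \<in> pformulas L (length b) A. holds M \<phi> (b @ a)}"

definition small :: "'k rel \<Rightarrow> 'a set \<Rightarrow> bool" where
  "small \<kappa> A \<longleftrightarrow> (card_of A, \<kappa>) \<in> ordLess"

definition saturated :: "('f, 'r) lang \<Rightarrow> 'k rel \<Rightarrow> ('f, 'r, 'a) fo_struct \<Rightarrow> bool" where
  "saturated L \<kappa> M \<longleftrightarrow>
     (\<forall>A p. small \<kappa> A \<and> p \<subseteq> pformulas L 1 A \<and>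
        (\<forall>p\<^sub>0. finite p\<^sub>0 \<and> p\<^sub>0 \<subseteq> p \<longrightarrow> (\<exists>b. realizes M [b] p\<^sub>0))
        \<longrightarrow> (\<exists>b. realizes M [b] p))"

definition partial_elementary ::
  "('f, 'r) lang \<Rightarrow> ('f, 'r, 'a) fo_struct \<Rightarrow> 'a set \<Rightarrow> ('a \<Rightarrow> 'a) \<Rightarrow> bool" where
  "partial_elementary L M A f \<longleftrightarrow>
     (\<forall>a \<phi>. set a \<subseteq> A \<and> \<phi> \<in> formulas L (length a) \<longrightarrow>
        (holds M \<phi> a \<longleftrightarrow> holds M \<phi> (map f a)))"

definition automorphism ::
  "('f, 'r) lang \<Rightarrow> ('f, 'r, 'a) fo_struct \<Rightarrow> ('a \<Rightarrow> 'a) \<Rightarrow> bool" where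
  "automorphism L M h \<longleftrightarrow> bij h \<and>
     (\<forall>f xs. fun_arity L f = Some (length xs) \<longrightarrow>
        h (fun_interp M f xs) = fun_interp M f (map h xs)) \<and>
     (\<forall>r xs. rel_arity L r = Some (length xs) \<longrightarrow>
        (rel_interp M r xs \<longleftrightarrow> rel_interp M r (map h xs)))"

definition strongly_homogeneous ::
  "('f, 'r) lang \<Rightarrow> 'k rel \<Rightarrow> ('f, 'r, 'a) fo_struct \<Rightarrow> bool" where
  "strongly_homogeneous L \<kappa> M \<longleftrightarrow>
     (\<forall>A f. small \<kappa> A \<and> partial_elementary L M A f \<longrightarrow>
        (\<exists>h. automorphism L M h \<and> (\<forall>x\<in>A. h x = f x)))"

text \<open>\<open>M\<close> is a monster model of \<open>T\<close> with respect to the cardinal \<open>\<kappa>\<close>, which exceeds the number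
  of formulas (so it is uncountable); the small sets are those of cardinality less than \<open>\<kappa>\<close>.\<close>

definition monster ::
  "('f, 'r) lang \<Rightarrow> ('f, 'r) fm set \<Rightarrow> 'k rel \<Rightarrow> ('f, 'r, 'a) fo_struct \<Rightarrow> bool" where
  "monster L T \<kappa> M \<longleftrightarrow> Card_order \<kappa> \<and> small \<kappa> (formulas L 0) \<and> models M T \<and>
     saturated L \<kappa> M \<and> strongly_homogeneous L \<kappa> M"


section \<open>Forking, supersimplicity and U-rank\<close>

text \<open>\<open>\<phi>(x, a)\<close>, with \<open>x\<close> of length \<open>m\<close>, divides over \<open>A\<close> if for some \<open>k\<close> there are
  \<open>c\<^sub>i\<close> (\<open>i < \<omega>\<close>) with the same type over \<open>A\<close> as \<open>a\<close> such that any \<open>k\<close> of the formulas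
  \<open>\<phi>(x, c\<^sub>i)\<close> (counted by their indices) are jointly inconsistent.\<close>

definition divides ::
  "('f, 'r) lang \<Rightarrow> ('f, 'r, 'a) fo_struct \<Rightarrow> nat \<Rightarrow> ('f, 'r, 'a) pfm \<Rightarrow> 'a set \<Rightarrow> bool" where
  "divides L M m = (\<lambda>(\<phi>, a) A.
     \<exists>k. \<exists>c :: nat \<Rightarrow> 'a list.
       (\<forall>i. length (c i) = length a \<and> tp L M (c i) A = tp L M a A) \<and>
       (\<forall>I. finite I \<and> card I = k \<longrightarrow>
          \<not> (\<exists>b. length b = m \<and> (\<forall>i\<in>I. holds M \<phi> (b @ c i)))))"

definition forks ::
  "('f, 'r) lang \<Rightarrow> ('f, 'r, 'a) fo_struct \<Rightarrow> nat \<Rightarrow> ('f, 'r, 'a) pfm \<Rightarrow> 'a set \<Rightarrow> bool" where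
  "forks L M m = (\<lambda>(\<phi>, a) A.
     \<exists>\<Psi>. finite \<Psi> \<and> \<Psi> \<subseteq> pformulas L m UNIV \<and> (\<forall>\<psi>\<in>\<Psi>. divides L M m \<psi> A) \<and>
       (\<forall>b. length b = m \<and> holds M \<phi> (b @ a) \<longrightarrow> (\<exists>(\<psi>, c)\<in>\<Psi>. holds M \<psi> (b @ c))))"

text \<open>The type \<open>p\<close> is meant to be complete, hence closed under conjunction, so it forks iff one
  of its members does.\<close>

definition type_forks ::
  "('f, 'r) lang \<Rightarrow> ('f, 'r, 'a) fo_struct \<Rightarrow> nat \<Rightarrow> ('f, 'r, 'a) pfm set \<Rightarrow> 'a set \<Rightarrow> bool" where
  "type_forks L M m p A \<longleftrightarrow> (\<exists>\<phi>\<in>p. forks L M m \<phi> A)"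

definition algebraic :: "('f, 'r, 'a) fo_struct \<Rightarrow> ('f, 'r, 'a) pfm \<Rightarrow> bool" where
  "algebraic M = (\<lambda>(\<phi>, a). \<exists>cs. \<forall>b. holds M \<phi> (b # a) \<longrightarrow> b \<in> set cs)"

text \<open>Supersimplicity and U-rank of a complete theory, computed in a monster model \<open>M\<close>
  of it.\<close>

definition supersimple :: "('f, 'r) lang \<Rightarrow> 'k rel \<Rightarrow> ('f, 'r, 'a) fo_struct \<Rightarrow> bool" where
  "supersimple L \<kappa> M \<longleftrightarrow>
     (\<forall>b A. small \<kappa> A \<longrightarrow>
        (\<exists>A\<^sub>0. finite A\<^sub>0 \<and> A\<^sub>0 \<subseteq> A \<and> \<not> type_forks L M (length b) (tp L M b A) A\<^sub>0))"

text \<open>\<open>U_rank_ge L M \<kappa> n A p\<close> says that the complete 1-type \<open>p\<close> over \<open>A\<close> has U-rank at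
  least \<open>n\<close>. Complete types over small sets are all realized in \<open>M\<close>, so the forking extension
  of \<open>p\<close> is taken of the form \<open>tp L M [d] B\<close>. Finite ranks suffice to say that a rank is
  equal to a given natural number.\<close>

primrec U_rank_ge ::
  "('f, 'r) lang \<Rightarrow> ('f, 'r, 'a) fo_struct \<Rightarrow> 'k rel \<Rightarrow> nat \<Rightarrow> 'a set \<Rightarrow> ('f, 'r, 'a) pfm set \<Rightarrow> bool"
where
  "U_rank_ge L M \<kappa> 0 A p \<longleftrightarrow> True"
| "U_rank_ge L M \<kappa> (Suc n) A p \<longleftrightarrow>
     (\<exists>B d. A \<subseteq> B \<and> small \<kappa> B \<and> p \<subseteq> tp L M [d] B \<and> type_forks L M 1 (tp L M [d] B) A \<and>
        U_rank_ge L M \<kappa> n B (tp L M [d] B))"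

text \<open>The U-rank of a theory is the supremum of the U-ranks of its complete 1-types.\<close>

definition theory_U_rank_ge ::
  "('f, 'r) lang \<Rightarrow> 'k rel \<Rightarrow> ('f, 'r, 'a) fo_struct \<Rightarrow> nat \<Rightarrow> bool" where
  "theory_U_rank_ge L \<kappa> M n \<longleftrightarrow> (\<exists>A d. small \<kappa> A \<and> U_rank_ge L M \<kappa> n A (tp L M [d] A))"

definition theory_U_rank_eq ::
  "('f, 'r) lang \<Rightarrow> 'k rel \<Rightarrow> ('f, 'r, 'a) fo_struct \<Rightarrow> nat \<Rightarrow> bool" where
  "theory_U_rank_eq L \<kappa> M n \<longleftrightarrow>
     theory_U_rank_ge L \<kappa> M n \<and> \<not> theory_U_rank_ge L \<kappa> M (Suc n)"


section \<open>The integers with a predicate for the primes\<close>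

datatype fsym = Plus | Minus | Zero | One

datatype rsym = Pr | Pr_mult nat | Div_by nat

definition Prime_pm :: "int set" where
  "Prime_pm = {p. prime p} \<union> uminus ` {p. prime p}"

fun Z_fun :: "fsym \<Rightarrow> int list \<Rightarrow> int" where
  "Z_fun Plus [x, y] = x + y"
| "Z_fun Minus [x] = - x"
| "Z_fun Zero [] = 0"
| "Z_fun One [] = 1"
| "Z_fun _ _ = undefined"

fun Z_rel :: "rsym \<Rightarrow> int list \<Rightarrow> bool" where
  "Z_rel Pr [x] \<longleftrightarrow> x \<in> Prime_pm"
| "Z_rel (Pr_mult n) [x] \<longleftrightarrow> int n dvd x \<and> x div int n \<in> Prime_pm"
| "Z_rel (Div_by n) [x] \<longleftrightarrow> int n dvd x"
| "Z_rel _ _ \<longleftrightarrow> undefined"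

definition Z_struct :: "(fsym, rsym, int) fo_struct" where
  "Z_struct = \<lparr>fun_interp = Z_fun, rel_interp = Z_rel\<rparr>"

definition L_star :: "(fsym, rsym) lang" where
  "L_star = \<lparr>
     fun_arity = (\<lambda>f. case f of Plus \<Rightarrow> Some 2 | Minus \<Rightarrow> Some 1 | Zero \<Rightarrow> Some 0 | One \<Rightarrow> Some 0),
     rel_arity = (\<lambda>r. case r of Pr \<Rightarrow> Some 1
                    | Pr_mult n \<Rightarrow> if 2 \<le> n then Some 1 else None
                    | Div_by n \<Rightarrow> if 2 \<le> n then Some 1 else None)\<rparr>"

definition L_plus_Pr :: "(fsym, rsym) lang" where
  "L_plus_Pr = \<lparr>
     fun_arity = (\<lambda>f. case f of Plus \<Rightarrow> Some 2 | Minus \<Rightarrow> None | Zero \<Rightarrow> Some 0 | One \<Rightarrow> Some 0),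
     rel_arity = (\<lambda>r. case r of Pr \<Rightarrow> Some 1 | Pr_mult n \<Rightarrow> None | Div_by n \<Rightarrow> None)\<rparr>"

definition T_star :: "(fsym, rsym) fm set" where
  "T_star = Th L_star Z_struct"

definition T_plus_Pr :: "(fsym, rsym) fm set" where
  "T_plus_Pr = Th L_plus_Pr Z_struct"

definition Dickson :: bool where
  "Dickson \<longleftrightarrow>
     (\<forall>k \<ge> 1. \<forall>a b :: nat \<Rightarrow> nat.
        (\<forall>i<k. a i \<ge> 1) \<and>
        \<not> (\<exists>n>1. \<forall>s. n dvd (\<Prod>i<k. a i * s + b i))
        \<longrightarrow> infinite {m. \<forall>i<k. prime (a i * m + b i)})"

end

theory Submission
  imports Defs "HOL-Number_Theory.Cong" "HOL-Library.Ramsey"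
begin

text \<open>The closure operator of the theory is linear: \<open>x\<close> is algebraic over \<open>A\<close> iff some nonzero
  multiple of \<open>x\<close> lies in the subgroup generated by \<open>A\<close> and \<open>1\<close>. Dickson's conjecture,
  transferred from the integers, yields a generic extension property: an element outside the
  closure of a tuple can be moved so that it has the same quantifier-free \<open>L\<^sup>*\<close>-type over several
  other realizations of the type of that tuple at once, provided no positive and negative
  primality conditions coming from different realizations coincide. With a single realization
  this gives quantifier elimination by back and forth. With the \<open>k\<close> realizations of a dividing
  configuration, where coincidences are removed by Ramsey's theorem, it shows that a formula
  satisfied by a tuple linearly independent of its parameters over \<open>A\<close> does not divide over
  \<open>A\<close>. Both languages are treated at once, since the additional symbols of \<open>L\<^sup>*\<close> are
  definable.\<close>

section \<open>Consequences of Dickson's conjecture for integer linear forms\<close>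

text \<open>The hypothesis of \<open>Dickson\<close> involves all primes, yet for finitely many
  forms only the primes up to a bound computed from coefficients, moduli and the number of forms can
  obstruct. Hence the conjecture, with congruences and negative conditions added, is a schema of
  first-order sentences, which passes to nonstandard constant terms. At an element c outside the
  closure the small primes do not obstruct: if n c + u is m times a prime and is also divisible by p
  m, it equals p m or - p m, which makes c algebraic. Moving u to another realization of its type
  preserves this, since corresponding constants are congruent modulo every standard integer. The
  only other obstruction is a negative condition that is, up to sign and scaling, the same as a
  positive one. Over one realization the type itself forbids this. Over several realizations u and
  u' may satisfy an accidental equation t(u) = t'(u') although t and t' differ on the original
  tuple; this is what \<open>compat\<close> excludes and what Ramsey's theorem removes.\<close>

lemma Prime_pm_iff: "x \<in> Prime_pm \<longleftrightarrow> prime \<bar>x\<bar>"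
proof (cases "x \<ge> 0")
  case True
  have "\<not> prime (- x)" using True prime_gt_0_int[of "- x"] by auto
  then show ?thesis using True by (auto simp: Prime_pm_def)
next
  case False
  then have "\<not> prime x" using prime_gt_0_int[of x] by auto
  then show ?thesis using False by (auto simp: Prime_pm_def image_iff)
qed

text \<open>The absence of a fixed divisor of the product, stated prime by prime: a prime divides a
  product iff it divides a factor. In this form the condition is easy to follow through affine
  substitutions.\<close>

definition admissible :: "'i set \<Rightarrow> ('i \<Rightarrow> int) \<Rightarrow> ('i \<Rightarrow> int) \<Rightarrow> bool" where
  "admissible I a b \<longleftrightarrow> (\<forall>p::int. prime p \<longrightarrow> (\<exists>y. \<forall>i\<in>I. \<not> p dvd a i * y + b i))"

lemma infinite_inj_image:
  "infinite A \<Longrightarrow> inj f \<Longrightarrow> f ` A \<subseteq> B \<Longrightarrow> infinite B"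
  by (meson finite_imageD finite_subset inj_on_subset subset_UNIV)

text \<open>Changing the sign of a form makes its leading coefficient positive, and a common shift
  of the variable makes all constant terms non-negative; the first operation leaves the absolute
  values alone and the second only translates the solutions.\<close>

lemma Dickson_int:
  assumes D: "Dickson" and fin: "finite I" and nz: "\<And>i. i \<in> I \<Longrightarrow> a i \<noteq> 0"
    and adm: "admissible I a b"
  shows "infinite {y. \<forall>i\<in>I. prime \<bar>a i * y + b i\<bar>}"
proof (cases "I = {}")
  case True
  then show ?thesis by simp
next
  case False
  define k where "k = card I"
  have k: "k \<ge> 1" using False fin by (simp add: k_def Suc_le_eq card_gt_0_iff)
  obtain h where h: "bij_betw h {0..<k} I"
    using ex_bij_betw_nat_finite[OF fin] k_def by blast
  have hI: "h j \<in> I" if "j < k" for j using h that by (auto simp: bij_betw_def)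
  \<comment> \<open>One shift serves all forms: since \<open>\<bar>a i\<bar>\<close> is at least 1,
    \<open>\<bar>a i\<bar> * T\<close> is at least \<open>\<bar>b i\<bar>\<close> for every
    i.\<close>
  define T where "T = (\<Sum>i\<in>I. \<bar>b i\<bar>)"
  define aa where "aa j = nat \<bar>a (h j)\<bar>" for j
  define bb where "bb j = nat (sgn (a (h j)) * b (h j) + \<bar>a (h j)\<bar> * T)" for j
  have nn: "sgn (a i) * b i + \<bar>a i\<bar> * T \<ge> 0" if "i \<in> I" for i
  proof -
    have "\<bar>b i\<bar> \<le> T" unfolding T_def using fin that by (intro member_le_sum) auto
    moreover have "T \<le> \<bar>a i\<bar> * T"
      using nz[OF that] calculation by (intro mult_le_cancel_right1[THEN iffD2]) auto
    moreover have "- \<bar>b i\<bar> \<le> sgn (a i) * b i"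
      using nz[OF that] by (auto simp: sgn_if abs_if)
    ultimately show ?thesis by linarith
  qed
  have key: "int (aa j * m + bb j) = sgn (a (h j)) * (a (h j) * (int m + T) + b (h j))"
    if "j < k" for j m
  proof -
    have "int (aa j * m + bb j) = \<bar>a (h j)\<bar> * int m + (sgn (a (h j)) * b (h j) + \<bar>a (h j)\<bar> * T)"
      using nn[OF hI[OF that]] by (simp add: aa_def bb_def)
    then show ?thesis by (simp add: abs_sgn[of "a (h j)"] algebra_simps)
  qed
  have keyabs: "int (aa j * m + bb j) = \<bar>a (h j) * (int m + T) + b (h j)\<bar>" if "j < k" for j m
  proof -
    have "\<bar>int (aa j * m + bb j)\<bar> = \<bar>a (h j) * (int m + T) + b (h j)\<bar>"
      unfolding key[OF that] using nz[OF hI[OF that]] by (simp add: abs_mult)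
    then show ?thesis by simp
  qed
  have "infinite {m. \<forall>i<k. prime (aa i * m + bb i)}"
  proof -
    have 1: "\<forall>i<k. aa i \<ge> 1" using nz hI by (fastforce simp: aa_def)
    have 2: "\<not> (\<exists>n>1. \<forall>s. n dvd (\<Prod>i<k. aa i * s + bb i))"
    proof
      assume "\<exists>n>1. \<forall>s. n dvd (\<Prod>i<k. aa i * s + bb i)"
      then obtain n where n: "n > 1" "\<forall>s. n dvd (\<Prod>i<k. aa i * s + bb i)" by blast
      then obtain p where p: "prime p" "p dvd n" using prime_factor_nat[of n] by auto
      obtain y where y: "\<forall>i\<in>I. \<not> int p dvd a i * y + b i"
        using adm p(1) unfolding admissible_def by (metis prime_nat_int_transfer)
      \<comment> \<open>Admissibility provides an integer y; s is a natural number for which the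
        shifted argument s + T lies in the same class modulo p.\<close>
      define s where "s = nat ((y - T) mod int p)"
      have sp: "int p dvd (int s + T) - y"
      proof -
        have "int p > 0" using p(1) prime_gt_0_nat by simp
        then have "int s = (y - T) mod int p" by (simp add: s_def)
        then have "int s + T - y = (y - T) mod int p - (y - T)" by simp
        then show ?thesis by (metis mod_eq_dvd_iff mod_mod_trivial)
      qed
      have "p dvd (\<Prod>i<k. aa i * s + bb i)" using n(2) p(2) dvd_trans by blast
      then obtain j where j: "j < k" "p dvd aa j * s + bb j"
        using p(1) by (auto simp: prime_dvd_prod_iff)
      then have "int p dvd int (aa j * s + bb j)" by (simp only: int_dvd_int_iff)
      then have "int p dvd a (h j) * (int s + T) + b (h j)"
        unfolding keyabs[OF j(1)] by simp
      moreover have "a (h j) * (int s + T) + b (h j) = a (h j) * y + b (h j) + a (h j) * ((int s + T) - y)"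
        by (simp add: algebra_simps)
      ultimately have "int p dvd a (h j) * y + b (h j)"
        using sp by (metis dvd_add_left_iff dvd_mult)
      then show False using y hI[OF j(1)] by blast
    qed
    show ?thesis using D[unfolded Dickson_def, rule_format, OF k, of aa bb] 1 2 by blast
  qed
  moreover have "(\<lambda>m. int m + T) ` {m. \<forall>i<k. prime (aa i * m + bb i)}
      \<subseteq> {y. \<forall>i\<in>I. prime \<bar>a i * y + b i\<bar>}"
  proof clarify
    fix m i assume m: "\<forall>i<k. prime (aa i * m + bb i)" and i: "i \<in> I"
    then obtain j where j: "j < k" "i = h j" using h by (auto simp: bij_betw_def)
    have "prime (int (aa j * m + bb j))" using m j(1) prime_nat_int_transfer by blast
    then show "prime \<bar>a i * (int m + T) + b i\<bar>" unfolding keyabs[OF j(1)] j(2) .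
  qed
  moreover have "inj (\<lambda>m. int m + T)" by (auto simp: inj_on_def)
  ultimately show ?thesis using infinite_inj_image by blast
qed

lemma finite_linear_preimage:
  fixes a b c :: int
  assumes "a \<noteq> 0"
  shows "finite {y. a * y + b = c}"
proof -
  have "{y. a * y + b = c} \<subseteq> {(c - b) div a}" using assms by auto
  then show ?thesis using finite_subset by blast
qed

lemma infinite_diff_finite: "infinite A \<Longrightarrow> finite B \<Longrightarrow> A - B \<subseteq> C \<Longrightarrow> infinite C"
  by (meson Diff_infinite_finite finite_subset)

text \<open>The negative conditions are treated one at a time: a form proportional to a positive one
  takes only finitely many prime values at the places in question, and any other form is made
  divisible by a suitable large prime through an affine substitution.\<close>

lemma Dickson_int_neg:
  assumes D: "Dickson" and fin: "finite I"
  shows "(\<And>i. i \<in> I \<Longrightarrow> a i \<noteq> 0) \<Longrightarrow> admissible I a b \<Longrightarrow>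
    (\<And>al ga m. (al, ga, m) \<in> set negs \<Longrightarrow> al \<noteq> 0 \<and> m > 0 \<and>
       (\<forall>i\<in>I. \<not> (m * a i = al \<and> m * b i = ga) \<and> \<not> (m * a i = - al \<and> m * b i = - ga))) \<Longrightarrow>
    infinite {y. (\<forall>i\<in>I. prime \<bar>a i * y + b i\<bar>) \<and>
      (\<forall>(al, ga, m)\<in>set negs. \<not> (\<exists>\<pi>. prime \<bar>\<pi>\<bar> \<and> al * y + ga = m * \<pi>))}"
\<comment> \<open>A triple \<open>(al, ga, m)\<close> forbids al * y + ga from being m times a prime
  up to sign. The induction is on the length because the substitution in the second case rewrites
  the remaining triples.\<close>
proof (induction negs arbitrary: a b rule: measure_induct_rule[where f = length])
  case (less negs')
  show ?case
  proof (cases negs')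
    case Nil
    then show ?thesis using Dickson_int[OF D fin, of a b] less.prems by auto
  next
    case (Cons g negs)
    note prems = less.prems[unfolded Cons]
    have len: "length negs < length negs'" by (simp add: Cons)
    obtain al ga m where g: "g = (al, ga, m)" by (cases g)
    have alm: "al \<noteq> 0" "m > 0" using prems(3)[of al ga m] g by auto
    let ?S = "\<lambda>a b negs. {y. (\<forall>i\<in>I. prime \<bar>a i * y + b i\<bar>) \<and>
        (\<forall>(al, ga, m)\<in>set negs. \<not> (\<exists>\<pi>. prime \<bar>\<pi>\<bar> \<and> al * y + ga = m * \<pi>))}"
    show ?thesis
    proof (cases "\<exists>i\<in>I. al * b i = ga * a i")
      case True
      then obtain i where i: "i \<in> I" "al * b i = ga * a i" by blast
      have ai: "a i \<noteq> 0" using prems(1) i(1) by blast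
      have inf: "infinite (?S a b negs)"
      proof (rule less.IH[OF len prems(1) prems(2)])
        show "al \<noteq> 0 \<and> m > 0 \<and>
         (\<forall>i\<in>I. \<not> (m * a i = al \<and> m * b i = ga) \<and> \<not> (m * a i = - al \<and> m * b i = - ga))"
          if "(al, ga, m) \<in> set negs" for al ga m
          using that by (intro prems(3)) simp
      qed
      \<comment> \<open>Once \<open>\<bar>f\<bar>\<close> exceeds C it cannot divide m * a i, so f
        must divide \<pi>. Only finitely many y stay below the bound.\<close>
      define C where "C = \<bar>al\<bar> + \<bar>m * a i\<bar>"
      define B where "B = {y. \<bar>a i * y + b i\<bar> \<le> C}"
      have "finite (\<Union>c\<in>{-C..C}. {y. a i * y + b i = c})" using finite_linear_preimage[OF ai] by auto
      moreover have "B \<subseteq> (\<Union>c\<in>{-C..C}. {y. a i * y + b i = c})" by (auto simp: B_def)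
      ultimately have "finite B" by (rule rev_finite_subset)
      moreover have "?S a b negs - B \<subseteq> ?S a b (g # negs)"
      proof
        fix y assume y: "y \<in> ?S a b negs - B"
        have "\<not> (\<exists>\<pi>. prime \<bar>\<pi>\<bar> \<and> al * y + ga = m * \<pi>)"
        proof
          assume "\<exists>\<pi>. prime \<bar>\<pi>\<bar> \<and> al * y + ga = m * \<pi>"
          then obtain \<pi> where \<pi>: "prime \<bar>\<pi>\<bar>" "al * y + ga = m * \<pi>" by blast
          define f where "f = a i * y + b i"
          have f: "prime \<bar>f\<bar>" "\<bar>f\<bar> > C" using y i(1) by (auto simp: f_def B_def)
          have e: "al * f = (m * a i) * \<pi>"
          proof -
            have "al * f = a i * (al * y) + al * b i" by (simp add: f_def algebra_simps)
            also have "\<dots> = a i * (al * y + ga)" using i(2) by (simp add: algebra_simps)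
            finally show ?thesis using \<pi>(2) by simp
          qed
          have "\<not> \<bar>f\<bar> dvd m * a i"
          proof
            assume "\<bar>f\<bar> dvd m * a i"
            then have "\<bar>f\<bar> \<le> \<bar>m * a i\<bar>" using alm ai by (metis abs_dvd_iff dvd_imp_le_int mult_eq_0_iff abs_abs less_irrefl)
            then show False using f(2) by (simp add: C_def)
          qed
          moreover have "\<bar>f\<bar> dvd (m * a i) * \<pi>" using e by (metis abs_dvd_iff dvd_triv_right)
          ultimately have "\<bar>f\<bar> dvd \<pi>" using f(1) prime_dvd_mult_iff by blast
          then have "\<bar>f\<bar> = \<bar>\<pi>\<bar>" using f(1) \<pi>(1) primes_dvd_imp_eq by (metis dvd_abs_iff)
          then consider "f = \<pi>" | "f = - \<pi>" by linarith
          then have "m * a i = al \<or> m * a i = - al"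
          proof cases
            case 1
            then have "al * f = (m * a i) * f" using e by simp
            then show ?thesis using f(1) by auto
          next
            case 2
            then have "al * f = - (m * a i) * f" using e by simp
            then show ?thesis using f(1) by (metis abs_0 minus_mult_minus mult_cancel_right not_prime_0 minus_minus)
          qed
          then show False
          proof
            assume h: "m * a i = al"
            then have "(m * b i) * a i = ga * a i" using i(2) by (metis mult.assoc mult.commute)
            then show False using ai h prems(3)[of al ga m] g i(1) by auto
          next
            assume h: "m * a i = - al"
            then have "(m * b i) * a i = - ga * a i" using i(2) by (metis mult.assoc mult.commute mult_minus_left)
            then have "m * b i = - ga" using ai by (metis mult_cancel_right)
            then show False using h prems(3)[of al ga m] g i(1) by auto
          qed
        qed
        then show "y \<in> ?S a b (g # negs)" using y g by auto
      qed
      ultimately show ?thesis unfolding Cons by (rule infinite_diff_finite[OF inf])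
    next
      case False
      \<comment> \<open>A prime q above R divides neither m, nor al, nor any of the determinants al
        * b i - ga * a i, all of which are nonzero in this case.\<close>
      define R where "R = \<bar>m\<bar> + \<bar>al\<bar> + (\<Sum>i\<in>I. \<bar>al * b i - ga * a i\<bar>)"
      obtain q0 where q0: "prime q0" "q0 > nat R" using bigger_prime by blast
      define q where "q = int q0"
      have q: "prime q" "q > R" using q0 by (auto simp: q_def)
      have small: "\<not> q dvd z" if "z \<noteq> 0" "\<bar>z\<bar> \<le> R" for z
        using that q(2) zdvd_imp_le[of q "\<bar>z\<bar>"] by auto
      have R0: "(\<Sum>i\<in>I. \<bar>al * b i - ga * a i\<bar>) \<ge> 0" by (intro sum_nonneg) auto
      have qm: "\<not> q dvd m" using alm R0 by (intro small) (auto simp: R_def)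
      have qal: "\<not> q dvd al" using alm R0 by (intro small) (auto simp: R_def)
      have qd: "\<not> q dvd al * b i - ga * a i" if "i \<in> I" for i
      proof (rule small)
        show "al * b i - ga * a i \<noteq> 0" using False that by auto
        have "\<bar>al * b i - ga * a i\<bar> \<le> (\<Sum>i\<in>I. \<bar>al * b i - ga * a i\<bar>)"
          using fin that member_le_sum[of i I "\<lambda>i. \<bar>al * b i - ga * a i\<bar>"] by auto
        then show "\<bar>al * b i - ga * a i\<bar> \<le> R" by (simp add: R_def)
      qed
      have solve: "\<exists>x. q' dvd s * x + t" if "prime q'" "\<not> q' dvd s" for q' s t :: int
      proof -
        have "coprime s q'" using that prime_imp_coprime coprime_commute by blast
        then obtain x where "[s * x = - t] (mod q')" using cong_solve_coprime_int cong_mult_rcancel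
          by (metis cong_scalar_right mult.assoc mult_1)
        then have "q' dvd s * x - (- t)" using cong_iff_dvd_diff by blast
        then show ?thesis by auto
      qed
      \<comment> \<open>After y is replaced by q * y + \<rho>, the forbidden form is always
        divisible by q, so the prime in question could only be q or - q. The positive forms stay
        admissible at q because q does not divide the determinants.\<close>
      obtain \<rho> where \<rho>: "q dvd al * \<rho> + ga" using solve[OF q(1) qal] by blast
      let ?a = "\<lambda>i. a i * q" and ?b = "\<lambda>i. a i * \<rho> + b i"
      let ?negs = "map (\<lambda>(al, ga, m). (al * q, al * \<rho> + ga, m)) negs"
      have q0': "q \<noteq> 0" using q(1) by auto
      have 1: "?a i \<noteq> 0" if "i \<in> I" for i using prems(1)[OF that] q0' by simp
      have 2: "admissible I ?a ?b" unfolding admissible_def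
      proof (intro allI impI)
        fix p :: int assume p: "prime p"
        show "\<exists>y. \<forall>i\<in>I. \<not> p dvd a i * q * y + (a i * \<rho> + b i)"
        proof (cases "p = q")
          case True
          have "\<not> q dvd a i * \<rho> + b i" if i: "i \<in> I" for i
          proof
            assume "q dvd a i * \<rho> + b i"
            then have "q dvd al * (a i * \<rho> + b i) - a i * (al * \<rho> + ga)" using \<rho> by simp
            then show False using qd[OF i] by (simp add: algebra_simps)
          qed
          then show ?thesis using True by (intro exI[of _ 0]) auto
        next
          case False
          obtain y where y: "\<forall>i\<in>I. \<not> p dvd a i * y + b i"
            using prems(2) p unfolding admissible_def by blast
          have "\<not> p dvd q" using False p q(1) primes_dvd_imp_eq by blast
          then obtain z where z: "p dvd q * z + (\<rho> - y)" using solve[OF p] by blast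
          have "\<not> p dvd a i * q * z + (a i * \<rho> + b i)" if i: "i \<in> I" for i
          proof
            assume "p dvd a i * q * z + (a i * \<rho> + b i)"
            then have "p dvd (a i * q * z + (a i * \<rho> + b i)) - a i * (q * z + (\<rho> - y))" using z by simp
            then have "p dvd a i * y + b i" by (simp add: algebra_simps)
            then show False using y i by blast
          qed
          then show ?thesis by blast
        qed
      qed
      have 3: "al' \<noteq> 0 \<and> m' > 0 \<and>
         (\<forall>i\<in>I. \<not> (m' * ?a i = al' \<and> m' * ?b i = ga') \<and> \<not> (m' * ?a i = - al' \<and> m' * ?b i = - ga'))"
        if mem: "(al', ga', m') \<in> set ?negs" for al' ga' m'
      proof -
        obtain al1 ga1 where n: "(al1, ga1, m') \<in> set negs" "al' = al1 * q" "ga' = al1 * \<rho> + ga1"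
          using mem by auto
        have h: "al1 \<noteq> 0 \<and> m' > 0 \<and>
         (\<forall>i\<in>I. \<not> (m' * a i = al1 \<and> m' * b i = ga1) \<and> \<not> (m' * a i = - al1 \<and> m' * b i = - ga1))"
          using prems(3)[of al1 ga1 m'] n(1) by simp
        have "\<not> (m' * ?a i = al' \<and> m' * ?b i = ga')" "\<not> (m' * ?a i = - al' \<and> m' * ?b i = - ga')"
          if i: "i \<in> I" for i
        proof -
          show "\<not> (m' * ?a i = al' \<and> m' * ?b i = ga')"
          proof
            assume x: "m' * ?a i = al' \<and> m' * ?b i = ga'"
            then have "(m' * a i) * q = al1 * q" using n(2) by (simp add: mult.assoc)
            then have y: "m' * a i = al1" using q0' by simp
            have "(m' * a i) * \<rho> + m' * b i = al1 * \<rho> + ga1" using x n(3) by (simp add: algebra_simps)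
            then have "m' * b i = ga1" unfolding y by simp
            then show False using h y i by blast
          qed
          show "\<not> (m' * ?a i = - al' \<and> m' * ?b i = - ga')"
          proof
            assume x: "m' * ?a i = - al' \<and> m' * ?b i = - ga'"
            then have "(m' * a i) * q = (- al1) * q" using n(2) by (simp add: mult.assoc)
            then have y: "m' * a i = - al1" using q0' by (metis mult_cancel_right)
            have "(m' * a i) * \<rho> + m' * b i = (- al1) * \<rho> - ga1" using x n(3) by (simp add: algebra_simps)
            then have "m' * b i = - ga1" unfolding y by simp
            then show False using h y i by blast
          qed
        qed
        then show ?thesis using h n(2) q0' by simp
      qed
      have inf: "infinite (?S ?a ?b ?negs)" by (rule less.IH[OF _ 1 2 3]) (simp_all add: Cons)
      \<comment> \<open>The finitely many arguments at which the forbidden form is m times q or -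
        q.\<close>
      define B where "B = {y. (al * q) * y + (al * \<rho> + ga) = m * q} \<union> {y. (al * q) * y + (al * \<rho> + ga) = - m * q}"
      have "finite B" unfolding B_def
        using finite_linear_preimage[of "al * q" "al * \<rho> + ga"] alm(1) q0' by simp
      moreover have "?S ?a ?b ?negs - B \<subseteq> {y. q * y + \<rho> \<in> ?S a b (g # negs)}"
      proof
        fix y assume y: "y \<in> ?S ?a ?b ?negs - B"
        have e: "a i * q * y + (a i * \<rho> + b i) = a i * (q * y + \<rho>) + b i" for a b :: "_ \<Rightarrow> int" and i
          by (simp add: algebra_simps)
        have e': "al * q * y + (al * \<rho> + ga) = al * (q * y + \<rho>) + ga" for al ga
          by (simp add: algebra_simps)
        have 1: "\<forall>i\<in>I. prime \<bar>a i * (q * y + \<rho>) + b i\<bar>" using y by (simp add: e)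
        have 2: "\<forall>(al, ga, m)\<in>set negs. \<not> (\<exists>\<pi>. prime \<bar>\<pi>\<bar> \<and> al * (q * y + \<rho>) + ga = m * \<pi>)"
        proof clarify
          fix al ga m \<pi>
          assume n: "(al, ga, m) \<in> set negs" "prime \<bar>\<pi>\<bar>" "al * (q * y + \<rho>) + ga = m * \<pi>"
          have "(al * q, al * \<rho> + ga, m) \<in> set ?negs" unfolding set_map by (rule image_eqI[OF _ n(1)]) simp
          moreover have "\<forall>(al, ga, m)\<in>set ?negs. \<not> (\<exists>\<pi>. prime \<bar>\<pi>\<bar> \<and> al * y + ga = m * \<pi>)"
            using y by blast
          ultimately have "\<not> (\<exists>\<pi>. prime \<bar>\<pi>\<bar> \<and> al * q * y + (al * \<rho> + ga) = m * \<pi>)" by blast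
          then show False using n(2,3) unfolding e' by blast
        qed
        have 3: "\<not> (\<exists>\<pi>. prime \<bar>\<pi>\<bar> \<and> al * (q * y + \<rho>) + ga = m * \<pi>)"
        proof
          assume "\<exists>\<pi>. prime \<bar>\<pi>\<bar> \<and> al * (q * y + \<rho>) + ga = m * \<pi>"
          then obtain \<pi> where \<pi>: "prime \<bar>\<pi>\<bar>" "al * (q * y + \<rho>) + ga = m * \<pi>" by blast
          have "q dvd (al * \<rho> + ga) + q * (al * y)" using \<rho> by simp
          then have "q dvd m * \<pi>" using \<pi>(2) by (simp add: algebra_simps)
          then have "q dvd \<bar>\<pi>\<bar>" using qm q(1) prime_dvd_mult_iff by auto
          then have "q = \<bar>\<pi>\<bar>" using q(1) \<pi>(1) primes_dvd_imp_eq by blast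
          then have "\<pi> = q \<or> \<pi> = - q" by linarith
          then have "y \<in> B" using \<pi>(2) by (auto simp: B_def e')
          then show False using y by blast
        qed
        show "y \<in> {y. q * y + \<rho> \<in> ?S a b (g # negs)}" using 1 2 3 g by auto
      qed
      ultimately have "infinite {y. q * y + \<rho> \<in> ?S a b (g # negs)}"
        by (rule infinite_diff_finite[OF inf])
      moreover have "inj (\<lambda>y. q * y + \<rho>)" using q0' by (auto simp: inj_on_def)
      moreover have "(\<lambda>y. q * y + \<rho>) ` {y. q * y + \<rho> \<in> ?S a b (g # negs)} \<subseteq> ?S a b (g # negs)"
        by blast
      ultimately show ?thesis unfolding Cons by (rule infinite_inj_image)
    qed
  qed
qed

text \<open>With x = \<beta> + N * y, where N is \<open>N\<^sub>0\<close> times all the moduli,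
  every positive condition becomes the primality of an integer form in y. Local solvability is
  demanded only for primes up to B, so that the hypotheses form a finite list and can later be
  expressed by formulas.\<close>

lemma Dickson_system:
  fixes n m u :: "'i \<Rightarrow> int" and J :: "(int \<times> int \<times> int) set"
  assumes D: "Dickson" and fin: "finite I" "finite J" "finite E" and N0: "N\<^sub>0 > 0"
    and I: "\<And>i. i \<in> I \<Longrightarrow> n i \<noteq> 0 \<and> m i > 0 \<and> m i dvd n i * \<beta> + u i"
    and B: "int (card I) \<le> B" "N\<^sub>0 \<le> B" "\<And>i. i \<in> I \<Longrightarrow> \<bar>n i\<bar> \<le> B \<and> m i \<le> B"
    and loc: "\<And>p i. prime p \<Longrightarrow> p \<le> B \<Longrightarrow> i \<in> I \<Longrightarrow> \<not> p * m i dvd n i * \<beta> + u i"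
    and J: "\<And>n' m' w. (n', m', w) \<in> J \<Longrightarrow> n' \<noteq> 0 \<and> m' > 0"
    and IJ: "\<And>n' m' w i. (n', m', w) \<in> J \<Longrightarrow> i \<in> I \<Longrightarrow>
       \<not> (m' * n i = m i * n' \<and> m' * u i = m i * w) \<and>
       \<not> (m' * n i = - (m i * n') \<and> m' * u i = - (m i * w))"
  shows "\<exists>x. N\<^sub>0 dvd x - \<beta> \<and> x \<notin> E \<and> (\<forall>i\<in>I. \<exists>\<pi>. prime \<bar>\<pi>\<bar> \<and> n i * x + u i = m i * \<pi>) \<and>
    (\<forall>(n', m', w)\<in>J. \<not> (\<exists>\<pi>. prime \<bar>\<pi>\<bar> \<and> n' * x + w = m' * \<pi>))"
proof -
  define N where "N = N\<^sub>0 * prod m I"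
  have N: "N > 0" using N0 I fin by (auto simp: N_def intro!: mult_pos_pos prod_pos)
  have mN: "m i dvd N" if "i \<in> I" for i
    unfolding N_def using dvd_prodI[OF fin(1) that, of m] by simp
  define a where "a i = n i * (N div m i)" for i
  define b where "b i = (n i * \<beta> + u i) div m i" for i
  have ma: "m i * a i = n i * N" if "i \<in> I" for i
    using mN[OF that] by (simp add: a_def)
  have mb: "m i * b i = n i * \<beta> + u i" if "i \<in> I" for i
    using I[OF that] by (simp add: b_def)
  have m0: "m i \<noteq> 0" if "i \<in> I" for i using I[OF that] by auto
  have a0: "a i \<noteq> 0" if "i \<in> I" for i
  proof
    assume "a i = 0"
    then have "n i * N = 0" using ma[OF that] by simp
    then show False using I[OF that] N by simp
  qed
  have adm: "admissible I a b" unfolding admissible_def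
  proof (intro allI impI)
    fix p :: int assume p: "prime p"
    show "\<exists>y. \<forall>i\<in>I. \<not> p dvd a i * y + b i"
    proof (cases "p \<le> B")
      \<comment> \<open>For small primes y = 0, that is x = \<beta>, already works by
        \<open>loc\<close>.\<close>
      case True
      have "\<not> p dvd b i" if "i \<in> I" for i
      proof
        assume "p dvd b i"
        then have "p * m i dvd m i * b i" by (simp add: mult.commute)
        then show False using loc[OF p True that] mb[OF that] by simp
      qed
      then show ?thesis by (intro exI[of _ 0]) simp
    next
      case False
      have big: "\<not> p dvd z" if "z > 0" "z \<le> B" for z using that False zdvd_imp_le[of p z] by auto
      have pN: "\<not> p dvd N"
      proof
        assume "p dvd N"
        then have "p dvd N\<^sub>0 \<or> (\<exists>i\<in>I. p dvd m i)"
          using p fin(1) by (simp add: N_def prime_dvd_mult_iff prime_dvd_prod_iff)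
        then show False using big I B N0 by blast
      qed
      have pa: "\<not> p dvd a i" if i: "i \<in> I" for i
      proof
        assume "p dvd a i"
        then have "p dvd n i * N" using ma[OF i] by (metis dvd_mult)
        then have "p dvd \<bar>n i\<bar>" using pN p prime_dvd_mult_iff by auto
        then show False using big[of "\<bar>n i\<bar>"] I[OF i] B(3)[OF i] by auto
      qed
      \<comment> \<open>For p > B all leading coefficients are units modulo p, so each form rules
        out one residue class; there are at most card I, hence fewer than p, bad classes.\<close>
      define bad where "bad = {y \<in> {0..<p}. \<exists>i\<in>I. p dvd a i * y + b i}"
      define f where "f y = (SOME i. i \<in> I \<and> p dvd a i * y + b i)" for y
      have f: "f y \<in> I \<and> p dvd a (f y) * y + b (f y)" if "y \<in> bad" for y
        unfolding f_def by (rule someI_ex) (use that in \<open>auto simp: bad_def\<close>)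
      have "inj_on f bad"
      proof (rule inj_onI)
        fix y z assume yz: "y \<in> bad" "z \<in> bad" "f y = f z"
        have "p dvd (a (f y) * y + b (f y)) - (a (f y) * z + b (f y))"
          using f[OF yz(1)] f[OF yz(2)] yz(3) by (intro dvd_diff) auto
        then have "p dvd a (f y) * (y - z)" by (simp add: algebra_simps)
        then have "p dvd y - z" using pa f[OF yz(1)] p prime_dvd_mult_iff by blast
        then have "y mod p = z mod p" by (simp add: mod_eq_dvd_iff)
        then show "y = z" using yz by (auto simp: bad_def)
      qed
      then have "card bad \<le> card I" using f fin(1) by (intro card_inj_on_le[of f]) auto
      then have "card bad < card {0..<p}" using False B(1) by simp
      moreover have "bad \<subseteq> {0..<p}" by (auto simp: bad_def)
      ultimately obtain y where "y \<in> {0..<p}" "y \<notin> bad" by (metis less_irrefl subsetI subset_antisym)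
      then show ?thesis by (auto simp: bad_def)
    qed
  qed
  obtain js where js: "set js = J" using fin(2) finite_list by blast
  define negs where "negs = map (\<lambda>(n', m', w). (n' * N, n' * \<beta> + w, m')) js"
  have negs: "al \<noteq> 0 \<and> k > 0 \<and>
       (\<forall>i\<in>I. \<not> (k * a i = al \<and> k * b i = ga) \<and> \<not> (k * a i = - al \<and> k * b i = - ga))"
    if mem: "(al, ga, k) \<in> set negs" for al ga k
  proof -
    obtain n' w where j: "(n', k, w) \<in> J" "al = n' * N" "ga = n' * \<beta> + w"
      using mem js by (auto simp: negs_def)
    \<comment> \<open>The sign e treats the coincidence of the forms and the coincidence up to sign
      together.\<close>
    have "\<not> (k * a i = e * al \<and> k * b i = e * ga)" if i: "i \<in> I" and e: "e = 1 \<or> e = -1" for i e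
    proof
      assume h: "k * a i = e * al \<and> k * b i = e * ga"
      have "k * (m i * a i) = m i * (e * al)" using h by (metis mult.left_commute)
      then have "(k * n i) * N = (e * (m i * n')) * N" unfolding ma[OF i] j(2) by (simp only: ac_simps)
      then have 1: "k * n i = e * (m i * n')" using N by simp
      have "k * (m i * b i) = m i * (e * ga)" using h by (metis mult.left_commute)
      then have "(k * n i) * \<beta> + k * u i = (e * (m i * n')) * \<beta> + e * (m i * w)"
        unfolding mb[OF i] j(3) by (simp add: algebra_simps)
      then have "k * u i = e * (m i * w)" using 1 by simp
      then show False using 1 e IJ[OF j(1) i] by auto
    qed
    from this[of _ 1] this[of _ "-1"] show ?thesis using J[OF j(1)] j(2) N by auto
  qed
  let ?S = "{y. (\<forall>i\<in>I. prime \<bar>a i * y + b i\<bar>) \<and>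
      (\<forall>(al, ga, m)\<in>set negs. \<not> (\<exists>\<pi>. prime \<bar>\<pi>\<bar> \<and> al * y + ga = m * \<pi>))}"
  have inf: "infinite ?S" by (rule Dickson_int_neg[OF D fin(1) a0 adm negs])
  have "finite ((\<lambda>y. \<beta> + N * y) -` E)" using fin(3) N by (intro finite_vimageI) (auto simp: inj_on_def)
  then have "\<not> ?S \<subseteq> (\<lambda>y. \<beta> + N * y) -` E" using inf finite_subset by blast
  then obtain y where y: "y \<in> ?S" "\<beta> + N * y \<notin> E" by blast
  have "\<exists>\<pi>. prime \<bar>\<pi>\<bar> \<and> n i * (\<beta> + N * y) + u i = m i * \<pi>" if i: "i \<in> I" for i
  proof -
    have "n i * (\<beta> + N * y) + u i = m i * a i * y + m i * b i"
      using ma[OF i] mb[OF i] by (simp add: algebra_simps)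
    then have "n i * (\<beta> + N * y) + u i = m i * (a i * y + b i)" by (simp add: algebra_simps)
    then show ?thesis using y(1) i by blast
  qed
  moreover have "\<not> (\<exists>\<pi>. prime \<bar>\<pi>\<bar> \<and> n' * (\<beta> + N * y) + w = m' * \<pi>)" if "(n', m', w) \<in> J" for n' m' w
  proof -
    have "(n' * N, n' * \<beta> + w, m') \<in> set negs" unfolding negs_def set_map js
      by (rule image_eqI[OF _ that]) simp
    then have "\<not> (\<exists>\<pi>. prime \<bar>\<pi>\<bar> \<and> (n' * N) * y + (n' * \<beta> + w) = m' * \<pi>)" using y(1) by blast
    moreover have "(n' * N) * y + (n' * \<beta> + w) = n' * (\<beta> + N * y) + w" by (simp add: algebra_simps)
    ultimately show ?thesis by simp
  qed
  moreover have "N\<^sub>0 dvd (\<beta> + N * y) - \<beta>" by (simp add: N_def)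
  ultimately show ?thesis using y(2) by blast
qed

section \<open>Formulas expressing conditions on linear forms\<close>

lemma tm_val_cong: "(\<And>x. x \<in> tm_vars t \<Longrightarrow> v x = w x) \<Longrightarrow> tm_val M v t = tm_val M w t"
proof (induction t)
  case (TApp f ts)
  then have "map (tm_val M v) ts = map (tm_val M w) ts" by auto
  then show ?case by (simp only: tm_val.simps)
qed simp

lemma sat_cong: "(\<And>x. x \<in> fm_free \<phi> \<Longrightarrow> v x = w x) \<Longrightarrow> sat M v \<phi> \<longleftrightarrow> sat M w \<phi>"
proof (induction \<phi> arbitrary: v w)
  case (FEq s t)
  then show ?case using tm_val_cong[of s v w M] tm_val_cong[of t v w M] by simp
next
  case (FRel r ts)
  then have "map (tm_val M v) ts = map (tm_val M w) ts" by (auto intro!: tm_val_cong)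
  then show ?case by (simp only: sat.simps)
next
  case (FConj \<phi> \<psi>)
  have "sat M v \<phi> = sat M w \<phi>" "sat M v \<psi> = sat M w \<psi>"
    using FConj.prems by (intro FConj.IH; simp)+
  then show ?case by simp
next
  case (FNeg \<phi>)
  have "sat M v \<phi> = sat M w \<phi>" using FNeg.prems by (intro FNeg.IH) simp
  then show ?case by simp
next
  case (FEx x \<phi>)
  have "sat M (v(x := c)) \<phi> = sat M (w(x := c)) \<phi>" for c using FEx.prems by (intro FEx.IH) auto
  then show ?case by simp
qed

lemma finite_tm_vars: "finite (tm_vars t)"
  by (induction t) auto

lemma finite_fm_free: "finite (fm_free \<phi>)"
  by (induction \<phi>) (auto simp: finite_tm_vars)

section \<open>Renaming of variables, finite conjunctions and blocks of quantifiers\<close>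

primrec tm_ren :: "(nat \<Rightarrow> nat) \<Rightarrow> 'f tm \<Rightarrow> 'f tm" where
  "tm_ren \<pi> (TVar x) = TVar (\<pi> x)"
| "tm_ren \<pi> (TApp f ts) = TApp f (map (tm_ren \<pi>) ts)"

primrec fm_ren :: "(nat \<Rightarrow> nat) \<Rightarrow> ('f, 'r) fm \<Rightarrow> ('f, 'r) fm" where
  "fm_ren \<pi> (FEq s t) = FEq (tm_ren \<pi> s) (tm_ren \<pi> t)"
| "fm_ren \<pi> (FRel r ts) = FRel r (map (tm_ren \<pi>) ts)"
| "fm_ren \<pi> (FNeg \<phi>) = FNeg (fm_ren \<pi> \<phi>)"
| "fm_ren \<pi> (FConj \<phi> \<psi>) = FConj (fm_ren \<pi> \<phi>) (fm_ren \<pi> \<psi>)"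
| "fm_ren \<pi> (FEx x \<phi>) = FEx (\<pi> x) (fm_ren \<pi> \<phi>)"

lemma tm_in_ren: "tm_in L (tm_ren \<pi> t) = tm_in L t"
  by (induction t) (auto simp: list_all_iff)

lemma fm_in_ren [simp]: "fm_in L (fm_ren \<pi> \<phi>) = fm_in L \<phi>"
  by (induction \<phi>) (auto simp: list_all_iff tm_in_ren)

lemma tm_vars_ren: "tm_vars (tm_ren \<pi> t) = \<pi> ` tm_vars t"
  by (induction t) auto

lemma fm_free_ren: "inj \<pi> \<Longrightarrow> fm_free (fm_ren \<pi> \<phi>) = \<pi> ` fm_free \<phi>"
  by (induction \<phi>) (auto simp: tm_vars_ren inj_image_mem_iff image_set_diff dest: injD)

lemma tm_val_ren: "tm_val M v (tm_ren \<pi> t) = tm_val M (v \<circ> \<pi>) t"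
  by (induction t) (auto intro!: arg_cong[where f = "fun_interp M _"])

text \<open>Bound variables are renamed as well; injectivity of \<pi> prevents capture. The
  renamings used later are involutions.\<close>

lemma sat_ren: "bij \<pi> \<Longrightarrow> sat M v (fm_ren \<pi> \<phi>) = sat M (v \<circ> \<pi>) \<phi>"
proof (induction \<phi> arbitrary: v)
  case (FRel r ts)
  have "map (tm_val M v) (map (tm_ren \<pi>) ts) = map (tm_val M (v \<circ> \<pi>)) ts"
    by (simp add: tm_val_ren)
  then show ?case by (simp only: sat.simps fm_ren.simps)
next
  case (FEx x \<phi>)
  have "v(\<pi> x := c) \<circ> \<pi> = (v \<circ> \<pi>)(x := c)" for c
    using FEx.prems by (auto simp: fun_eq_iff bij_def dest: injD)
  then show ?case using FEx.IH[OF FEx.prems] by (simp only: sat.simps fm_ren.simps)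
qed (auto simp: tm_val_ren)

definition FTrue :: "(fsym, 'r) fm" where
  "FTrue = FEq (TApp Zero []) (TApp Zero [])"

definition FConjs :: "(fsym, 'r) fm list \<Rightarrow> (fsym, 'r) fm" where
  "FConjs \<phi>s = foldr FConj \<phi>s FTrue"

definition FExs :: "nat list \<Rightarrow> ('f, 'r) fm \<Rightarrow> ('f, 'r) fm" where
  "FExs xs \<phi> = foldr FEx xs \<phi>"

lemma sat_FConjs [simp]: "sat M v (FConjs \<phi>s) \<longleftrightarrow> (\<forall>\<phi>\<in>set \<phi>s. sat M v \<phi>)"
  by (induction \<phi>s) (auto simp: FConjs_def FTrue_def)

lemma fm_free_FConjs [simp]: "fm_free (FConjs \<phi>s) = (\<Union>\<phi>\<in>set \<phi>s. fm_free \<phi>)"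
  by (induction \<phi>s) (auto simp: FConjs_def FTrue_def)

lemma fm_in_FConjs:
  "fun_arity L Zero = Some 0 \<Longrightarrow> fm_in L (FConjs \<phi>s) \<longleftrightarrow> (\<forall>\<phi>\<in>set \<phi>s. fm_in L \<phi>)"
  by (induction \<phi>s) (auto simp: FConjs_def FTrue_def)

lemma fm_free_FExs [simp]: "fm_free (FExs xs \<phi>) = fm_free \<phi> - set xs"
  by (induction xs) (auto simp: FExs_def)

lemma fm_in_FExs [simp]: "fm_in L (FExs xs \<phi>) = fm_in L \<phi>"
  by (induction xs) (auto simp: FExs_def)

lemma sat_FExs: "sat M v (FExs xs \<phi>) \<longleftrightarrow> (\<exists>u. (\<forall>x. x \<notin> set xs \<longrightarrow> u x = v x) \<and> sat M u \<phi>)"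
proof (induction xs arbitrary: v)
  case Nil
  have "u = v" if "\<forall>x. u x = v x" for u using that by auto
  then show ?case by (auto simp: FExs_def)
next
  case (Cons y xs)
  have "sat M v (FExs (y # xs) \<phi>) \<longleftrightarrow> (\<exists>c. sat M (v(y := c)) (FExs xs \<phi>))"
    by (simp add: FExs_def)
  also have "\<dots> \<longleftrightarrow> (\<exists>c u. (\<forall>x. x \<notin> set xs \<longrightarrow> u x = (v(y := c)) x) \<and> sat M u \<phi>)"
    using Cons.IH by simp
  also have "\<dots> \<longleftrightarrow> (\<exists>u. (\<forall>x. x \<notin> set (y # xs) \<longrightarrow> u x = v x) \<and> sat M u \<phi>)"
  proof safe
    fix c u assume "\<forall>x. x \<notin> set xs \<longrightarrow> u x = (v(y := c)) x" "sat M u \<phi>"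
    then show "\<exists>u. (\<forall>x. x \<notin> set (y # xs) \<longrightarrow> u x = v x) \<and> sat M u \<phi>"
      by (intro exI[of _ u]) auto
  next
    fix u assume "\<forall>x. x \<notin> set (y # xs) \<longrightarrow> u x = v x" "sat M u \<phi>"
    then show "\<exists>c u. (\<forall>x. x \<notin> set xs \<longrightarrow> u x = (v(y := c)) x) \<and> sat M u \<phi>"
      by (intro exI[of _ "u y"] exI[of _ u]) auto
  qed
  finally show ?case .
qed

text \<open>A theory contains only sentences, so the universal closure of the formula is what is
  transferred.\<close>

lemma Th_transfer:
  assumes "models M (Th L N)" "fm_in L \<phi>" "\<And>v. sat N v \<phi>"
  shows "sat M v \<phi>"
proof -
  obtain xs where xs: "set xs = fm_free \<phi>" using finite_list[OF finite_fm_free] by blast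
  define \<sigma> where "\<sigma> = FNeg (FExs xs (FNeg \<phi>))"
  have "\<sigma> \<in> Th L N" using assms(2,3) xs by (auto simp: \<sigma>_def Th_def formulas_def holds_def sat_FExs)
  then have "sat M (\<lambda>i. [] ! i) \<sigma>" using assms(1) by (auto simp: models_def holds_def)
  moreover have "sat M (\<lambda>i. [] ! i) \<sigma> = sat M v \<sigma>" by (rule sat_cong) (auto simp: \<sigma>_def xs)
  ultimately show ?thesis unfolding \<sigma>_def by (auto simp: sat_FExs)
qed

text \<open>A list of monomials in which \<open>None\<close> stands for the constant 1. The type of
  variables is left open: natural numbers when a form is turned into a formula, elements of the
  model itself in the definition of the closure.\<close>

type_synonym 'b form = "(int \<times> 'b option) list"

definition fvars :: "'b form \<Rightarrow> 'b set" where
  "fvars t = {x. \<exists>n. (n, Some x) \<in> set t}"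

definition fscale :: "int \<Rightarrow> 'b form \<Rightarrow> 'b form" where
  "fscale k t = map (\<lambda>(n, z). (k * n, z)) t"

definition fren :: "('b \<Rightarrow> 'c) \<Rightarrow> 'b form \<Rightarrow> 'c form" where
  "fren f t = map (\<lambda>(n, z). (n, map_option f z)) t"

primrec fcoef :: "'b \<Rightarrow> 'b form \<Rightarrow> int" where
  "fcoef y [] = 0"
| "fcoef y (c # t) = (if snd c = Some y then fst c else 0) + fcoef y t"

definition frest :: "'b \<Rightarrow> 'b form \<Rightarrow> 'b form" where
  "frest y t = filter (\<lambda>c. snd c \<noteq> Some y) t"

lemma fvars_Nil [simp]: "fvars [] = {}"
  by (simp add: fvars_def)

lemma fvars_Cons [simp]: "fvars ((n, z) # t) = set_option z \<union> fvars t"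
  by (auto simp: fvars_def)

lemma fvars_append [simp]: "fvars (s @ t) = fvars s \<union> fvars t"
  by (auto simp: fvars_def)

lemma fvars_scale [simp]: "fvars (fscale k t) = fvars t"
  by (force simp: fvars_def fscale_def)

lemma fvars_ren [simp]: "fvars (fren f t) = f ` fvars t"
  by (induction t) (auto simp: fren_def option.set_map)

lemma fvars_rest [simp]: "fvars (frest y t) = fvars t - {y}"
  by (auto simp: fvars_def frest_def)

lemma finite_fvars [simp]: "finite (fvars t)"
  by (induction t) auto

primrec tm_mult :: "nat \<Rightarrow> fsym tm \<Rightarrow> fsym tm" where
  "tm_mult 0 s = TApp Zero []"
| "tm_mult (Suc n) s = TApp Plus [s, tm_mult n s]"

definition tm_var :: "nat option \<Rightarrow> fsym tm" where
  "tm_var z = (case z of None \<Rightarrow> TApp One [] | Some x \<Rightarrow> TVar x)"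

text \<open>Subtraction is not available in the smaller language, so the terms with positive and
  with negative coefficients are collected on different sides of an equation.\<close>

primrec tm_pos :: "nat form \<Rightarrow> fsym tm" where
  "tm_pos [] = TApp Zero []"
| "tm_pos (c # t) = TApp Plus [tm_mult (nat (fst c)) (tm_var (snd c)), tm_pos t]"

primrec tm_neg :: "nat form \<Rightarrow> fsym tm" where
  "tm_neg [] = TApp Zero []"
| "tm_neg (c # t) = TApp Plus [tm_mult (nat (- fst c)) (tm_var (snd c)), tm_neg t]"

definition fm_zero :: "nat form \<Rightarrow> (fsym, rsym) fm" where
  "fm_zero t = FEq (tm_pos t) (tm_neg t)"

definition fresh :: "nat form \<Rightarrow> nat" where
  "fresh t = Suc (\<Sum>x\<in>fvars t. x)"

text \<open>The existential quantifier keeps divisibility, and likewise \<open>fm_prime\<close>,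
  inside the language without \<open>Minus\<close>, \<open>Pr_mult\<close> and
  \<open>Div_by\<close>. This is why both languages have the same definable sets.\<close>

definition fm_dvd :: "int \<Rightarrow> nat form \<Rightarrow> (fsym, rsym) fm" where
  "fm_dvd m t = FEx (fresh t) (fm_zero ((- m, Some (fresh t)) # t))"

definition fm_prime :: "int \<Rightarrow> nat form \<Rightarrow> (fsym, rsym) fm" where
  "fm_prime m t = FEx (fresh t) (FConj (FRel Pr [TVar (fresh t)]) (fm_zero ((- m, Some (fresh t)) # t)))"

lemma fresh: "fresh t \<notin> fvars t"
proof
  assume "fresh t \<in> fvars t"
  then have "fresh t \<le> (\<Sum>x\<in>fvars t. x)" using member_le_sum[of "fresh t" "fvars t" "\<lambda>x. x"] by simp
  then show False by (simp add: fresh_def)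
qed

lemma tm_vars_mult: "tm_vars (tm_mult n s) \<subseteq> tm_vars s"
  by (induction n) auto

lemma tm_vars_var: "tm_vars (tm_var z) = set_option z"
  by (cases z) (auto simp: tm_var_def)

lemma tm_vars_pos: "tm_vars (tm_pos t) \<subseteq> fvars t" and tm_vars_neg: "tm_vars (tm_neg t) \<subseteq> fvars t"
  using tm_vars_mult tm_vars_var by (induction t; fastforce)+

lemma fm_free_zero: "fm_free (fm_zero t) \<subseteq> fvars t"
  using tm_vars_pos tm_vars_neg by (auto simp: fm_zero_def)

lemma fm_free_dvd: "fm_free (fm_dvd m t) \<subseteq> fvars t"
  using fm_free_zero[of "(- m, Some (fresh t)) # t"] by (auto simp: fm_dvd_def)

lemma fm_free_prime: "fm_free (fm_prime m t) \<subseteq> fvars t"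
  using fm_free_zero[of "(- m, Some (fresh t)) # t"] by (auto simp: fm_prime_def)

lemma arity_L_plus_Pr:
  "fun_arity L_plus_Pr Zero = Some 0" "fun_arity L_plus_Pr One = Some 0"
  "fun_arity L_plus_Pr Plus = Some 2" "rel_arity L_plus_Pr Pr = Some 1"
  by (simp_all add: L_plus_Pr_def)

lemma tm_in_mult: "tm_in L_plus_Pr s \<Longrightarrow> tm_in L_plus_Pr (tm_mult n s)"
  by (induction n) (auto simp: arity_L_plus_Pr)

lemma tm_in_var: "tm_in L_plus_Pr (tm_var z)"
  by (cases z) (auto simp: arity_L_plus_Pr tm_var_def)

lemma tm_in_mult_var [simp]: "tm_in L_plus_Pr (tm_mult n (tm_var z))"
  by (intro tm_in_mult tm_in_var)

lemma tm_in_pos: "tm_in L_plus_Pr (tm_pos t)" and tm_in_neg: "tm_in L_plus_Pr (tm_neg t)"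
  by (induction t) (auto simp: arity_L_plus_Pr tm_in_mult tm_in_var)

lemma fm_in_basic [simp]:
  "fm_in L_plus_Pr (fm_zero t)" "fm_in L_plus_Pr (fm_dvd m t)" "fm_in L_plus_Pr (fm_prime m t)"
  by (simp_all add: fm_zero_def fm_dvd_def fm_prime_def tm_in_pos tm_in_neg arity_L_plus_Pr)

lemma fm_in_FConjs_plus_Pr [simp]:
  "fm_in L_plus_Pr (FConjs \<phi>s) \<longleftrightarrow> (\<forall>\<phi>\<in>set \<phi>s. fm_in L_plus_Pr \<phi>)"
  by (rule fm_in_FConjs) (simp add: arity_L_plus_Pr)

text \<open>Inverses are only asserted to exist, because one of the two languages has no symbol for
  negation. The integers are an instance too, so the same notation evaluates a formula on both sides
  of a transfer.\<close>

locale zgroup =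
  fixes M :: "(fsym, rsym, 'a) fo_struct"
  assumes plus_comm: "fun_interp M Plus [x, y] = fun_interp M Plus [y, x]"
    and plus_assoc: "fun_interp M Plus [fun_interp M Plus [x, y], z] = fun_interp M Plus [x, fun_interp M Plus [y, z]]"
    and plus_zero: "fun_interp M Plus [fun_interp M Zero [], x] = x"
    and plus_inv: "\<exists>y. fun_interp M Plus [x, y] = fun_interp M Zero []"
begin

definition add (infixl "\<oplus>" 65) where "x \<oplus> y = fun_interp M Plus [x, y]"
definition zer where "zer = fun_interp M Zero []"
definition one where "one = fun_interp M One []"
definition neg where "neg x = (SOME y. x \<oplus> y = zer)"
definition sub (infixl "\<ominus>" 65) where "x \<ominus> y = x \<oplus> neg y"

sublocale G: ab_group_add where plus = add and zero = zer and minus = sub and uminus = neg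
proof
  have n: "x \<oplus> neg x = zer" for x
    unfolding neg_def by (rule someI_ex) (use plus_inv in \<open>simp add: add_def zer_def\<close>)
  have c: "x \<oplus> y = y \<oplus> x" for x y using plus_comm by (simp add: add_def)
  show "x \<oplus> y \<oplus> z = x \<oplus> (y \<oplus> z)" for x y z using plus_assoc by (simp add: add_def)
  show "x \<oplus> y = y \<oplus> x" for x y by (rule c)
  show "zer \<oplus> x = x" for x using plus_zero by (simp add: add_def zer_def)
  show "neg x \<oplus> x = zer" for x using n c by metis
  show "x \<ominus> y = x \<oplus> neg y" for x y by (simp add: sub_def)
qed

lemma diff_add_diff: "(a \<oplus> b) \<ominus> (c \<oplus> d) = (a \<ominus> c) \<oplus> (b \<ominus> d)"
  unfolding sub_def G.minus_add_distrib by (simp only: G.add.assoc G.add.left_commute)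

primrec nsm :: "nat \<Rightarrow> 'a \<Rightarrow> 'a" where
  "nsm 0 x = zer"
| "nsm (Suc n) x = x \<oplus> nsm n x"

definition smul (infixr "\<odot>" 70) where "k \<odot> x = nsm (nat k) x \<ominus> nsm (nat (- k)) x"

lemma nsm_add: "nsm (a + b) x = nsm a x \<oplus> nsm b x"
  by (induction a) (simp_all add: G.add.assoc)

lemma nsm_distrib: "nsm a (x \<oplus> y) = nsm a x \<oplus> nsm a y"
  by (induction a) (simp_all add: G.add.assoc G.add.left_commute)

lemma smul_diff: "(int a - int b) \<odot> x = nsm a x \<ominus> nsm b x"
proof (cases "a \<ge> b")
  case True
  then obtain d where d: "a = b + d" using le_Suc_ex by blast
  show ?thesis by (simp add: smul_def d nsm_add G.add_diff_cancel_left')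
next
  case False
  then obtain d where d: "b = a + d" using le_Suc_ex[of a b] by auto
  have "nsm a x \<ominus> (nsm a x \<oplus> nsm d x) = zer \<ominus> nsm d x"
    by (metis G.diff_diff_add G.diff_self)
  then show ?thesis by (simp add: smul_def d nsm_add)
qed

lemma smul_add_left: "(a + b) \<odot> x = a \<odot> x \<oplus> b \<odot> x"
proof -
  obtain a1 a2 b1 b2 where e: "a = int a1 - int a2" "b = int b1 - int b2" by (metis int_diff_cases)
  have "a + b = int (a1 + b1) - int (a2 + b2)" using e by simp
  then have "(a + b) \<odot> x = nsm (a1 + b1) x \<ominus> nsm (a2 + b2) x" by (simp only: smul_diff)
  also have "\<dots> = (nsm a1 x \<ominus> nsm a2 x) \<oplus> (nsm b1 x \<ominus> nsm b2 x)"
    by (simp add: nsm_add diff_add_diff)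
  finally show ?thesis by (simp add: e smul_diff)
qed

lemma smul_0 [simp]: "0 \<odot> x = zer" by (simp add: smul_def)
lemma smul_1 [simp]: "1 \<odot> x = x" by (simp add: smul_def)

lemma smul_neg_left [simp]: "(- a) \<odot> x = neg (a \<odot> x)"
  using smul_add_left[of "- a" a x] by (simp add: G.eq_neg_iff_add_eq_0)

lemma smul_diff_left: "(a - b) \<odot> x = a \<odot> x \<ominus> b \<odot> x"
  using smul_add_left[of a "- b" x] by simp

lemma smul_add_right: "a \<odot> (x \<oplus> y) = a \<odot> x \<oplus> a \<odot> y"
  by (simp add: smul_def nsm_distrib diff_add_diff)

lemma smul_zer [simp]: "a \<odot> zer = zer"
  using smul_add_right[of a zer zer] by simp

lemma smul_neg_right [simp]: "a \<odot> neg x = neg (a \<odot> x)"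
  using smul_add_right[of a "neg x" x] by (simp add: G.eq_neg_iff_add_eq_0)

lemma smul_diff_right: "a \<odot> (x \<ominus> y) = a \<odot> x \<ominus> a \<odot> y"
  using smul_add_right[of a x "neg y"] by simp

lemma smul_smul [simp]: "a \<odot> b \<odot> x = (a * b) \<odot> x"
proof -
  have n: "int k \<odot> b \<odot> x = (int k * b) \<odot> x" for k
    by (induction k) (simp_all add: smul_add_left algebra_simps)
  show ?thesis
  proof (cases "a \<ge> 0")
    case True
    then show ?thesis using n[of "nat a"] by simp
  next
    case False
    then have "a = - int (nat (- a))" by simp
    then show ?thesis using n[of "nat (- a)"] by (metis smul_neg_left mult_minus_left)
  qed
qed

definition val :: "('b \<Rightarrow> 'a) \<Rightarrow> 'b option \<Rightarrow> 'a" where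
  "val v z = (case z of None \<Rightarrow> one | Some x \<Rightarrow> v x)"

lemma val_simps [simp]: "val v None = one" "val v (Some x) = v x"
  by (simp_all add: val_def)

primrec lv :: "('b \<Rightarrow> 'a) \<Rightarrow> 'b form \<Rightarrow> 'a" where
  "lv v [] = zer"
| "lv v (c # t) = fst c \<odot> val v (snd c) \<oplus> lv v t"

lemma lv_append [simp]: "lv v (s @ t) = lv v s \<oplus> lv v t"
  by (induction s) (simp_all add: G.add.assoc)

lemma lv_scale [simp]: "lv v (fscale k t) = k \<odot> lv v t"
  by (induction t) (simp_all add: fscale_def smul_add_right case_prod_beta)

lemma lv_ren [simp]: "lv v (fren f t) = lv (\<lambda>x. v (f x)) t"
  by (induction t) (auto simp: fren_def val_def split: option.splits)

lemma lv_cong: "(\<And>x. x \<in> fvars t \<Longrightarrow> v x = w x) \<Longrightarrow> lv v t = lv w t"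
proof (induction t)
  case (Cons c t)
  obtain n z where c: "c = (n, z)" by (cases c)
  have "val v z = val w z" using Cons.prems c by (cases z) auto
  then show ?case using Cons c by auto
qed simp

lemma lv_split: "lv v t = fcoef y t \<odot> v y \<oplus> lv v (frest y t)"
  by (induction t) (auto simp: frest_def smul_add_left G.add.assoc G.add.left_commute val_def)

definition isP where "isP x \<longleftrightarrow> rel_interp M Pr [x]"
definition prm :: "int \<Rightarrow> 'a \<Rightarrow> bool" where "prm m x \<longleftrightarrow> (\<exists>y. isP y \<and> x = m \<odot> y)"
definition dvm :: "int \<Rightarrow> 'a \<Rightarrow> bool" where "dvm m x \<longleftrightarrow> (\<exists>y. x = m \<odot> y)"

lemma tm_val_mult: "tm_val M v (tm_mult n s) = nsm n (tm_val M v s)"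
  by (induction n) (simp_all add: add_def zer_def)

lemma tm_val_var: "tm_val M v (tm_var z) = val v z"
  by (cases z) (simp_all add: tm_var_def one_def)

lemma tm_val_pos_neg: "lv v t = tm_val M v (tm_pos t) \<ominus> tm_val M v (tm_neg t)"
proof (induction t)
  case Nil
  then show ?case by (simp add: zer_def)
next
  case (Cons c t)
  then show ?case
    by (simp add: tm_val_mult tm_val_var add_def[symmetric] smul_def diff_add_diff)
qed

lemma sat_zero [simp]: "sat M v (fm_zero t) \<longleftrightarrow> lv v t = zer"
  by (simp add: fm_zero_def tm_val_pos_neg)

lemma lv_fresh [simp]: "lv (v(fresh t := y)) t = lv v t"
  using fresh by (intro lv_cong) auto

lemma sat_dvd [simp]: "sat M v (fm_dvd m t) \<longleftrightarrow> dvm m (lv v t)"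
  by (auto simp: fm_dvd_def dvm_def G.right_minus_eq)

lemma sat_prime [simp]: "sat M v (fm_prime m t) \<longleftrightarrow> prm m (lv v t)"
  by (auto simp: fm_prime_def prm_def isP_def G.right_minus_eq)

end

interpretation Z: zgroup Z_struct
proof
  show "\<exists>y. fun_interp Z_struct Plus [x, y] = fun_interp Z_struct Zero []" for x
    by (rule exI[of _ "- x"]) (simp add: Z_struct_def)
qed (simp_all add: Z_struct_def)

lemma Z_simps [simp]: "Z.add x y = x + y" "Z.zer = 0" "Z.one = 1"
  unfolding Z.add_def Z.zer_def Z.one_def by (simp_all add: Z_struct_def)

lemma Z_neg [simp]: "Z.neg x = - x"
  using Z.G.left_minus[of x] by simp

lemma Z_sub [simp]: "Z.sub x y = x - y"
  by (simp add: Z.sub_def)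

lemma Z_smul [simp]: "Z.smul k x = k * x"
proof -
  have "Z.nsm n x = int n * x" for n by (induction n) (simp_all add: algebra_simps)
  then show ?thesis by (simp add: Z.smul_def)
qed

lemma Z_prm: "Z.prm m x \<longleftrightarrow> (\<exists>\<pi>. prime \<bar>\<pi>\<bar> \<and> x = m * \<pi>)"
  unfolding Z.prm_def Z.isP_def Z_smul by (simp add: Z_struct_def Prime_pm_iff)

lemma Z_dvm: "Z.dvm m x \<longleftrightarrow> m dvd x"
  by (auto simp: Z.dvm_def)

section \<open>Models of the theory of the integers\<close>

locale zmodel =
  fixes M :: "(fsym, rsym, 'a) fo_struct"
  assumes models_M: "models M T_plus_Pr"
begin

lemma transfer: "fm_in L_plus_Pr \<phi> \<Longrightarrow> (\<And>v. sat Z_struct v \<phi>) \<Longrightarrow> sat M v \<phi>"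
  using Th_transfer models_M unfolding T_plus_Pr_def by blast

end

sublocale zmodel \<subseteq> zgroup M
proof
  let ?t = "\<lambda>s t. TApp Plus [s, t]" and ?o = "TApp Zero []"
  show "fun_interp M Plus [x, y] = fun_interp M Plus [y, x]" for x y
  proof -
    have "sat M (\<lambda>i. [x, y] ! i) (FEq (?t (TVar 0) (TVar 1)) (?t (TVar 1) (TVar 0)))"
      by (rule transfer) (simp_all add: arity_L_plus_Pr, simp add: Z_struct_def)
    then show ?thesis by simp
  qed
  show "fun_interp M Plus [fun_interp M Plus [x, y], z] = fun_interp M Plus [x, fun_interp M Plus [y, z]]" for x y z
  proof -
    have "sat M (\<lambda>i. [x, y, z] ! i) (FEq (?t (?t (TVar 0) (TVar 1)) (TVar 2)) (?t (TVar 0) (?t (TVar 1) (TVar 2))))"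
      by (rule transfer) (simp_all add: arity_L_plus_Pr, simp add: Z_struct_def)
    then show ?thesis by (simp add: numeral_2_eq_2)
  qed
  show "fun_interp M Plus [fun_interp M Zero [], x] = x" for x
  proof -
    have "sat M (\<lambda>_. x) (FEq (?t ?o (TVar 0)) (TVar 0))"
      by (rule transfer) (simp_all add: arity_L_plus_Pr, simp add: Z_struct_def)
    then show ?thesis by simp
  qed
  show "\<exists>y. fun_interp M Plus [x, y] = fun_interp M Zero []" for x
  proof -
    have "sat M (\<lambda>_. x) (FEx 1 (FEq (?t (TVar 0) (TVar 1)) ?o))"
    proof (rule transfer)
      show "sat Z_struct v (FEx 1 (FEq (?t (TVar 0) (TVar 1)) ?o))" for v
        by (simp add: Z_struct_def) (rule exI[of _ "- v 0"], simp)
    qed (simp_all add: arity_L_plus_Pr)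
    then show ?thesis by simp
  qed
qed

context zmodel
begin

lemma one_neq_zer: "one \<noteq> zer"
proof -
  have "sat M v (FNeg (fm_zero [(1, None)]))" for v
    by (rule transfer) simp_all
  then show ?thesis by simp
qed

lemma smul_eq_zer [simp]: "n \<odot> x = zer \<longleftrightarrow> n = 0 \<or> x = zer"
proof -
  have "sat M (\<lambda>_. x) (FNeg (FConj (fm_zero [(n, Some 0)]) (FNeg (fm_zero [(1, Some 0)]))))" if "n \<noteq> 0"
    by (rule transfer) (use that in simp_all)
  then show ?thesis by auto
qed

lemma smul_cancel: "n \<noteq> 0 \<Longrightarrow> n \<odot> x = n \<odot> y \<longleftrightarrow> x = y"
  using smul_eq_zer[of n "x \<ominus> y"] by (auto simp: smul_diff_right G.right_minus_eq)

lemma smul_cancel_left: "x \<noteq> zer \<Longrightarrow> n \<odot> x = m \<odot> x \<longleftrightarrow> n = m"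
  using smul_eq_zer[of "n - m" x] by (auto simp: smul_diff_left G.right_minus_eq)

lemma prm_scale: "k \<noteq> 0 \<Longrightarrow> prm (k * m) (k \<odot> x) \<longleftrightarrow> prm m x"
  unfolding prm_def by (metis smul_smul smul_cancel)

lemma dvm_scale: "k \<noteq> 0 \<Longrightarrow> dvm (k * m) (k \<odot> x) \<longleftrightarrow> dvm m x"
  unfolding dvm_def by (metis smul_smul smul_cancel)

lemma dvm_add: "dvm m x \<Longrightarrow> dvm m y \<Longrightarrow> dvm m (x \<oplus> y)"
  unfolding dvm_def by (metis smul_add_right)

lemma dvm_neg [simp]: "dvm m (neg x) \<longleftrightarrow> dvm m x"
  unfolding dvm_def by (metis smul_neg_right G.minus_minus)

lemma dvm_diff: "dvm m x \<Longrightarrow> dvm m y \<Longrightarrow> dvm m (x \<ominus> y)"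
  using dvm_add[of m x "neg y"] by simp

lemma dvm_smul: "dvm m x \<Longrightarrow> dvm m (k \<odot> x)"
  unfolding dvm_def by (metis smul_smul mult.commute)

lemma dvm_mono: "m dvd k \<Longrightarrow> dvm k x \<Longrightarrow> dvm m x"
  unfolding dvm_def dvd_def by (metis smul_smul)

lemma prm_dvm: "prm m x \<Longrightarrow> dvm m x"
  by (auto simp: prm_def dvm_def)

lemma dvm_cong: "dvm m (x \<ominus> y) \<Longrightarrow> dvm m x \<longleftrightarrow> dvm m y"
  by (metis G.diff_add_cancel G.minus_diff_eq dvm_add dvm_neg)

lemma prm_neg [simp]: "prm m (neg x) \<longleftrightarrow> prm m x"
proof -
  have *: "prm m (neg x)" if "prm m x" for x
  proof -
    have "sat M (\<lambda>_. x) (FNeg (FConj (fm_prime m [(1, Some 0)]) (FNeg (fm_prime m [(-1, Some 0)]))))"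
    proof (rule transfer)
      fix v :: "nat \<Rightarrow> int"
      have "\<exists>\<pi>. prime \<bar>\<pi>\<bar> \<and> - v 0 = m * \<pi>" if "prime \<bar>\<pi>\<bar>" "v 0 = m * \<pi>" for \<pi>
        using that by (intro exI[of _ "- \<pi>"]) simp
      then show "sat Z_struct v (FNeg (FConj (fm_prime m [(1, Some 0)]) (FNeg (fm_prime m [(-1, Some 0)]))))"
        by (auto simp: Z_prm)
    qed simp_all
    then show ?thesis using that by simp
  qed
  show ?thesis using *[of x] *[of "neg x"] by auto
qed

text \<open>For a standard m there are only m residues, so division with remainder is a finite
  disjunction and transfers. Every element thus has standard residues.\<close>

lemma residue_exists:
  assumes "m > 0"
  shows "\<exists>r. dvm m (x \<ominus> r \<odot> one)"
proof -
  let ?\<phi> = "FNeg (FConjs (map (\<lambda>r. FNeg (fm_dvd m [(1, Some 0), (- r, None)])) [0..m-1]))"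
  have "sat M (\<lambda>_. x) ?\<phi>"
  proof (rule transfer)
    fix v :: "nat \<Rightarrow> int"
    have "m dvd v 0 - v 0 mod m" by (simp add: minus_mod_eq_mult_div)
    moreover have "v 0 mod m \<in> {0..m-1}" using assms by simp
    ultimately have "\<exists>r\<in>{0..m-1}. m dvd v 0 - r" by blast
    then show "sat Z_struct v ?\<phi>" by (auto simp: Z_dvm)
  qed simp
  then show ?thesis by auto
qed

text \<open>The prime quotient x / m is divisible by p and so equals p up to sign. The point is that
  x becomes a standard integer: a primality condition at a non-algebraic point can never be
  obstructed by a standard prime.\<close>

lemma prm_dvm_prime_mult:
  assumes "prime p" "m \<noteq> 0" "prm m x" "dvm (p * m) x"
  shows "x = (p * m) \<odot> one \<or> x = (- (p * m)) \<odot> one"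
proof -
  let ?\<phi> = "FNeg (FConjs [fm_prime m [(1, Some 0)], fm_dvd (p * m) [(1, Some 0)],
    FNeg (fm_zero [(1, Some 0), (- (p * m), None)]), FNeg (fm_zero [(1, Some 0), (p * m, None)])])"
  have "sat M (\<lambda>_. x) ?\<phi>"
  proof (rule transfer)
    fix v :: "nat \<Rightarrow> int"
    have "v 0 = p * m \<or> v 0 = - (p * m)"
      if "prime \<bar>\<pi>\<bar>" "v 0 = m * \<pi>" "p * m dvd v 0" for \<pi>
    proof -
      have "p dvd \<pi>" using that(2,3) assms(2) by (simp add: mult.commute)
      then have "p = \<bar>\<pi>\<bar>" using that(1) assms(1) primes_dvd_imp_eq by (metis dvd_abs_iff)
      then have "\<pi> = p \<or> \<pi> = - p" by linarith
      then show ?thesis using that(2) by auto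
    qed
    then show "sat Z_struct v ?\<phi>" by (auto simp: Z_prm Z_dvm)
  qed simp
  then have "x \<ominus> (p * m) \<odot> one = zer \<or> x \<oplus> (p * m) \<odot> one = zer" using assms(3,4) by auto
  then show ?thesis by (auto simp: G.right_minus_eq G.eq_neg_iff_add_eq_0)
qed

text \<open>\<open>Dickson_system\<close> transferred to M. Coefficients and moduli remain standard
  integers, while the constant terms and the base point b are elements of M and enter through
  variables.\<close>

lemma consistency:
  assumes D: "Dickson" and fin: "finite P" "finite Q" "finite E" and N: "N > 0"
    and P: "\<And>n m u. (n, m, u) \<in> P \<Longrightarrow> n \<noteq> 0 \<and> m > 0 \<and> dvm m (n \<odot> b \<oplus> u) \<and>
       (\<forall>p. prime p \<longrightarrow> \<not> dvm (p * m) (n \<odot> b \<oplus> u))"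
    and Q: "\<And>n m w. (n, m, w) \<in> Q \<Longrightarrow> n \<noteq> 0 \<and> m > 0"
    and PQ: "\<And>n m u n' m' w. (n, m, u) \<in> P \<Longrightarrow> (n', m', w) \<in> Q \<Longrightarrow>
       \<not> (m' * n = m * n' \<and> m' \<odot> u = m \<odot> w) \<and>
       \<not> (m' * n = - (m * n') \<and> m' \<odot> u = neg (m \<odot> w))"
  shows "\<exists>x. dvm N (x \<ominus> b) \<and> x \<notin> E \<and> (\<forall>(n, m, u)\<in>P. prm m (n \<odot> x \<oplus> u)) \<and>
    (\<forall>(n, m, w)\<in>Q. \<not> prm m (n \<odot> x \<oplus> w))"
proof -
  define U where "U = (\<lambda>(n, m, u). u) ` P \<union> (\<lambda>(n, m, u). u) ` Q \<union> E"
  have "finite U" using fin by (simp add: U_def)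
  then obtain f :: "'a \<Rightarrow> nat" where f: "inj_on f U"
    using finite_imp_inj_to_nat_seg by blast
  \<comment> \<open>Variable 0 is kept for the solution x and variable 1 for b; the elements of U
    are coded by variables from 2 on.\<close>
  define e where "e u = f u + 2" for u
  define v where "v i = (if i = 1 then b else inv_into U f (i - 2))" for i :: nat
  have ve: "v (e u) = u" if "u \<in> U" for u using f that by (simp add: v_def e_def)
  have v1: "v 1 = b" by (simp add: v_def)
  have U: "u \<in> U" if "(n, m, u) \<in> P \<or> (n, m, u) \<in> Q \<or> u \<in> E" for n m u
    using that by (force simp: U_def)
  have e0: "e u \<noteq> 0" "e u \<noteq> 1" for u by (simp_all add: e_def)
  define R where "R = (\<lambda>(n :: int, m :: int, u). (n, m, e u))"
  define P' where "P' = R ` P"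
  define Q' where "Q' = R ` Q"
  have fin': "finite P'" "finite Q'" using fin by (simp_all add: P'_def Q'_def)
  \<comment> \<open>The bound depends on standard data only, so the same finite set of primes serves
    in the integers and in M.\<close>
  define B where "B = int (card (P')) + N + (\<Sum>(n, m, i)\<in>P'. \<bar>n\<bar> + \<bar>m\<bar>)"
  let ?pr = "{p::int. prime p \<and> p \<le> B}"
  have "?pr \<subseteq> {0..B}" using prime_ge_0_int by auto
  then have finpr: "finite ?pr" using finite_subset by blast
  \<comment> \<open>H collects the hypotheses and C the desired properties of x. Coefficients are
    standard, so their proportionality is decided outside the formulas; only the constant terms are
    compared inside them.\<close>
  define H :: "(fsym, rsym) fm set" where
   "H = (\<Union>(n, m, i)\<in>P'. {fm_dvd m [(n, Some 1), (1, Some i)]}) \<union>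
     (\<Union>(n, m, i)\<in>P'. \<Union>p\<in>?pr. {FNeg (fm_dvd (p * m) [(n, Some 1), (1, Some i)])}) \<union>
     (\<Union>(n, m, i)\<in>P'. \<Union>(n', m', j)\<in>Q'.
        if m' * n = m * n' then {FNeg (fm_zero [(m', Some i), (- m, Some j)])} else {}) \<union>
     (\<Union>(n, m, i)\<in>P'. \<Union>(n', m', j)\<in>Q'.
        if m' * n = - (m * n') then {FNeg (fm_zero [(m', Some i), (m, Some j)])} else {})"
  define C :: "(fsym, rsym) fm set" where
   "C = {fm_dvd N [(1, Some 0), (- 1, Some 1)]} \<union>
     (\<Union>u\<in>E. {FNeg (fm_zero [(1, Some 0), (- 1, Some (e u))])}) \<union>
     (\<Union>(n, m, i)\<in>P'. {fm_prime m [(n, Some 0), (1, Some i)]}) \<union>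
     (\<Union>(n, m, j)\<in>Q'. {FNeg (fm_prime m [(n, Some 0), (1, Some j)])})"
  have "finite H" unfolding H_def using fin' finpr by (auto split: if_splits)
  then obtain hs where hs: "set hs = H" using finite_list by blast
  have "finite C" unfolding C_def using fin fin' by auto
  then obtain cs where cs: "set cs = C" using finite_list by blast
  let ?\<phi> = "FNeg (FConj (FConjs hs) (FNeg (FEx 0 (FConjs cs))))"
  have "sat M v ?\<phi>"
  proof (rule transfer)
    show "fm_in L_plus_Pr ?\<phi>"
      by (auto simp: hs cs H_def C_def split: if_splits)
    fix v :: "nat \<Rightarrow> int"
    have "sat Z_struct v (FEx 0 (FConjs cs))" if "sat Z_struct v (FConjs hs)"
    proof -
      from that have h: "\<And>\<phi>. \<phi> \<in> H \<Longrightarrow> sat Z_struct v \<phi>" by (simp add: hs)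
      have h1: "m dvd n * v 1 + v i" if "(n, m, i) \<in> P'" for n m i
      proof -
        have "fm_dvd m [(n, Some 1), (1, Some i)] \<in> H" unfolding H_def using that by blast
        from h[OF this] show ?thesis by (simp add: Z_dvm)
      qed
      have h2: "\<not> p * m dvd n * v 1 + v i" if "(n, m, i) \<in> P'" "prime p" "p \<le> B" for n m i p
      proof -
        have "FNeg (fm_dvd (p * m) [(n, Some 1), (1, Some i)]) \<in> H" unfolding H_def using that by blast
        from h[OF this] show ?thesis by (simp add: Z_dvm)
      qed
      have h3: "m' * v i \<noteq> m * v j"
        if "(n, m, i) \<in> P'" "(n', m', j) \<in> Q'" "m' * n = m * n'" for n m i n' m' j
      proof -
        have "FNeg (fm_zero [(m', Some i), (- m, Some j)]) \<in> H" unfolding H_def using that by fastforce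
        from h[OF this] show ?thesis by simp
      qed
      have h4: "m' * v i \<noteq> - (m * v j)"
        if "(n, m, i) \<in> P'" "(n', m', j) \<in> Q'" "m' * n = - (m * n')" for n m i n' m' j
      proof -
        have "FNeg (fm_zero [(m', Some i), (m, Some j)]) \<in> H" unfolding H_def using that by fastforce
        from h[OF this] show ?thesis by simp
      qed
      \<comment> \<open>The system is indexed by P' rather than by value triples, because in the
        integers distinct variables may receive equal values.\<close>
      have "\<exists>x. N dvd x - v 1 \<and> x \<notin> (\<lambda>u. v (e u)) ` E \<and>
          (\<forall>i\<in>P'. \<exists>\<pi>. prime \<bar>\<pi>\<bar> \<and> fst i * x + v (snd (snd i)) = fst (snd i) * \<pi>) \<and>
          (\<forall>(n', m', w)\<in>(\<lambda>(n, m, j). (n, m, v j)) ` Q'.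
             \<not> (\<exists>\<pi>. prime \<bar>\<pi>\<bar> \<and> n' * x + w = m' * \<pi>))"
      proof (rule Dickson_system[OF D _ _ _ N, where B = B])
        fix i assume i: "i \<in> P'"
        obtain n m k where nmk: "i = (n, m, k)" by (cases i)
        have nm: "n \<noteq> 0 \<and> m > 0" using P i by (auto simp: R_def P'_def nmk)
        show "fst i \<noteq> 0 \<and> fst (snd i) > 0 \<and> fst (snd i) dvd fst i * v 1 + v (snd (snd i))"
          using nm h1 i nmk by auto
        have "(case i of (n, m, i) \<Rightarrow> \<bar>n\<bar> + \<bar>m\<bar>) \<le> (\<Sum>(n, m, i)\<in>P'. \<bar>n\<bar> + \<bar>m\<bar>)"
          using i fin' by (intro member_le_sum) auto
        then show "\<bar>fst i\<bar> \<le> B \<and> fst (snd i) \<le> B" using N nmk by (auto simp: B_def)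
        show "\<not> p * fst (snd i) dvd fst i * v 1 + v (snd (snd i))" if "prime p" "p \<le> B" for p
          using h2 i nmk that by auto
        fix n' m' w assume "(n', m', w) \<in> (\<lambda>(n, m, j). (n, m, v j)) ` Q'"
        then obtain j where j: "(n', m', j) \<in> Q'" "w = v j" by auto
        show "\<not> (m' * fst i = fst (snd i) * n' \<and> m' * v (snd (snd i)) = fst (snd i) * w) \<and>
          \<not> (m' * fst i = - (fst (snd i) * n') \<and> m' * v (snd (snd i)) = - (fst (snd i) * w))"
          using h3[OF i[unfolded nmk] j(1)] h4[OF i[unfolded nmk] j(1)] nmk j(2) by auto
      next
        show "n' \<noteq> 0 \<and> 0 < m'" if "(n', m', w) \<in> (\<lambda>(n, m, j). (n, m, v j)) ` Q'" for n' m' w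
          using that Q by (auto simp: R_def Q'_def)
        have nn: "0 \<le> (\<Sum>(n, m, i)\<in>P'. \<bar>n\<bar> + \<bar>m\<bar>)" by (intro sum_nonneg) auto
        show "int (card (P')) \<le> B" using nn N by (simp add: B_def)
        show "N \<le> B" using nn by (simp add: B_def)
      qed (use fin fin' in auto)
      then obtain x where X: "N dvd x - v 1" "x \<notin> (\<lambda>u. v (e u)) ` E"
        "\<forall>i\<in>P'. \<exists>\<pi>. prime \<bar>\<pi>\<bar> \<and> fst i * x + v (snd (snd i)) = fst (snd i) * \<pi>"
        "\<forall>(n', m', w)\<in>(\<lambda>(n, m, j). (n, m, v j)) ` Q'. \<not> (\<exists>\<pi>. prime \<bar>\<pi>\<bar> \<and> n' * x + w = m' * \<pi>)"
        by (elim exE conjE) (rule that)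
      have x2: "x \<noteq> v (e u)" if "u \<in> E" for u using X(2) that by blast
      have x3: "\<exists>\<pi>. prime \<bar>\<pi>\<bar> \<and> n * x + v i = m * \<pi>" if "(n, m, i) \<in> P'" for n m i
        using X(3)[rule_format, OF that] by simp
      have x4: "\<not> (\<exists>\<pi>. prime \<bar>\<pi>\<bar> \<and> n * x + v i = m * \<pi>)" if "(n, m, i) \<in> Q'" for n m i
      proof -
        have "(n, m, v i) \<in> (\<lambda>(n, m, j). (n, m, v j)) ` Q'" by (rule image_eqI[OF _ that]) simp
        then show ?thesis using X(4) by blast
      qed
      have R0: "i \<noteq> 0" if "(n, m, i) \<in> P' \<or> (n, m, i) \<in> Q'" for n m i
        using that e0 by (auto simp: R_def P'_def Q'_def)
      have "sat Z_struct (v(0 := x)) \<phi>" if "\<phi> \<in> C" for \<phi>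
        using that unfolding C_def
      proof (elim UnE)
        assume "\<phi> \<in> {fm_dvd N [(1, Some 0), (- 1, Some 1)]}"
        then show ?thesis using X(1) by (simp add: Z_dvm)
      next
        assume "\<phi> \<in> (\<Union>u\<in>E. {FNeg (fm_zero [(1, Some 0), (- 1, Some (e u))])})"
        then show ?thesis using x2 e0 by auto
      next
        assume "\<phi> \<in> (\<Union>(n, m, i)\<in>P'. {fm_prime m [(n, Some 0), (1, Some i)]})"
        then obtain n m i where "(n, m, i) \<in> P'" "\<phi> = fm_prime m [(n, Some 0), (1, Some i)]" by auto
        then show ?thesis using x3[of n m i] R0[of n m i] by (simp add: Z_prm)
      next
        assume "\<phi> \<in> (\<Union>(n, m, i)\<in>Q'. {FNeg (fm_prime m [(n, Some 0), (1, Some i)])})"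
        then obtain n m i where "(n, m, i) \<in> Q'" "\<phi> = FNeg (fm_prime m [(n, Some 0), (1, Some i)])" by auto
        then show ?thesis using x4[of n m i] R0[of n m i] by (simp add: Z_prm)
      qed
      then show ?thesis by (auto simp: cs)
    qed
    then show "sat Z_struct v ?\<phi>" unfolding sat.simps(3,4) by blast
  qed
  moreover have "sat M v (FConjs hs)"
  proof -
    have "sat M v \<phi>" if "\<phi> \<in> H" for \<phi>
    proof -
      have 1: "\<exists>u. i = e u \<and> u = v i \<and> (n, m, u) \<in> P" if "(n, m, i) \<in> P'" for n m i
        using that U ve by (force simp: R_def P'_def Q'_def)
      have 2: "\<exists>u. i = e u \<and> u = v i \<and> (n, m, u) \<in> Q" if "(n, m, i) \<in> Q'" for n m i
        using that U ve by (force simp: R_def P'_def Q'_def)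
      from that show ?thesis unfolding H_def
      proof (elim UnE)
        assume "\<phi> \<in> (\<Union>(n, m, i)\<in>P'. {fm_dvd m [(n, Some 1), (1, Some i)]})"
        then obtain n m i where "(n, m, i) \<in> P'" "\<phi> = fm_dvd m [(n, Some 1), (1, Some i)]" by auto
        then show ?thesis using P 1 v1 by fastforce
      next
        assume "\<phi> \<in> (\<Union>(n, m, i)\<in>P'. \<Union>p\<in>?pr. {FNeg (fm_dvd (p * m) [(n, Some 1), (1, Some i)])})"
        then obtain n m i p where "(n, m, i) \<in> P'" "prime p" "\<phi> = FNeg (fm_dvd (p * m) [(n, Some 1), (1, Some i)])" by auto
        then show ?thesis using P 1 v1 by fastforce
      next
        assume "\<phi> \<in> (\<Union>(n, m, i)\<in>P'. \<Union>(n', m', j)\<in>Q'.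
          if m' * n = m * n' then {FNeg (fm_zero [(m', Some i), (- m, Some j)])} else {})"
        then obtain n m i n' m' j where a: "(n, m, i) \<in> P'" "(n', m', j) \<in> Q'" "m' * n = m * n'"
          "\<phi> = FNeg (fm_zero [(m', Some i), (- m, Some j)])" by (auto split: if_splits)
        have "m' \<odot> v i \<noteq> m \<odot> v j" using 1[OF a(1)] 2[OF a(2)] PQ a(3) by metis
        then show ?thesis by (simp add: a(4) G.right_minus_eq)
      next
        assume "\<phi> \<in> (\<Union>(n, m, i)\<in>P'. \<Union>(n', m', j)\<in>Q'.
          if m' * n = - (m * n') then {FNeg (fm_zero [(m', Some i), (m, Some j)])} else {})"
        then obtain n m i n' m' j where a: "(n, m, i) \<in> P'" "(n', m', j) \<in> Q'" "m' * n = - (m * n')"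
          "\<phi> = FNeg (fm_zero [(m', Some i), (m, Some j)])" by (auto split: if_splits)
        have "m' \<odot> v i \<noteq> neg (m \<odot> v j)" using 1[OF a(1)] 2[OF a(2)] PQ a(3) by metis
        then show ?thesis by (simp add: a(4) G.eq_neg_iff_add_eq_0)
      qed
    qed
    then show ?thesis by (simp add: hs)
  qed
  ultimately have "sat M v (FEx 0 (FConjs cs))" unfolding sat.simps(3,4) by blast
  then obtain x where x: "\<And>\<phi>. \<phi> \<in> C \<Longrightarrow> sat M (v(0 := x)) \<phi>" by (auto simp: cs)
  have "dvm N (x \<ominus> b)"
    using x[of "fm_dvd N [(1, Some 0), (- 1, Some 1)]"] v1 by (simp add: C_def)
  moreover have "x \<notin> E"
  proof
    assume xE: "x \<in> E"
    have "FNeg (fm_zero [(1, Some 0), (- 1, Some (e x))]) \<in> C" using xE by (auto simp: C_def)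
    from x[OF this] show False using ve[OF U, of 0 0 x] xE e0 by simp
  qed
  moreover have "prm m (n \<odot> x \<oplus> u)" if "(n, m, u) \<in> P" for n m u
  proof -
    have "(n, m, e u) \<in> P'" unfolding R_def P'_def Q'_def by (rule image_eqI[OF _ that]) simp
    then have "fm_prime m [(n, Some 0), (1, Some (e u))] \<in> C" by (auto simp: C_def)
    from x[OF this] show ?thesis using ve[OF U, of n m u] that e0 by auto
  qed
  moreover have "\<not> prm m (n \<odot> x \<oplus> u)" if "(n, m, u) \<in> Q" for n m u
  proof -
    have "(n, m, e u) \<in> Q'" unfolding R_def P'_def Q'_def by (rule image_eqI[OF _ that]) simp
    then have "FNeg (fm_prime m [(n, Some 0), (1, Some (e u))]) \<in> C" by (fastforce simp: C_def)
    from x[OF this] show ?thesis using ve[OF U, of n m u] that e0 by auto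
  qed
  ultimately show ?thesis by blast
qed

end

section \<open>Saturation and generic points\<close>

context zgroup
begin

definition cl :: "'a set \<Rightarrow> 'a set" where
  "cl S = {x. \<exists>n t. n \<noteq> 0 \<and> fvars t \<subseteq> S \<and> n \<odot> x = lv (\<lambda>x. x) t}"

lemma cl_mono: "S \<subseteq> T \<Longrightarrow> cl S \<subseteq> cl T"
  unfolding cl_def by blast

lemma cl_image: "x \<in> cl (v ` X) \<longleftrightarrow> (\<exists>n t. n \<noteq> 0 \<and> fvars t \<subseteq> X \<and> n \<odot> x = lv v t)"
proof
  assume "x \<in> cl (v ` X)"
  then obtain n t where nt: "n \<noteq> 0" "fvars t \<subseteq> v ` X" "n \<odot> x = lv (\<lambda>x. x) t" by (auto simp: cl_def)
  have "lv v (fren (inv_into X v) t) = lv (\<lambda>x. x) t"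
    unfolding lv_ren using nt(2) by (intro lv_cong) (auto simp: f_inv_into_f)
  moreover have "fvars (fren (inv_into X v) t) \<subseteq> X" using nt(2) by (auto intro: inv_into_into)
  ultimately show "\<exists>n t. n \<noteq> 0 \<and> fvars t \<subseteq> X \<and> n \<odot> x = lv v t" using nt by metis
next
  assume "\<exists>n t. n \<noteq> 0 \<and> fvars t \<subseteq> X \<and> n \<odot> x = lv v t"
  then obtain n t where nt: "n \<noteq> 0" "fvars t \<subseteq> X" "n \<odot> x = lv v t" by blast
  have "n \<odot> x = lv (\<lambda>x. x) (fren v t)" using nt(3) by simp
  moreover have "fvars (fren v t) \<subseteq> v ` X" using nt(2) by auto
  ultimately show "x \<in> cl (v ` X)" using nt(1) unfolding cl_def by blast
qed

lemma lv_update: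
  "lv (v(y := c)) t = fcoef y t \<odot> c \<oplus> lv v (frest y t)"
proof -
  have "lv (v(y := c)) (frest y t) = lv v (frest y t)" by (rule lv_cong) auto
  then show ?thesis using lv_split[of "v(y := c)" t y] by simp
qed

text \<open>Agreement of the quantifier-free types of two assignments in the language
  \<open>L\<^sup>*\<close>.\<close>

definition qfeq :: "'b set \<Rightarrow> ('b \<Rightarrow> 'a) \<Rightarrow> ('b \<Rightarrow> 'a) \<Rightarrow> bool" where
  "qfeq X v w \<longleftrightarrow> (\<forall>t. fvars t \<subseteq> X \<longrightarrow> (lv v t = zer \<longleftrightarrow> lv w t = zer) \<and>
     (\<forall>m>0. (prm m (lv v t) \<longleftrightarrow> prm m (lv w t)) \<and> (dvm m (lv v t) \<longleftrightarrow> dvm m (lv w t))))"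

text \<open>The second clause concerns forms evaluated at different members of W: an equality there
  must already hold at v. It is what allows one and the same new element to extend all members of W
  at once.\<close>

definition compat :: "'b set \<Rightarrow> ('b \<Rightarrow> 'a) \<Rightarrow> ('b \<Rightarrow> 'a) set \<Rightarrow> bool" where
  "compat X v W \<longleftrightarrow> (\<forall>w\<in>W. qfeq X v w) \<and>
     (\<forall>w\<in>W. \<forall>w'\<in>W. \<forall>t t'. fvars t \<subseteq> X \<longrightarrow> fvars t' \<subseteq> X \<longrightarrow> lv w t = lv w' t' \<longrightarrow> lv v t = lv v t')"

lemma qfeqD:
  assumes "qfeq X v w" "fvars t \<subseteq> X"
  shows "lv v t = zer \<longleftrightarrow> lv w t = zer" "m > 0 \<Longrightarrow> prm m (lv v t) \<longleftrightarrow> prm m (lv w t)"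
    "m > 0 \<Longrightarrow> dvm m (lv v t) \<longleftrightarrow> dvm m (lv w t)"
  using assms unfolding qfeq_def by blast+

lemma compatI:
  assumes "\<And>w. w \<in> W \<Longrightarrow> qfeq X v w"
    "\<And>w w' t t'. w \<in> W \<Longrightarrow> w' \<in> W \<Longrightarrow> fvars t \<subseteq> X \<Longrightarrow> fvars t' \<subseteq> X \<Longrightarrow> lv w t = lv w' t' \<Longrightarrow> lv v t = lv v t'"
  shows "compat X v W"
  using assms unfolding compat_def by blast

lemma compatD:
  assumes "compat X v W" "w \<in> W" "w' \<in> W" "fvars t \<subseteq> X" "fvars t' \<subseteq> X" "lv w t = lv w' t'"
  shows "lv v t = lv v t'"
  using assms unfolding compat_def by blast

lemma compat_qfeq: "compat X v W \<Longrightarrow> w \<in> W \<Longrightarrow> qfeq X v w"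
  unfolding compat_def by blast

lemma qfeq_refl: "qfeq X v v"
  unfolding qfeq_def by blast

lemma qfeq_sym: "qfeq X v w \<Longrightarrow> qfeq X w v"
  unfolding qfeq_def by blast

lemma qfeq_cong:
  assumes "\<And>x. x \<in> X \<Longrightarrow> v x = v' x" "\<And>x. x \<in> X \<Longrightarrow> w x = w' x"
  shows "qfeq X v w \<longleftrightarrow> qfeq X v' w'"
proof -
  have "lv v t = lv v' t" "lv w t = lv w' t" if "fvars t \<subseteq> X" for t
    using assms that by (auto intro!: lv_cong)
  then show ?thesis unfolding qfeq_def by simp
qed

lemma qfeq_ren:
  assumes "qfeq X v w" "f ` Y \<subseteq> X"
  shows "qfeq Y (\<lambda>y. v (f y)) (\<lambda>y. w (f y))"
  unfolding qfeq_def
proof (intro allI impI)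
  fix t assume "fvars t \<subseteq> Y"
  then have "fvars (fren f t) \<subseteq> X" using assms(2) by auto
  from qfeqD[OF assms(1) this]
  show "(lv (\<lambda>y. v (f y)) t = zer \<longleftrightarrow> lv (\<lambda>y. w (f y)) t = zer) \<and>
     (\<forall>m>0. (prm m (lv (\<lambda>y. v (f y)) t) \<longleftrightarrow> prm m (lv (\<lambda>y. w (f y)) t)) \<and>
       (dvm m (lv (\<lambda>y. v (f y)) t) \<longleftrightarrow> dvm m (lv (\<lambda>y. w (f y)) t)))"
    by simp
qed

lemma qfeq_eq:
  assumes "qfeq X v w" "fvars t \<subseteq> X" "fvars t' \<subseteq> X"
  shows "lv v t = lv v t' \<longleftrightarrow> lv w t = lv w t'"
  using qfeqD(1)[OF assms(1), of "t @ fscale (-1) t'"] assms(2,3) by (simp add: G.right_minus_eq)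

text \<open>For a single realization the second clause of \<open>compat\<close> is an equation
  between linear forms and so belongs to the quantifier-free type.\<close>

lemma qfeq_compat: "qfeq X v w \<Longrightarrow> compat X v {w}"
  unfolding compat_def by (simp add: qfeq_eq)

end

context zmodel
begin

lemma finite_smul_eq: "n \<noteq> 0 \<Longrightarrow> finite {x. n \<odot> x = u}"
proof (cases "\<exists>x. n \<odot> x = u")
  case True
  then obtain x where x: "n \<odot> x = u" by blast
  assume "n \<noteq> 0"
  then have "{x. n \<odot> x = u} \<subseteq> {x}" using x smul_cancel by auto
  then show ?thesis using finite_subset by blast
qed simp

text \<open>Both values have the same standard residue r modulo m.\<close>

lemma qfeq_dvm_diff:
  assumes "qfeq X v w" "fvars t \<subseteq> X" "m > 0"
  shows "dvm m (lv w t \<ominus> lv v t)"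
proof -
  obtain r where r: "dvm m (lv v t \<ominus> r \<odot> one)" using residue_exists[OF assms(3)] by blast
  then have "dvm m (lv w t \<ominus> r \<odot> one)"
    using qfeqD(3)[OF assms(1), of "t @ [(- r, None)]" m] assms(2,3) by simp
  from dvm_diff[OF this r] show ?thesis by (simp add: G.diff_diff_eq2)
qed

text \<open>The equation n c = t0 over S determines c. All members of W agree on S, so n c' = t0 is
  the same equation for each of them; its solvability is a divisibility condition, which
  \<open>qfeq\<close> preserves.\<close>

lemma algebraic_extension:
  assumes comp: "compat X v W" and S: "S \<subseteq> X" "\<And>w w' x. w \<in> W \<Longrightarrow> w' \<in> W \<Longrightarrow> x \<in> S \<Longrightarrow> w x = w' x"
    and c: "c \<in> cl (v ` S)"
  shows "\<exists>c'. compat (insert y X) (v(y := c)) ((\<lambda>w. w(y := c')) ` W)"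
proof (cases "W = {}")
  case True
  then show ?thesis by (simp add: compat_def)
next
  case False
  then obtain w0 where w0: "w0 \<in> W" by blast
  obtain n1 t1 where 1: "n1 \<noteq> 0" "fvars t1 \<subseteq> S" "n1 \<odot> c = lv v t1" using c unfolding cl_image by blast
  obtain n t0 where n: "n > 0" "fvars t0 \<subseteq> S" "n \<odot> c = lv v t0"
  proof (cases "n1 > 0")
    case True
    then show ?thesis using that 1 by blast
  next
    case False
    then show ?thesis using that[of "- n1" "fscale (-1) t1"] 1 by simp
  qed
  have "dvm n (lv v t0)" unfolding dvm_def using n(3) by metis
  then have "dvm n (lv w0 t0)" using qfeqD(3)[OF compat_qfeq[OF comp w0]] n S(1) by blast
  then obtain c' where c': "n \<odot> c' = lv w0 t0" by (auto simp: dvm_def)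
  have wt0: "lv w t0 = n \<odot> c'" if "w \<in> W" for w
    unfolding c' by (rule lv_cong) (use S(2)[OF that w0] n(2) in blast)
  \<comment> \<open>\<open>T t\<close> is n times t with n y replaced by t0. Scaling by n changes
    neither zeros nor, with moduli scaled as well, the relations \<open>prm\<close> and
    \<open>dvm\<close>, so questions about y reduce to X.\<close>
  define T where "T t = fscale (fcoef y t) t0 @ fscale n (frest y t)" for t
  have T: "fvars (T t) \<subseteq> X" if "fvars t \<subseteq> insert y X" for t
    using that n(2) S(1) by (auto simp: T_def)
  have vT: "lv v (T t) = n \<odot> lv (v(y := c)) t" for t
    unfolding T_def lv_update by (simp add: smul_add_right n(3)[symmetric] mult.commute)
  have wT: "lv w (T t) = n \<odot> lv (w(y := c')) t" if "w \<in> W" for w t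
    unfolding T_def lv_update by (simp add: smul_add_right wt0[OF that] mult.commute)
  have q: "qfeq (insert y X) (v(y := c)) (w(y := c'))" if w: "w \<in> W" for w
    unfolding qfeq_def
  proof (intro allI impI)
    fix t assume t: "fvars t \<subseteq> insert y X"
    note q = qfeqD[OF compat_qfeq[OF comp w] T[OF t], unfolded vT wT[OF w]]
    show "(lv (v(y := c)) t = zer \<longleftrightarrow> lv (w(y := c')) t = zer) \<and>
     (\<forall>m>0. (prm m (lv (v(y := c)) t) \<longleftrightarrow> prm m (lv (w(y := c')) t)) \<and>
       (dvm m (lv (v(y := c)) t) \<longleftrightarrow> dvm m (lv (w(y := c')) t)))"
      using q(1) q(2)[of "n * _"] q(3)[of "n * _"] n(1) by (simp add: prm_scale dvm_scale)
  qed
  have cr: "lv (v(y := c)) t = lv (v(y := c)) t'"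
    if w: "w \<in> W" "w' \<in> W" and t: "fvars t \<subseteq> insert y X" "fvars t' \<subseteq> insert y X"
      and e: "lv (w(y := c')) t = lv (w'(y := c')) t'" for w w' t t'
  proof -
    have "lv w (T t) = lv w' (T t')" using wT w e by simp
    then have "lv v (T t) = lv v (T t')" using compatD[OF comp w T[OF t(1)] T[OF t(2)]] by blast
    then show ?thesis using vT n(1) smul_cancel by simp
  qed
  have "compat (insert y X) (v(y := c)) ((\<lambda>w. w(y := c')) ` W)"
  proof (rule compatI)
    show "qfeq (insert y X) (v(y := c)) u" if "u \<in> (\<lambda>w. w(y := c')) ` W" for u
      using that by (elim imageE) (simp only: q)
    show "lv (v(y := c)) t = lv (v(y := c)) t'"
      if "u \<in> (\<lambda>w. w(y := c')) ` W" "u' \<in> (\<lambda>w. w(y := c')) ` W"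
        "fvars t \<subseteq> insert y X" "fvars t' \<subseteq> insert y X" "lv u t = lv u' t'" for u u' t t'
      using that by (elim imageE) (metis cr)
  qed
  then show ?thesis ..
qed

end

text \<open>What the two languages have in common: terms are linear forms, relations are
  \<open>prm m\<close> or \<open>dvm m\<close> with m > 0, and all basic formulas are available.
  Saturation is used only over finite parameter sets.\<close>

locale emodel = zmodel M for M :: "(fsym, rsym, 'a) fo_struct" +
  fixes L :: "(fsym, rsym) lang" and \<kappa> :: "'k rel"
  assumes D: "Dickson"
    and fm_in_plus_Pr: "fm_in L_plus_Pr \<phi> \<Longrightarrow> fm_in L \<phi>"
    and Zero_arity: "fun_arity L Zero = Some 0"
    and fun_arityD: "fun_arity L f = Some k \<Longrightarrow> (f = Plus \<and> k = 2) \<or>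
      (f = Minus \<and> k = 1 \<and> (\<forall>x. fun_interp M Minus [x] = neg x)) \<or> ((f = Zero \<or> f = One) \<and> k = 0)"
    and rel_arityD: "rel_arity L r = Some k \<Longrightarrow> k = 1 \<and>
      (\<exists>m>0. (\<forall>x. rel_interp M r [x] \<longleftrightarrow> prm m x) \<or> (\<forall>x. rel_interp M r [x] \<longleftrightarrow> dvm m x))"
    and saturated: "saturated L \<kappa> M"
    and small_finite: "finite (A :: 'a set) \<Longrightarrow> small \<kappa> A"
begin

lemma fm_in_basic_L [simp]: "fm_in L (fm_zero t)" "fm_in L (fm_dvd m t)" "fm_in L (fm_prime m t)"
  by (auto intro: fm_in_plus_Pr)

lemma fm_in_FConjs_L [simp]: "fm_in L (FConjs \<phi>s) \<longleftrightarrow> (\<forall>\<phi>\<in>set \<phi>s. fm_in L \<phi>)"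
  by (rule fm_in_FConjs[OF Zero_arity])

section \<open>Definable sets and saturation in several variables\<close>

definition swp :: "nat \<Rightarrow> nat \<Rightarrow> nat" where
  "swp y x = (if x = 0 then y else if x = y then 0 else x)"

lemma swp_swp [simp]: "swp y (swp y x) = x"
  by (simp add: swp_def)

lemma bij_swp: "bij (swp y)"
  by (rule involuntory_imp_bij) simp

text \<open>Here the distinguished variable y and the assignment are arbitrary, whereas
  \<open>pformulas\<close> wants the element variable to be 0 and the parameters in a list;
  exchanging y with 0 links the two.\<close>

definition dset :: "'a set \<Rightarrow> 'a set \<Rightarrow> bool" where
  "dset A S \<longleftrightarrow> (\<exists>\<phi> v y. fm_in L \<phi> \<and> v ` (fm_free \<phi> - {y}) \<subseteq> A \<and> S = {c. sat M (v(y := c)) \<phi>})"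

lemma dset_pformula:
  assumes "dset A S"
  shows "\<exists>(\<phi>, a)\<in>pformulas L 1 (insert zer A). S = {c. holds M \<phi> ([c] @ a)}"
proof -
  obtain \<phi> v y where \<phi>: "fm_in L \<phi>" "v ` (fm_free \<phi> - {y}) \<subseteq> A" "S = {c. sat M (v(y := c)) \<phi>}"
    using assms unfolding dset_def by blast
  define K where "K = (\<Sum>x\<in>fm_free \<phi>. swp y x)"
  have K: "swp y x \<le> K" if "x \<in> fm_free \<phi>" for x
    unfolding K_def using that finite_fm_free by (intro member_le_sum) auto
  \<comment> \<open>The list starts with the parameter for variable 1, since position 0 belongs to
    the element. Positions of non-occurring variables are filled with \<open>zer\<close>, whence the
    enlarged parameter set.\<close>
  define a where "a = map (\<lambda>i. if swp y i \<in> fm_free \<phi> - {y} then v (swp y i) else zer) [1..<Suc K]"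
  have "set a \<subseteq> insert zer A" using \<phi>(2) by (auto simp: a_def)
  moreover have "fm_ren (swp y) \<phi> \<in> formulas L (1 + length a)"
    using \<phi>(1) K by (fastforce simp: formulas_def fm_free_ren bij_is_inj[OF bij_swp] a_def less_Suc_eq_le)
  moreover have "holds M (fm_ren (swp y) \<phi>) ([c] @ a) \<longleftrightarrow> sat M (v(y := c)) \<phi>" for c
    unfolding holds_def sat_ren[OF bij_swp]
  proof (rule sat_cong)
    fix x assume x: "x \<in> fm_free \<phi>"
    show "((\<lambda>i. ([c] @ a) ! i) \<circ> swp y) x = (v(y := c)) x"
    proof (cases "x = y")
      case True
      then show ?thesis by (simp add: swp_def)
    next
      case False
      then have "swp y x \<noteq> 0" by (auto simp: swp_def)
      then obtain j where j: "swp y x = Suc j" by (cases "swp y x") auto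
      have "j < length a" using K[OF x] j by (simp add: a_def del: upt_Suc)
      moreover have "swp y (Suc j) = x" using j swp_swp[of y x] by simp
      ultimately show ?thesis using j False x
        by (simp add: a_def nth_map_upt del: upt_Suc)
    qed
  qed
  ultimately show ?thesis using \<phi>(3) by (auto simp: pformulas_def)
qed

lemma dset_inter:
  assumes A: "finite A" and F: "\<And>S. S \<in> F \<Longrightarrow> dset A S"
    and fip: "\<And>F\<^sub>0. finite F\<^sub>0 \<Longrightarrow> F\<^sub>0 \<subseteq> F \<Longrightarrow> \<Inter>F\<^sub>0 \<noteq> {}"
  shows "\<exists>c. \<forall>S\<in>F. c \<in> S"
proof -
  let ?A = "insert zer A"
  let ?S = "\<lambda>(\<phi>, a). {c. holds M \<phi> ([c] @ a)}"
  define p where "p = {q \<in> pformulas L 1 ?A. ?S q \<in> F}"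
  have "\<exists>b. realizes M [b] p\<^sub>0" if "finite p\<^sub>0" "p\<^sub>0 \<subseteq> p" for p\<^sub>0
  proof -
    have "\<Inter>(?S ` p\<^sub>0) \<noteq> {}" using that by (intro fip) (auto simp: p_def)
    then obtain b where "\<forall>q\<in>p\<^sub>0. b \<in> ?S q" by blast
    then show ?thesis by (intro exI[of _ b]) (auto simp: realizes_def)
  qed
  moreover have "p \<subseteq> pformulas L 1 ?A" by (auto simp: p_def)
  moreover have "small \<kappa> ?A" using A by (intro small_finite) simp
  ultimately obtain b where b: "realizes M [b] p" using saturated unfolding saturated_def by metis
  have "b \<in> S" if S: "S \<in> F" for S
  proof -
    obtain q where "q \<in> pformulas L 1 ?A" "S = ?S q"
      using dset_pformula[OF F[OF S]] by (auto simp: case_prod_beta)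
    then have "q \<in> p" using S by (simp add: p_def)
    then show ?thesis using b \<open>S = ?S q\<close> by (auto simp: realizes_def)
  qed
  then show ?thesis by blast
qed

text \<open>\<open>saturated\<close> speaks of a single variable. The value of y is found first,
  from the finite subsets of \<Sigma> with the remaining variables existentially quantified; the
  other values follow by induction.\<close>

lemma saturation_tuple:
  assumes "finite X" and \<Sigma>: "\<And>\<phi>. \<phi> \<in> \<Sigma> \<Longrightarrow> fm_in L \<phi> \<and> fm_free \<phi> \<subseteq> Y" and Y: "finite Y"
    and "\<And>\<Sigma>\<^sub>0. finite \<Sigma>\<^sub>0 \<Longrightarrow> \<Sigma>\<^sub>0 \<subseteq> \<Sigma> \<Longrightarrow> \<exists>u. (\<forall>x. x \<notin> X \<longrightarrow> u x = v x) \<and> (\<forall>\<phi>\<in>\<Sigma>\<^sub>0. sat M u \<phi>)"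
  shows "\<exists>u. (\<forall>x. x \<notin> X \<longrightarrow> u x = v x) \<and> (\<forall>\<phi>\<in>\<Sigma>. sat M u \<phi>)"
  using assms(1,4)
proof (induction X arbitrary: v rule: finite_induct)
  case empty
  have "sat M v \<phi>" if \<phi>: "\<phi> \<in> \<Sigma>" for \<phi>
  proof -
    obtain u where "\<forall>x. u x = v x" "sat M u \<phi>" using empty.prems[of "{\<phi>}"] \<phi> by auto
    then show ?thesis using sat_cong[of \<phi> u v M] by simp
  qed
  then show ?case by blast
next
  case (insert y X)
  obtain xs where xs: "set xs = X" using insert.hyps(1) finite_list by blast
  define S where "S \<Sigma>\<^sub>0 = {c. \<exists>u. (\<forall>x. x \<notin> X \<longrightarrow> u x = (v(y := c)) x) \<and> (\<forall>\<phi>\<in>\<Sigma>\<^sub>0. sat M u \<phi>)}" for \<Sigma>\<^sub>0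
  have dS: "dset (v ` Y) (S \<Sigma>\<^sub>0)" if f: "finite \<Sigma>\<^sub>0" "\<Sigma>\<^sub>0 \<subseteq> \<Sigma>" for \<Sigma>\<^sub>0
  proof -
    obtain \<phi>s where \<phi>s: "set \<phi>s = \<Sigma>\<^sub>0" using f finite_list by blast
    have 1: "fm_in L (FExs xs (FConjs \<phi>s))" using \<phi>s f \<Sigma> by auto
    have "fm_free (FExs xs (FConjs \<phi>s)) \<subseteq> Y" using \<phi>s f \<Sigma> by fastforce
    then have 2: "v ` (fm_free (FExs xs (FConjs \<phi>s)) - {y}) \<subseteq> v ` Y" by blast
    have 3: "S \<Sigma>\<^sub>0 = {c. sat M (v(y := c)) (FExs xs (FConjs \<phi>s))}"
      by (simp add: S_def sat_FExs xs \<phi>s)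
    show ?thesis unfolding dset_def using 1 2 3 by blast
  qed
  define F where "F = S ` {\<Sigma>\<^sub>0. finite \<Sigma>\<^sub>0 \<and> \<Sigma>\<^sub>0 \<subseteq> \<Sigma>}"
  have "\<exists>c. \<forall>T\<in>F. c \<in> T"
  proof (rule dset_inter)
    show "finite (v ` Y)" using Y by simp
    show "dset (v ` Y) T" if "T \<in> F" for T using that dS by (auto simp: F_def)
    fix F\<^sub>0 assume F0: "finite F\<^sub>0" "F\<^sub>0 \<subseteq> F"
    obtain B where B: "finite B" "B \<subseteq> {\<Sigma>\<^sub>0. finite \<Sigma>\<^sub>0 \<and> \<Sigma>\<^sub>0 \<subseteq> \<Sigma>}" "F\<^sub>0 = S ` B"
      using finite_subset_image[OF F0(1) F0(2)[unfolded F_def]] by blast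
    obtain u where u: "\<forall>x. x \<notin> insert y X \<longrightarrow> u x = v x" "\<forall>\<phi>\<in>\<Union>B. sat M u \<phi>"
      using insert.prems[of "\<Union>B"] B by blast
    have "u y \<in> S \<Sigma>\<^sub>0" if "\<Sigma>\<^sub>0 \<in> B" for \<Sigma>\<^sub>0
      unfolding S_def using u that by (intro CollectI exI[of _ u]) auto
    then show "\<Inter>F\<^sub>0 \<noteq> {}" using B(3) by blast
  qed
  then obtain c where c: "\<And>\<Sigma>\<^sub>0. finite \<Sigma>\<^sub>0 \<Longrightarrow> \<Sigma>\<^sub>0 \<subseteq> \<Sigma> \<Longrightarrow> c \<in> S \<Sigma>\<^sub>0" by (auto simp: F_def)
  have "\<exists>u. (\<forall>x. x \<notin> X \<longrightarrow> u x = (v(y := c)) x) \<and> (\<forall>\<phi>\<in>\<Sigma>. sat M u \<phi>)"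
    by (rule insert.IH) (use c in \<open>auto simp: S_def\<close>)
  then obtain u where u: "\<forall>x. x \<notin> X \<longrightarrow> u x = (v(y := c)) x" "\<forall>\<phi>\<in>\<Sigma>. sat M u \<phi>" by blast
  then show ?case by (intro exI[of _ u]) auto
qed

lemma lv_nat_form:
  fixes t :: "'b form"
  obtains t' :: "nat form" and v where "lv v t' = lv w t" "0 \<notin> fvars t'" "v ` fvars t' \<subseteq> w ` fvars t"
proof -
  obtain f :: "'b \<Rightarrow> nat" where f: "inj_on f (fvars t)"
    using finite_imp_inj_to_nat_seg[OF finite_fvars[of t]] by auto
  define e where "e x = Suc (f x)" for x
  define v where "v i = w (inv_into (fvars t) f (i - 1))" for i
  have ve: "v (e x) = w x" if "x \<in> fvars t" for x using that f by (simp add: v_def e_def)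
  have "lv v (fren e t) = lv w t" unfolding lv_ren by (rule lv_cong) (rule ve)
  moreover have "0 \<notin> fvars (fren e t)" by (auto simp: e_def)
  moreover have "v ` fvars (fren e t) \<subseteq> w ` fvars t" using ve by auto
  ultimately show ?thesis by (rule that)
qed

lemma dset_fm:
  assumes w: "w ` fvars t \<subseteq> A"
    and R: "\<And>s v. sat M v (fm s) \<longleftrightarrow> R (lv v s)" "\<And>s. fm_in L (fm s)" "\<And>s. fm_free (fm s) \<subseteq> fvars s"
  shows "dset A {x. R (n \<odot> x \<oplus> lv w t)}" "dset A {x. \<not> R (n \<odot> x \<oplus> lv w t)}"
proof -
  obtain t' :: "nat form" and v where t': "lv v t' = lv w t" "0 \<notin> fvars t'" "v ` fvars t' \<subseteq> w ` fvars t"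
    by (rule lv_nat_form)
  have u: "lv (v(0 := x)) t' = lv w t" for x
    unfolding t'(1)[symmetric] using t'(2) by (intro lv_cong) auto
  have f: "v ` (fm_free (fm ((n, Some 0) # t')) - {0}) \<subseteq> A" using R(3)[of "(n, Some 0) # t'"] t'(3) w by fastforce
  have "{x. R (n \<odot> x \<oplus> lv w t)} = {x. sat M (v(0 := x)) (fm ((n, Some 0) # t'))}" by (simp add: R(1) u)
  then show "dset A {x. R (n \<odot> x \<oplus> lv w t)}" unfolding dset_def using f R(2) by blast
  have "{x. \<not> R (n \<odot> x \<oplus> lv w t)} = {x. sat M (v(0 := x)) (FNeg (fm ((n, Some 0) # t')))}" by (simp add: R(1) u)
  then show "dset A {x. \<not> R (n \<odot> x \<oplus> lv w t)}" unfolding dset_def using f R(2)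
    by (metis fm_free.simps(3) fm_in.simps(3))
qed

lemma dset_zero: "w ` fvars t \<subseteq> A \<Longrightarrow> dset A {x. n \<odot> x \<oplus> lv w t \<noteq> zer}"
  using dset_fm(2)[of w t A fm_zero "\<lambda>x. x = zer"] fm_free_zero by simp

lemma dset_prime: "w ` fvars t \<subseteq> A \<Longrightarrow> dset A {x. prm m (n \<odot> x \<oplus> lv w t) \<longleftrightarrow> b}"
  using dset_fm[of w t A "fm_prime m" "prm m"] fm_free_prime by (cases b) simp_all

lemma dset_dvd: "w ` fvars t \<subseteq> A \<Longrightarrow> dset A {x. dvm m (n \<odot> x \<oplus> lv w t) \<longleftrightarrow> b}"
  using dset_fm[of w t A "fm_dvd m" "dvm m"] fm_free_dvd by (cases b) simp_all

text \<open>By saturation it suffices to meet finitely many requirements. Congruence to c settles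
  the \<open>dvm\<close> requirements, avoiding a finite set settles those about the closure, and
  the primality requirements are solved by \<open>consistency\<close> with base point c.\<close>

lemma generic_point:
  assumes comp: "compat X v W" and fin: "finite W" "finite X" "finite A" and A: "(\<Union>w\<in>W. w ` X) \<subseteq> A"
    and c: "c \<notin> cl (v ` X)"
  shows "\<exists>c'. c' \<notin> cl A \<and> (\<forall>w\<in>W. \<forall>t n m. fvars t \<subseteq> X \<longrightarrow> n \<noteq> 0 \<longrightarrow> m > 0 \<longrightarrow>
    (prm m (n \<odot> c' \<oplus> lv w t) \<longleftrightarrow> prm m (n \<odot> c \<oplus> lv v t)) \<and>
    (dvm m (n \<odot> c' \<oplus> lv w t) \<longleftrightarrow> dvm m (n \<odot> c \<oplus> lv v t)))"
proof -
  define F1 where "F1 = {{x. n \<odot> x \<oplus> lv (\<lambda>x. x) t \<noteq> zer} | n t. n \<noteq> 0 \<and> fvars t \<subseteq> A}"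
  define F2 where "F2 = {{x. prm m (n \<odot> x \<oplus> lv w t) \<longleftrightarrow> prm m (n \<odot> c \<oplus> lv v t)} | n m w t.
    n \<noteq> 0 \<and> m > 0 \<and> w \<in> W \<and> fvars t \<subseteq> X}"
  define F3 where "F3 = {{x. dvm m (n \<odot> x \<oplus> lv w t) \<longleftrightarrow> dvm m (n \<odot> c \<oplus> lv v t)} | n m w t.
    n \<noteq> 0 \<and> m > 0 \<and> w \<in> W \<and> fvars t \<subseteq> X}"
  define PP where "PP = {(n, m, lv w t) | n m w t.
    n \<noteq> 0 \<and> m > 0 \<and> w \<in> W \<and> fvars t \<subseteq> X \<and> prm m (n \<odot> c \<oplus> lv v t)}"
  define QQ where "QQ = {(n, m, lv w t) | n m w t.
    n \<noteq> 0 \<and> m > 0 \<and> w \<in> W \<and> fvars t \<subseteq> X \<and> \<not> prm m (n \<odot> c \<oplus> lv v t)}"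
  define good where "good P Q E N x \<longleftrightarrow> dvm N (x \<ominus> c) \<and> x \<notin> E \<and>
    (\<forall>(n, m, u)\<in>P. prm m (n \<odot> x \<oplus> u)) \<and> (\<forall>(n, m, u)\<in>Q. \<not> prm m (n \<odot> x \<oplus> u))"
    for P Q :: "(int \<times> int \<times> 'a) set" and E N x
  \<comment> \<open>Each requirement S is reduced to finite data of the shape that
    \<open>consistency\<close> accepts. Such data can be merged by unions and by multiplying the
    moduli, which handles finite intersections.\<close>
  define imp where "imp S P Q E N \<longleftrightarrow> finite P \<and> finite Q \<and> finite E \<and> P \<subseteq> PP \<and> Q \<subseteq> QQ \<and> (N :: int) > 0 \<and>
    (\<forall>x. good P Q E N x \<longrightarrow> x \<in> S)" for S P Q E N
  have imp1: "\<exists>P Q E N. imp S P Q E N" if "S \<in> F1 \<union> F2 \<union> F3" for S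
    using that
  proof (elim UnE)
    assume "S \<in> F1"
    then obtain n t where n: "n \<noteq> 0" "S = {x. n \<odot> x \<oplus> lv (\<lambda>x. x) t \<noteq> zer}" by (auto simp: F1_def)
    have "finite {x. n \<odot> x \<oplus> lv (\<lambda>x. x) t = zer}"
      using finite_smul_eq[OF n(1), of "neg (lv (\<lambda>x. x) t)"] by (simp add: G.eq_neg_iff_add_eq_0)
    then have "imp S {} {} {x. n \<odot> x \<oplus> lv (\<lambda>x. x) t = zer} 1"
      by (simp add: imp_def good_def n(2))
    then show ?thesis by blast
  next
    assume "S \<in> F2"
    then obtain n m w t where n: "n \<noteq> 0" "m > 0" "w \<in> W" "fvars t \<subseteq> X"
      "S = {x. prm m (n \<odot> x \<oplus> lv w t) \<longleftrightarrow> prm m (n \<odot> c \<oplus> lv v t)}" by (auto simp: F2_def)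
    have "imp S {(n, m, lv w t)} {} {} 1" if "prm m (n \<odot> c \<oplus> lv v t)"
      using that n by (auto simp: imp_def good_def PP_def)
    moreover have "imp S {} {(n, m, lv w t)} {} 1" if "\<not> prm m (n \<odot> c \<oplus> lv v t)"
      using that n by (auto simp: imp_def good_def QQ_def)
    ultimately show ?thesis by blast
  next
    assume "S \<in> F3"
    then obtain n m w t where n: "n \<noteq> 0" "m > 0" "w \<in> W" "fvars t \<subseteq> X"
      "S = {x. dvm m (n \<odot> x \<oplus> lv w t) \<longleftrightarrow> dvm m (n \<odot> c \<oplus> lv v t)}" by (auto simp: F3_def)
    have "dvm m (n \<odot> x \<oplus> lv w t) \<longleftrightarrow> dvm m (n \<odot> c \<oplus> lv v t)" if "dvm m (x \<ominus> c)" for x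
    proof (rule dvm_cong)
      have "dvm m (n \<odot> (x \<ominus> c) \<oplus> (lv w t \<ominus> lv v t))"
        using dvm_add dvm_smul[OF that] qfeq_dvm_diff[OF compat_qfeq[OF comp n(3)] n(4,2)] by blast
      then show "dvm m (n \<odot> x \<oplus> lv w t \<ominus> (n \<odot> c \<oplus> lv v t))"
        by (simp add: diff_add_diff smul_diff_right)
    qed
    then have "imp S {} {} {} m" using n by (auto simp: imp_def good_def)
    then show ?thesis by blast
  qed
  have impfin: "\<exists>P Q E N. imp (\<Inter>F\<^sub>0) P Q E N" if "finite F\<^sub>0" "F\<^sub>0 \<subseteq> F1 \<union> F2 \<union> F3" for F\<^sub>0
    using that
  proof (induction F\<^sub>0 rule: finite_induct)
    case empty
    have "imp (\<Inter>{}) {} {} {} 1" by (simp add: imp_def)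
    then show ?case by blast
  next
    case (insert S F\<^sub>0)
    obtain P Q E N where 1: "imp (\<Inter>F\<^sub>0) P Q E N" using insert by auto
    obtain P' Q' E' N' where 2: "imp S P' Q' E' N'" using imp1[of S] insert.prems by auto
    have g: "good P Q E N x \<and> good P' Q' E' N' x"
      if "good (P \<union> P') (Q \<union> Q') (E \<union> E') (N * N') x" for x
      using that dvm_mono[of N "N * N'"] dvm_mono[of N' "N * N'"] unfolding good_def by auto
    have "imp (\<Inter>(insert S F\<^sub>0)) (P \<union> P') (Q \<union> Q') (E \<union> E') (N * N')"
      using 1 2 g unfolding imp_def by auto
    then show ?case by blast
  qed
  have sat: "\<exists>x. good P Q E N x" if sub: "finite P" "finite Q" "finite E" "P \<subseteq> PP" "Q \<subseteq> QQ" "N > 0" for P Q E N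
    unfolding good_def
  proof (rule consistency[OF D sub(1-3) sub(6)])
    fix n m u assume "(n, m, u) \<in> P"
    then obtain w t where t: "n \<noteq> 0" "m > 0" "w \<in> W" "fvars t \<subseteq> X" "prm m (n \<odot> c \<oplus> lv v t)" "u = lv w t"
      using sub(4) by (auto simp: PP_def)
    \<comment> \<open>The constant u is a value at w, while primality is known only for the value at
      v; the two are congruent modulo every k > 0, so divisibility can be tested at v.\<close>
    have cong: "dvm k (n \<odot> c \<oplus> u) \<longleftrightarrow> dvm k (n \<odot> c \<oplus> lv v t)" if "k > 0" for k
      by (rule dvm_cong)
        (use qfeq_dvm_diff[OF compat_qfeq[OF comp t(3)] t(4) that] t(6) in simp)
    have "\<not> dvm (p * m) (n \<odot> c \<oplus> u)" if p: "prime p" for p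
    proof
      assume "dvm (p * m) (n \<odot> c \<oplus> u)"
      then have "dvm (p * m) (n \<odot> c \<oplus> lv v t)" using cong[of "p * m"] t(2) prime_gt_0_int[OF p] by simp
      then obtain k where "n \<odot> c \<oplus> lv v t = k \<odot> one" using prm_dvm_prime_mult[OF p _ t(5)] t(2) by fastforce
      then have "n \<odot> c = lv v ((k, None) # fscale (-1) t)" by (simp add: G.eq_diff_eq)
      moreover have "fvars ((k, None) # fscale (-1) t) \<subseteq> X" using t(4) by simp
      ultimately have "c \<in> cl (v ` X)" using t(1) unfolding cl_image by blast
      then show False using c by blast
    qed
    then show "n \<noteq> 0 \<and> m > 0 \<and> dvm m (n \<odot> c \<oplus> u) \<and> (\<forall>p. prime p \<longrightarrow> \<not> dvm (p * m) (n \<odot> c \<oplus> u))"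
      using t cong prm_dvm by blast
    fix n' m' w assume "(n', m', w) \<in> Q"
    then obtain w' t' where t': "n' \<noteq> 0" "m' > 0" "w' \<in> W" "fvars t' \<subseteq> X" "\<not> prm m' (n' \<odot> c \<oplus> lv v t')" "w = lv w' t'"
      using sub(5) by (auto simp: QQ_def)
    \<comment> \<open>Both conditions are brought to the common modulus m * m'. One of the scaled
      values satisfies \<open>prm\<close> and the other does not, so they differ, also up to
      sign.\<close>
    have "prm (m * m') (m' \<odot> (n \<odot> c \<oplus> lv v t))" using t t'(2) prm_scale[of m' m] by (simp add: mult.commute)
    moreover have "\<not> prm (m * m') (m \<odot> (n' \<odot> c \<oplus> lv v t'))" using t t'(5) prm_scale[of m m'] by simp
    ultimately have ne: "m' \<odot> (n \<odot> c \<oplus> lv v t) \<noteq> m \<odot> (n' \<odot> c \<oplus> lv v t')"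
      "m' \<odot> (n \<odot> c \<oplus> lv v t) \<noteq> neg (m \<odot> (n' \<odot> c \<oplus> lv v t'))" by (metis, metis prm_neg)
    have "\<not> (m' * n = m * n' \<and> m' \<odot> u = m \<odot> w)"
    proof
      assume h: "m' * n = m * n' \<and> m' \<odot> u = m \<odot> w"
      \<comment> \<open>The name w now denotes the constant of the negative condition; the local
        \<open>for w\<close> gives access to the realization behind u again, which
        \<open>compatD\<close> needs.\<close>
      then have "lv w (fscale m' t) = lv w' (fscale m t')" if "u = lv w t" for w
        using that t'(6) by simp
      from compatD[OF comp t(3) t'(3) _ _ this[OF t(6)]]
      have "m' \<odot> lv v t = m \<odot> lv v t'" using t(4) t'(4) by simp
      then show False using ne(1) h by (simp add: smul_add_right)
    qed
    moreover have "\<not> (m' * n = - (m * n') \<and> m' \<odot> u = neg (m \<odot> w))"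
    proof
      assume h: "m' * n = - (m * n') \<and> m' \<odot> u = neg (m \<odot> w)"
      then have "lv w (fscale m' t) = lv w' (fscale (- m) t')" if "u = lv w t" for w
        using that t'(6) by simp
      from compatD[OF comp t(3) t'(3) _ _ this[OF t(6)]]
      have "m' \<odot> lv v t = neg (m \<odot> lv v t')" using t(4) t'(4) by simp
      then show False using ne(2) h by (simp add: smul_add_right)
    qed
    ultimately show "\<not> (m' * n = m * n' \<and> m' \<odot> u = m \<odot> w) \<and>
       \<not> (m' * n = - (m * n') \<and> m' \<odot> u = neg (m \<odot> w))" by blast
  next
    show "n \<noteq> 0 \<and> m > 0" if "(n, m, w) \<in> Q" for n m w using that sub(5) by (auto simp: QQ_def)
  qed
  have "\<exists>x. \<forall>S\<in>F1 \<union> F2 \<union> F3. x \<in> S"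
  proof (rule dset_inter[OF fin(3)])
    fix S assume "S \<in> F1 \<union> F2 \<union> F3"
    then show "dset A S"
    proof (elim UnE)
      assume "S \<in> F1"
      then obtain n t where "fvars t \<subseteq> A" "S = {x. n \<odot> x \<oplus> lv (\<lambda>x. x) t \<noteq> zer}"
        by (auto simp: F1_def)
      then show ?thesis using dset_zero[of "\<lambda>x. x" t A n] by simp
    next
      assume "S \<in> F2"
      then obtain n m w t where "w \<in> W" "fvars t \<subseteq> X" "S = {x. prm m (n \<odot> x \<oplus> lv w t) \<longleftrightarrow> prm m (n \<odot> c \<oplus> lv v t)}"
        by (auto simp: F2_def)
      moreover from this have "w ` fvars t \<subseteq> A" using A by blast
      ultimately show ?thesis using dset_prime by simp
    next
      assume "S \<in> F3"
      then obtain n m w t where "w \<in> W" "fvars t \<subseteq> X" "S = {x. dvm m (n \<odot> x \<oplus> lv w t) \<longleftrightarrow> dvm m (n \<odot> c \<oplus> lv v t)}"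
        by (auto simp: F3_def)
      moreover from this have "w ` fvars t \<subseteq> A" using A by blast
      ultimately show ?thesis using dset_dvd by simp
    qed
  next
    fix F\<^sub>0 assume F0: "finite F\<^sub>0" "F\<^sub>0 \<subseteq> F1 \<union> F2 \<union> F3"
    obtain P Q E N where "imp (\<Inter>F\<^sub>0) P Q E N" using impfin[OF F0] by blast
    then show "\<Inter>F\<^sub>0 \<noteq> {}" using sat[of P Q E N] unfolding imp_def by blast
  qed
  then obtain x where x: "\<And>S. S \<in> F1 \<Longrightarrow> x \<in> S" "\<And>S. S \<in> F2 \<Longrightarrow> x \<in> S" "\<And>S. S \<in> F3 \<Longrightarrow> x \<in> S" by blast
  have "x \<notin> cl A"
  proof
    assume "x \<in> cl A"
    then obtain n t where n: "n \<noteq> 0" "fvars t \<subseteq> A" "n \<odot> x = lv (\<lambda>x. x) t" by (auto simp: cl_def)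
    have "{x. n \<odot> x \<oplus> lv (\<lambda>x. x) (fscale (-1) t) \<noteq> zer} \<in> F1" unfolding F1_def using n
      by (intro CollectI exI[of _ n] exI[of _ "fscale (-1) t"]) simp
    from x(1)[OF this] show False using n(3) by simp
  qed
  moreover have "(prm m (n \<odot> x \<oplus> lv w t) \<longleftrightarrow> prm m (n \<odot> c \<oplus> lv v t)) \<and>
    (dvm m (n \<odot> x \<oplus> lv w t) \<longleftrightarrow> dvm m (n \<odot> c \<oplus> lv v t))"
    if "w \<in> W" "fvars t \<subseteq> X" "n \<noteq> 0" "m > 0" for w t n m
  proof -
    have "{x. prm m (n \<odot> x \<oplus> lv w t) \<longleftrightarrow> prm m (n \<odot> c \<oplus> lv v t)} \<in> F2" using that unfolding F2_def by blast
    moreover have "{x. dvm m (n \<odot> x \<oplus> lv w t) \<longleftrightarrow> dvm m (n \<odot> c \<oplus> lv v t)} \<in> F3" using that unfolding F3_def by blast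
    ultimately show ?thesis using x(2,3) by blast
  qed
  ultimately show ?thesis by blast
qed

end

section \<open>Back and forth\<close>

lemma infinite_separated:
  assumes "finite C" and ne: "\<And>p n. p \<in> C \<Longrightarrow> f p n \<noteq> g p (n :: nat)"
  shows "\<exists>H. infinite H \<and> (\<forall>p\<in>C. \<forall>n\<in>H. \<forall>n'\<in>H. f p n \<noteq> g p n')"
  using assms
proof (induction C rule: finite_induct)
  case empty
  then show ?case by (intro exI[of _ UNIV]) simp
next
  case (insert p C)
  obtain H where H: "infinite H" "\<forall>p\<in>C. \<forall>n\<in>H. \<forall>n'\<in>H. f p n \<noteq> g p n'"
    using insert.IH insert.prems by blast
  \<comment> \<open>For x < y the colour records which of the equalities f x = g y and f y = g x
    hold.\<close>
  define col :: "nat set \<Rightarrow> nat" where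
    "col A = (if f p (Min A) = g p (Max A) then 1 else 0) + (if f p (Max A) = g p (Min A) then 2 else 0)" for A
  have "\<forall>x\<in>H. \<forall>y\<in>H. x \<noteq> y \<longrightarrow> col {x, y} < 4" by (simp add: col_def)
  from Ramsey2[OF H(1) this] obtain Y t
    where Y: "Y \<subseteq> H" "infinite Y" "\<forall>x\<in>Y. \<forall>y\<in>Y. x \<noteq> y \<longrightarrow> col {x, y} = t" by blast
  have col: "col {x, y} = (if f p x = g p y then 1 else 0) + (if f p y = g p x then 2 else 0)" if "x < y" for x y
    using that by (simp add: col_def)
  obtain i where i: "i \<in> Y" using Y(2) by fastforce
  obtain j where j: "j \<in> Y" "i < j" using Y(2) unfolding infinite_nat_iff_unbounded by blast
  obtain k where k: "k \<in> Y" "j < k" using Y(2) unfolding infinite_nat_iff_unbounded by blast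
  have nep: "f p n \<noteq> g p n" for n using insert.prems by simp
  have Yt: "(f p x = g p y \<longleftrightarrow> odd t) \<and> (f p y = g p x \<longleftrightarrow> t \<ge> 2)" if "x \<in> Y" "y \<in> Y" "x < y" for x y
  proof -
    have "col {x, y} = t" using Y(3) that by auto
    then show ?thesis unfolding col[OF that(3)] by (auto split: if_splits)
  qed
  have "i < k" using j(2) k(2) by simp
  \<comment> \<open>On a homogeneous set neither equality can hold: f i = g j, f i = g k and f j = g
    k would give f j = g j, against the hypothesis, and the reversed equalities give the same
    contradiction.\<close>
  note ijk = Yt[OF i j(1,2)] Yt[OF j(1) k] Yt[OF i k(1) this]
  have "\<not> odd t" using ijk nep[of j] by metis
  moreover have "\<not> t \<ge> 2" using ijk nep[of j] by metis
  ultimately have "f p n \<noteq> g p n'" if "n \<in> Y" "n' \<in> Y" for n n'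
    using Yt[of n n'] Yt[of n' n] nep[of n] that by (cases n n' rule: linorder_cases) auto
  then show ?case using H(2) Y(1,2) by (intro exI[of _ Y]) blast
qed

context emodel
begin

text \<open>The new element avoids the closure of all values of all members of W. In an equality
  between forms at two members the coefficients of c' must then agree, so c' cancels and the old
  compatibility applies.\<close>

lemma generic_extension:
  assumes comp: "compat X v W" and fin: "finite W" "finite X" "finite A"
    and c: "c \<notin> cl (v ` X)"
  shows "\<exists>c'. c' \<notin> cl A \<and> compat (insert y X) (v(y := c)) ((\<lambda>w. w(y := c')) ` W)"
proof -
  define B where "B = A \<union> (\<Union>w\<in>W. w ` X)"
  have B: "finite B" "(\<Union>w\<in>W. w ` X) \<subseteq> B" using fin by (auto simp: B_def)
  obtain c' where c': "c' \<notin> cl B" and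
    eq: "\<And>w t n m. w \<in> W \<Longrightarrow> fvars t \<subseteq> X \<Longrightarrow> n \<noteq> 0 \<Longrightarrow> m > 0 \<Longrightarrow>
      (prm m (n \<odot> c' \<oplus> lv w t) \<longleftrightarrow> prm m (n \<odot> c \<oplus> lv v t)) \<and>
      (dvm m (n \<odot> c' \<oplus> lv w t) \<longleftrightarrow> dvm m (n \<odot> c \<oplus> lv v t))"
    using generic_point[OF comp fin(1,2) B c] by blast
  have sub: "fvars (frest y t) \<subseteq> X" if "fvars t \<subseteq> insert y X" for t using that by auto
  have nz: "k \<odot> x \<oplus> lv u t \<noteq> zer" if "x \<notin> cl (u ` X)" "fvars t \<subseteq> X" "k \<noteq> 0" for k x u t
  proof
    assume "k \<odot> x \<oplus> lv u t = zer"
    then have "k \<odot> x = lv u (fscale (-1) t)" by (simp add: G.eq_neg_iff_add_eq_0)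
    moreover have "fvars (fscale (-1) t) \<subseteq> X" using that by simp
    ultimately show False using that(1,3) unfolding cl_image by blast
  qed
  have c'w: "c' \<notin> cl (w ` X)" if "w \<in> W" for w
    using c' cl_mono[of "w ` X" B] B(2) that by blast
  have q: "qfeq (insert y X) (v(y := c)) (w(y := c'))" if w: "w \<in> W" for w
    unfolding qfeq_def
  proof (intro allI impI)
    fix t assume t: "fvars t \<subseteq> insert y X"
    show "(lv (v(y := c)) t = zer \<longleftrightarrow> lv (w(y := c')) t = zer) \<and>
     (\<forall>m>0. (prm m (lv (v(y := c)) t) \<longleftrightarrow> prm m (lv (w(y := c')) t)) \<and>
       (dvm m (lv (v(y := c)) t) \<longleftrightarrow> dvm m (lv (w(y := c')) t)))"
    proof (cases "fcoef y t = 0")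
      case True
      then show ?thesis unfolding lv_update using qfeqD[OF compat_qfeq[OF comp w] sub[OF t]] by simp
    next
      case False
      then show ?thesis unfolding lv_update
        using eq[OF w sub[OF t] False] nz[OF c sub[OF t] False] nz[OF c'w[OF w] sub[OF t] False] by blast
    qed
  qed
  have cr: "lv (v(y := c)) t = lv (v(y := c)) t'"
    if w: "w \<in> W" "w' \<in> W" and t: "fvars t \<subseteq> insert y X" "fvars t' \<subseteq> insert y X"
      and e: "lv (w(y := c')) t = lv (w'(y := c')) t'" for w w' t t'
  proof -
    let ?k = "fcoef y t" and ?k' = "fcoef y t'" and ?r = "frest y t" and ?r' = "frest y t'"
    have e: "?k \<odot> c' \<oplus> lv w ?r = ?k' \<odot> c' \<oplus> lv w' ?r'" using e unfolding lv_update .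
    have "?k = ?k'"
    proof (rule ccontr)
      assume ne: "?k \<noteq> ?k'"
      let ?s = "fren w' ?r' @ fscale (-1) (fren w ?r)"
      have "(?k \<odot> c' \<oplus> lv w ?r) \<ominus> (?k' \<odot> c' \<oplus> lv w ?r) = (?k' \<odot> c' \<oplus> lv w' ?r') \<ominus> (?k' \<odot> c' \<oplus> lv w ?r)"
        by (simp only: e)
      then have "(?k - ?k') \<odot> c' = lv (\<lambda>x. x) ?s" by (simp add: smul_diff_left)
      moreover have "fvars ?s \<subseteq> B" using sub[OF t(1)] sub[OF t(2)] w B(2) by fastforce
      moreover have "?k - ?k' \<noteq> 0" using ne by simp
      ultimately show False using c' unfolding cl_def by blast
    qed
    moreover from this have "lv w ?r = lv w' ?r'" using e by simp
    then have "lv v ?r = lv v ?r'" by (rule compatD[OF comp w sub[OF t(1)] sub[OF t(2)]])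
    ultimately show ?thesis unfolding lv_update by simp
  qed
  have "compat (insert y X) (v(y := c)) ((\<lambda>w. w(y := c')) ` W)"
  proof (rule compatI)
    show "qfeq (insert y X) (v(y := c)) u" if "u \<in> (\<lambda>w. w(y := c')) ` W" for u
      using that by (elim imageE) (simp only: q)
    show "lv (v(y := c)) t = lv (v(y := c)) t'"
      if "u \<in> (\<lambda>w. w(y := c')) ` W" "u' \<in> (\<lambda>w. w(y := c')) ` W"
        "fvars t \<subseteq> insert y X" "fvars t' \<subseteq> insert y X" "lv u t = lv u' t'" for u u' t t'
      using that by (elim imageE) (metis cr)
  qed
  moreover have "c' \<notin> cl A" using c' cl_mono[of A B] by (auto simp: B_def)
  ultimately show ?thesis by blast
qed

section \<open>Quantifier elimination and the extension of whole tuples\<close>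

lemma qfeq_extension:
  assumes "qfeq X v w" "finite X"
  shows "\<exists>c'. qfeq (insert y X) (v(y := c)) (w(y := c'))"
proof -
  have "\<exists>c'. compat (insert y X) (v(y := c)) ((\<lambda>w. w(y := c')) ` {w})"
  proof (cases "c \<in> cl (v ` X)")
    case True
    then show ?thesis by (intro algebraic_extension[OF qfeq_compat[OF assms(1)], of X]) auto
  next
    case False
    then show ?thesis
      using generic_extension[OF qfeq_compat[OF assms(1)] _ assms(2), of "{}"] by auto
  qed
  then obtain c' where "compat (insert y X) (v(y := c)) {w(y := c')}" by auto
  then show ?thesis using compat_qfeq by blast
qed

lemma tm_form: "tm_in L s \<Longrightarrow> \<exists>t. fvars t \<subseteq> tm_vars s \<and> (\<forall>v. tm_val M v s = lv v t)"
proof (induction s)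
  case (TVar x)
  show ?case by (intro exI[of _ "[(1, Some x)]"]) simp
next
  case (TApp f ts)
  have ar: "fun_arity L f = Some (length ts)" and ts: "\<And>s. s \<in> set ts \<Longrightarrow> tm_in L s"
    using TApp.prems by (auto simp: list_all_iff)
  from fun_arityD[OF ar] consider (plus) "f = Plus" "length ts = 2"
    | (minus) "f = Minus" "length ts = 1" "\<And>x. fun_interp M Minus [x] = neg x"
    | (zero) "f = Zero" "ts = []" | (one) "f = One" "ts = []" by auto
  then show ?case
  proof cases
    case plus
    then obtain s1 s2 where s: "ts = [s1, s2]" by (auto simp: length_Suc_conv numeral_2_eq_2)
    obtain t1 t2 where "fvars t1 \<subseteq> tm_vars s1" "\<And>v. tm_val M v s1 = lv v t1"
      "fvars t2 \<subseteq> tm_vars s2" "\<And>v. tm_val M v s2 = lv v t2"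
      using TApp.IH[of s1] TApp.IH[of s2] ts s by auto
    then show ?thesis using plus(1) s by (intro exI[of _ "t1 @ t2"]) (auto simp: add_def)
  next
    case minus
    then obtain s1 where s: "ts = [s1]" by (auto simp: length_Suc_conv)
    obtain t1 where "fvars t1 \<subseteq> tm_vars s1" "\<And>v. tm_val M v s1 = lv v t1"
      using TApp.IH[of s1] ts s by auto
    then show ?thesis using minus s by (intro exI[of _ "fscale (-1) t1"]) auto
  next
    case zero
    then show ?thesis by (intro exI[of _ "[]"]) (simp add: zer_def)
  next
    case one
    then show ?thesis by (intro exI[of _ "[(1, None)]"]) (simp add: one_def)
  qed
qed

text \<open>Semantic quantifier elimination: \<open>qfeq\<close> is symmetric, so the one-point
  extension handles an existential quantifier in both directions.\<close>

lemma sat_qfeq: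
  "fm_in L \<phi> \<Longrightarrow> fm_free \<phi> \<subseteq> X \<Longrightarrow> finite X \<Longrightarrow> qfeq X v w \<Longrightarrow> sat M v \<phi> \<longleftrightarrow> sat M w \<phi>"
proof (induction \<phi> arbitrary: X v w)
  case (FEq s s')
  obtain t t' where "fvars t \<subseteq> tm_vars s" "\<And>v. tm_val M v s = lv v t"
    "fvars t' \<subseteq> tm_vars s'" "\<And>v. tm_val M v s' = lv v t'"
    using tm_form FEq.prems(1) by (metis fm_in.simps(1))
  then show ?case using qfeq_eq[OF FEq.prems(4), of t t'] FEq.prems(2) by auto
next
  case (FRel r ts)
  have ar: "rel_arity L r = Some (length ts)" and ts: "\<And>s. s \<in> set ts \<Longrightarrow> tm_in L s"
    using FRel.prems(1) by (auto simp: list_all_iff)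
  obtain m where m: "m > 0" "length ts = 1"
    "(\<forall>x. rel_interp M r [x] \<longleftrightarrow> prm m x) \<or> (\<forall>x. rel_interp M r [x] \<longleftrightarrow> dvm m x)"
    using rel_arityD[OF ar] by blast
  from m(2) obtain s where s: "ts = [s]" by (auto simp: length_Suc_conv)
  obtain t where t: "fvars t \<subseteq> tm_vars s" "\<And>v. tm_val M v s = lv v t" using tm_form[of s] ts s by auto
  have "fvars t \<subseteq> X" using t(1) FRel.prems(2) s by auto
  from qfeqD(2,3)[OF FRel.prems(4) this m(1)] show ?case using m(3) s t(2) by auto
next
  case (FNeg \<phi>)
  then show ?case by (metis fm_free.simps(3) fm_in.simps(3) sat.simps(3))
next
  case (FConj \<phi> \<psi>)
  have "sat M v \<phi> \<longleftrightarrow> sat M w \<phi>" "sat M v \<psi> \<longleftrightarrow> sat M w \<psi>"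
    using FConj.prems by (intro FConj.IH[of X]; simp)+
  then show ?case by simp
next
  case (FEx y \<phi>)
  have *: "sat M w (FEx y \<phi>)" if q: "qfeq X v w" and s: "sat M v (FEx y \<phi>)" for v w
  proof -
    obtain c where c: "sat M (v(y := c)) \<phi>" using s by auto
    obtain c' where "qfeq (insert y X) (v(y := c)) (w(y := c'))"
      using qfeq_extension[OF q FEx.prems(3)] by blast
    moreover have "fm_in L \<phi>" "fm_free \<phi> \<subseteq> insert y X" "finite (insert y X)"
      using FEx.prems(1-3) by auto
    ultimately have "sat M (v(y := c)) \<phi> \<longleftrightarrow> sat M (w(y := c')) \<phi>" by (rule FEx.IH[rotated -1])
    then show ?thesis using c by auto
  qed
  show ?case using * FEx.prems(4) qfeq_sym by blast
qed

definition override :: "nat \<Rightarrow> (nat \<Rightarrow> 'a) \<Rightarrow> (nat \<Rightarrow> 'a) \<Rightarrow> nat \<Rightarrow> 'a" where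
  "override m e w = (\<lambda>j. if j < m then e j else w j)"

lemma override_Suc: "(override m e w)(m := c) = override (Suc m) (e(m := c)) w"
  by (auto simp: override_def)

text \<open>Coordinates are moved one at a time, algebraic ones over S and generic ones over X. The
  hypothesis excludes a coordinate that is algebraic over X and its predecessors but not over S and
  them: different members of W could then demand different images.\<close>

lemma tuple_extension:
  assumes comp: "compat X v W" and fin: "finite W" "finite X" "finite A" and S: "S \<subseteq> X"
    "\<And>w w' x. w \<in> W \<Longrightarrow> w' \<in> W \<Longrightarrow> x \<in> S \<Longrightarrow> w x = w' x"
  shows "(\<And>i. i < m \<Longrightarrow> v i \<in> cl (v ` (S \<union> {..<i})) \<or> v i \<notin> cl (v ` (X \<union> {..<i}))) \<Longrightarrow>
    \<exists>e. compat (X \<union> {..<m}) v (override m e ` W) \<and>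
      (\<forall>i<m. v i \<in> cl (v ` (S \<union> {..<i})) \<or> e i \<notin> cl (A \<union> e ` {..<i}))"
proof (induction m)
  case 0
  have "override 0 e w = w" for e w by (simp add: override_def)
  then show ?case using comp by simp
next
  case (Suc m)
  obtain e where e: "compat (X \<union> {..<m}) v (override m e ` W)"
    "\<forall>i<m. v i \<in> cl (v ` (S \<union> {..<i})) \<or> e i \<notin> cl (A \<union> e ` {..<i})"
    using Suc.IH Suc.prems less_Suc_eq by metis
  have ag: "u x = u' x" if "u \<in> override m e ` W" "u' \<in> override m e ` W" "x \<in> S \<union> {..<m}" for u u' x
  proof -
    obtain w w' where "w \<in> W" "w' \<in> W" "u = override m e w" "u' = override m e w'"
      using \<open>u \<in> _\<close> \<open>u' \<in> _\<close> by blast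
    then show ?thesis using S(2)[of w w' x] \<open>x \<in> _\<close> by (auto simp: override_def)
  qed
  have "\<exists>c'. compat (insert m (X \<union> {..<m})) (v(m := v m)) ((\<lambda>w. w(m := c')) ` override m e ` W) \<and>
    (v m \<in> cl (v ` (S \<union> {..<m})) \<or> c' \<notin> cl (A \<union> e ` {..<m}))"
  proof (cases "v m \<in> cl (v ` (S \<union> {..<m}))")
    case True
    have "S \<union> {..<m} \<subseteq> X \<union> {..<m}" using S(1) by auto
    then have "\<exists>c'. compat (insert m (X \<union> {..<m})) (v(m := v m)) ((\<lambda>w. w(m := c')) ` override m e ` W)"
      by (rule algebraic_extension[OF e(1) _ _ True]) (rule ag)
    then show ?thesis using True by blast
  next
    case False
    then have v: "v m \<notin> cl (v ` (X \<union> {..<m}))" using Suc.prems[of m] by simp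
    show ?thesis
      using generic_extension[OF e(1) _ _ _ v, of "A \<union> e ` {..<m}" m] fin by auto
  qed
  then obtain c' where c': "compat (insert m (X \<union> {..<m})) v ((\<lambda>w. w(m := c')) ` override m e ` W)"
    "v m \<in> cl (v ` (S \<union> {..<m})) \<or> c' \<notin> cl (A \<union> e ` {..<m})" by auto
  let ?e = "e(m := c')"
  have "(\<lambda>w. w(m := c')) ` override m e ` W = override (Suc m) ?e ` W"
    unfolding image_image override_Suc ..
  moreover have "insert m (X \<union> {..<m}) = X \<union> {..<Suc m}" by auto
  ultimately have "compat (X \<union> {..<Suc m}) v (override (Suc m) ?e ` W)" using c'(1) by simp
  moreover have "v i \<in> cl (v ` (S \<union> {..<i})) \<or> ?e i \<notin> cl (A \<union> ?e ` {..<i})" if "i < Suc m" for i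
  proof -
    have "?e ` {..<i} = e ` {..<i}" using that by auto
    then show ?thesis using e(2) c'(2) that by (cases "i = m") auto
  qed
  ultimately show ?case by blast
qed

end

section \<open>Dividing\<close>

lemma image_shift: "f ` {n..<n + k} = (\<lambda>j. f (n + j)) ` {..<k :: nat}"
proof -
  have "{n..<n + k} = (+) n ` {..<k}"
    using image_add_atLeastLessThan[of n 0 k] by (simp add: atLeast0LessThan add.commute)
  then show ?thesis by (simp only: image_image)
qed

lemma nth_image_take: "i \<le> length b \<Longrightarrow> (\<lambda>x. (b @ d) ! x) ` {..<i} = set (take i b)"
  by (force simp: nth_append set_conv_nth image_iff)

lemma nth_image_mid: "(\<lambda>x. (b @ d @ a) ! x) ` {length b..<length b + length d} = set d"
  unfolding image_shift by (auto simp: nth_append set_conv_nth image_iff)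

lemma nth_image_last:
  "(\<lambda>x. (b @ d @ a) ! x) ` {length b + length d..<length b + length d + length a} = set a"
  unfolding image_shift by (auto simp: nth_append set_conv_nth image_iff)

context emodel
begin

lemma qfeqI_sat:
  assumes "\<And>\<chi>. fm_in L \<chi> \<Longrightarrow> fm_free \<chi> \<subseteq> X \<Longrightarrow> sat M v \<chi> \<longleftrightarrow> sat M w \<chi>"
  shows "qfeq X v w"
  unfolding qfeq_def
proof (intro allI impI)
  fix t assume t: "fvars t \<subseteq> X"
  note sub = subset_trans[OF fm_free_zero t] subset_trans[OF fm_free_prime t] subset_trans[OF fm_free_dvd t]
  show "(lv v t = zer \<longleftrightarrow> lv w t = zer) \<and>
     (\<forall>m>0. (prm m (lv v t) \<longleftrightarrow> prm m (lv w t)) \<and> (dvm m (lv v t) \<longleftrightarrow> dvm m (lv w t)))"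
    using assms[of "fm_zero t"] assms[of "fm_prime _ t"] assms[of "fm_dvd _ t"] sub by simp
qed

lemma tp_qfeq:
  assumes tp: "tp L M c A = tp L M d A" and len: "length c = length d" and A0: "set a \<subseteq> A"
  shows "qfeq {..<length d + length a} (\<lambda>i. (d @ a) ! i) (\<lambda>i. (c @ a) ! i)"
proof -
  have iff: "sat M (\<lambda>i. (d @ a) ! i) \<phi> \<longleftrightarrow> sat M (\<lambda>i. (c @ a) ! i) \<phi>"
    if "fm_in L \<phi>" "fm_free \<phi> \<subseteq> {..<length d + length a}" for \<phi>
  proof -
    have "(\<phi>, a) \<in> tp L M c A \<longleftrightarrow> (\<phi>, a) \<in> tp L M d A" using tp by simp
    then show ?thesis using that len A0 by (simp add: tp_def pformulas_def formulas_def holds_def)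
  qed
  show ?thesis
    by (rule qfeqI_sat) (rule iff)
qed

text \<open>The witnesses of dividing are first replaced, by Ramsey's theorem and saturation, by a
  \<open>k\<close>-tuple of witnesses which is compatible, so that the given realization can be moved
  simultaneously to all of them.\<close>

lemma not_divides:
  assumes \<psi>: "\<psi> \<in> formulas L (m + length d)" and len: "length b = m"
    and a: "set a \<subseteq> A" and holds: "holds M \<psi> (b @ d)"
    and alt: "\<And>i. i < m \<Longrightarrow> b ! i \<in> cl (set a \<union> set (take i b)) \<or>
      b ! i \<notin> cl (set a \<union> set d \<union> set (take i b))"
  shows "\<not> divides L M m (\<psi>, d) A"
proof
  assume "divides L M m (\<psi>, d) A"
  then obtain k and c :: "nat \<Rightarrow> 'a list" where c: "\<And>n. length (c n) = length d" "\<And>n. tp L M (c n) A = tp L M d A"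
    and incons: "\<And>I. finite I \<Longrightarrow> card I = k \<Longrightarrow>
      \<not> (\<exists>b. length b = m \<and> (\<forall>i\<in>I. holds M \<psi> (b @ c i)))"
    unfolding divides_def by auto
  \<comment> \<open>Layout of the variables: b occupies the first m places, d the next l, a the
    places up to K. Behind K there is room for k copies of d, the i-th starting at K + i *
    l.\<close>
  define l where "l = length d"
  define K where "K = m + l + length a"
  define v where "v x = (b @ d @ a) ! x" for x
  define w where "w n x = (b @ c n @ a) ! x" for n x
  define X where "X = {m..<K}"
  define S where "S = {m + l..<K}"
  have SX: "S \<subseteq> X" by (auto simp: S_def X_def)
  have q: "qfeq X v (w n)" for n
  proof -
    have "qfeq {..<l + length a} (\<lambda>i. (d @ a) ! i) (\<lambda>i. (c n @ a) ! i)"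
      unfolding l_def by (rule tp_qfeq[OF c(2) c(1) a])
    moreover have "(\<lambda>x. x - m) ` X \<subseteq> {..<l + length a}" by (auto simp: X_def K_def)
    ultimately have "qfeq X (\<lambda>x. (d @ a) ! (x - m)) (\<lambda>x. (c n @ a) ! (x - m))" by (rule qfeq_ren)
    then show ?thesis
      by (subst qfeq_cong[where v' = "\<lambda>x. (d @ a) ! (x - m)" and w' = "\<lambda>x. (c n @ a) ! (x - m)"])
        (auto simp: v_def w_def X_def nth_append len)
  qed
  \<comment> \<open>\<open>\<rho> i\<close> exchanges the block of d with its i-th copy, so it turns
    a statement about d into one about the i-th witness.\<close>
  define \<rho> where "\<rho> i x = (if m \<le> x \<and> x < m + l then K + i * l + (x - m)
    else if K + i * l \<le> x \<and> x < K + i * l + l then m + (x - (K + i * l)) else x)" for i x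
  have \<rho>\<rho>: "\<rho> i (\<rho> i x) = x" for i x
    by (auto simp: \<rho>_def K_def)
  have bij: "bij (\<rho> i)" for i by (rule involuntory_imp_bij) (rule \<rho>\<rho>)
  have \<rho>lt: "\<rho> i x < K + k * l" if "x < K" "i < k" for i x
  proof -
    have "i * l + l \<le> k * l" using that(2) by (metis Suc_leI mult_Suc mult_le_mono1 add.commute)
    then show ?thesis using that(1) by (auto simp: \<rho>_def)
  qed
  have \<rho>S: "\<rho> i x = x" if "x \<in> S" for i x using that by (auto simp: \<rho>_def S_def)
  have \<rho>m: "\<rho> i x = x" if "x < m" for i x using that by (auto simp: \<rho>_def K_def)
  have \<rho>ge: "m \<le> \<rho> i x" if "m \<le> x" for i x using that by (auto simp: \<rho>_def K_def)
  define sep where "sep = (\<lambda>(i, j, t, t'). FNeg (fm_zero (fren (\<rho> i) t @ fscale (- 1) (fren (\<rho> j) t'))))"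
  define T where "T = {(t, t'). fvars t \<subseteq> X \<and> fvars t' \<subseteq> X \<and> lv v t \<noteq> lv v t'}"
  \<comment> \<open>\<Sigma>1 gives every copy the type of d over a, \<Sigma>2 forbids coincidences
    between copies that are absent at v, and \<chi>0 says that the k copies of \<psi> are jointly
    inconsistent.\<close>
  define \<Sigma>1 where "\<Sigma>1 = {fm_ren (\<rho> i) \<chi> | i \<chi>. i < k \<and> fm_in L \<chi> \<and> fm_free \<chi> \<subseteq> X \<and> (\<forall>n. sat M (w n) \<chi>)}"
  define \<Sigma>2 where "\<Sigma>2 = sep ` {(i, j, t, t'). i < k \<and> j < k \<and> (t, t') \<in> T}"
  define \<chi>0 where "\<chi>0 = FNeg (FExs [0..<m] (FConjs (map (\<lambda>i. fm_ren (\<rho> i) \<psi>) [0..<k])))"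
  define \<Sigma> where "\<Sigma> = \<Sigma>1 \<union> \<Sigma>2 \<union> {\<chi>0}"
  have \<psi>': "fm_in L \<psi>" "fm_free \<psi> \<subseteq> {..<m + l}" using \<psi> by (auto simp: formulas_def l_def)
  have free: "fm_free \<phi> \<subseteq> {..<K + k * l}" and fm_in: "fm_in L \<phi>" if "\<phi> \<in> \<Sigma>" for \<phi>
  proof -
    have "fm_free \<phi> \<subseteq> {..<K + k * l} \<and> fm_in L \<phi>"
      using that unfolding \<Sigma>_def
    proof (elim UnE)
      assume "\<phi> \<in> \<Sigma>1"
      then obtain i \<chi> where "\<phi> = fm_ren (\<rho> i) \<chi>" "i < k" "fm_in L \<chi>" "fm_free \<chi> \<subseteq> X"
        by (auto simp: \<Sigma>1_def)
      then show ?thesis using \<rho>lt by (auto simp: fm_free_ren[OF bij_is_inj[OF bij]] X_def)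
    next
      assume "\<phi> \<in> \<Sigma>2"
      then obtain i j t t' where \<phi>: "\<phi> = FNeg (fm_zero (fren (\<rho> i) t @ fscale (- 1) (fren (\<rho> j) t')))"
        and ij: "i < k" "j < k" "fvars t \<subseteq> X" "fvars t' \<subseteq> X" by (auto simp: \<Sigma>2_def T_def sep_def)
      have "fvars (fren (\<rho> i) t @ fscale (- 1) (fren (\<rho> j) t')) \<subseteq> {..<K + k * l}"
        using \<rho>lt ij by (auto simp: X_def)
      from subset_trans[OF fm_free_zero this] show ?thesis by (simp add: \<phi>)
    next
      assume "\<phi> \<in> {\<chi>0}"
      then show ?thesis using \<psi>' \<rho>lt
        by (fastforce simp: \<chi>0_def fm_free_ren[OF bij_is_inj[OF bij]] K_def)
    qed
    then show "fm_free \<phi> \<subseteq> {..<K + k * l}" "fm_in L \<phi>" by blast+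
  qed
  have fip: "\<exists>u. (\<forall>x. x \<notin> {K..<K + k * l} \<longrightarrow> u x = v x) \<and> (\<forall>\<phi>\<in>\<Sigma>\<^sub>0. sat M u \<phi>)"
    if \<Sigma>0: "finite \<Sigma>\<^sub>0" "\<Sigma>\<^sub>0 \<subseteq> \<Sigma>" for \<Sigma>\<^sub>0
  proof -
    have "finite (\<Sigma>\<^sub>0 \<inter> \<Sigma>2)" "\<Sigma>\<^sub>0 \<inter> \<Sigma>2 \<subseteq> sep ` {(i, j, t, t'). i < k \<and> j < k \<and> (t, t') \<in> T}"
      using \<Sigma>0 by (auto simp: \<Sigma>2_def)
    then obtain C where C: "finite C" "C \<subseteq> {(i, j, t, t'). i < k \<and> j < k \<and> (t, t') \<in> T}" "\<Sigma>\<^sub>0 \<inter> \<Sigma>2 = sep ` C"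
      using finite_subset_image[of "\<Sigma>\<^sub>0 \<inter> \<Sigma>2"] by metis
    \<comment> \<open>A finite part of \<Sigma>2 involves only finitely many pairs of forms. For
      these an infinite set H of witnesses is free of coincidences, and the first k members of H
      interpret the copies.\<close>
    define C' where "C' = (\<lambda>(i, j, t, t'). (t, t')) ` C"
    have C': "finite C'" "C' \<subseteq> T" using C(1,2) by (auto simp: C'_def)
    have ne: "lv (w n) (fst p) \<noteq> lv (w n) (snd p)" if "p \<in> C'" for p n
      using that C'(2) qfeq_eq[OF q, of "fst p" "snd p"] by (auto simp: T_def)
    obtain H where H: "infinite H" "\<And>p n n'. p \<in> C' \<Longrightarrow> n \<in> H \<Longrightarrow> n' \<in> H \<Longrightarrow> lv (w n) (fst p) \<noteq> lv (w n') (snd p)"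
      using infinite_separated[OF C'(1), of "\<lambda>p n. lv (w n) (fst p)" "\<lambda>p n. lv (w n) (snd p)", OF ne] by auto
    define h where "h = enumerate H"
    have h: "h i \<in> H" "inj h" for i
      using H(1) by (auto simp: h_def enumerate_in_set strict_mono_enumerate strict_mono_imp_inj_on)
    define u where "u x = (if K \<le> x \<and> x < K + k * l then c (h ((x - K) div l)) ! ((x - K) mod l) else v x)" for x
    have u\<rho>: "u (\<rho> i x) = w (h i) x" if "x < K" "i < k" for i x
    proof (cases "m \<le> x \<and> x < m + l")
      case True
      then have e: "\<rho> i x = K + i * l + (x - m)" by (simp add: \<rho>_def)
      have lt: "\<rho> i x < K + k * l" by (rule \<rho>lt[OF that])
      have "x - m < l" using True by auto
      then have "(\<rho> i x - K) div l = i" "(\<rho> i x - K) mod l = x - m" by (simp_all add: e)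
      then have "u (\<rho> i x) = c (h i) ! (x - m)" using lt e by (simp add: u_def)
      also have "\<dots> = w (h i) x" using True c(1)[of "h i"] by (simp add: w_def nth_append len l_def) (auto simp: l_def)
      finally show ?thesis .
    next
      case False
      then have "\<rho> i x = x" using that(1) by (auto simp: \<rho>_def)
      then show ?thesis using False that(1) c(1)[of "h i"]
        by (auto simp: u_def v_def w_def nth_append len l_def)
    qed
    have "sat M u \<phi>" if "\<phi> \<in> \<Sigma>\<^sub>0" for \<phi>
    proof -
      have "\<phi> \<in> \<Sigma>1 \<or> \<phi> \<in> \<Sigma>\<^sub>0 \<inter> \<Sigma>2 \<or> \<phi> = \<chi>0" using that \<Sigma>0(2) by (auto simp: \<Sigma>_def)
      then show ?thesis
      proof (elim disjE)
        assume "\<phi> \<in> \<Sigma>1"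
        then obtain i \<chi> where \<chi>: "\<phi> = fm_ren (\<rho> i) \<chi>" "i < k" "fm_free \<chi> \<subseteq> X" "sat M (w (h i)) \<chi>"
          by (auto simp: \<Sigma>1_def)
        have "sat M (u \<circ> \<rho> i) \<chi> \<longleftrightarrow> sat M (w (h i)) \<chi>"
          by (rule sat_cong) (use u\<rho> \<chi>(2,3) in \<open>auto simp: X_def\<close>)
        then show ?thesis using \<chi> by (simp add: sat_ren[OF bij])
      next
        assume "\<phi> \<in> \<Sigma>\<^sub>0 \<inter> \<Sigma>2"
        then obtain i j t t' where it: "(i, j, t, t') \<in> C" "\<phi> = sep (i, j, t, t')" using C(3) by auto
        then have ij: "i < k" "j < k" "fvars t \<subseteq> X" "fvars t' \<subseteq> X" using C(2) by (auto simp: T_def)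
        have e: "lv (\<lambda>x. u (\<rho> i x)) t = lv (w (h i)) t" "lv (\<lambda>x. u (\<rho> j x)) t' = lv (w (h j)) t'"
          using u\<rho> ij by (auto intro!: lv_cong simp: X_def)
        have "(t, t') \<in> C'" unfolding C'_def by (rule image_eqI[OF _ it(1)]) simp
        then have "lv (w (h i)) t \<noteq> lv (w (h j)) t'" using H(2)[of "(t, t')"] h(1) by auto
        then show ?thesis by (simp add: it(2) sep_def e G.right_minus_eq)
      next
        assume \<phi>: "\<phi> = \<chi>0"
        show ?thesis
        \<comment> \<open>If \<chi>0 failed, b' would satisfy \<psi> with k distinctly indexed
          witnesses, against the choice of k; this uses that h is injective.\<close>
        proof (rule ccontr)
          assume "\<not> ?thesis"
          then have "\<exists>u'. (\<forall>x. x < m \<or> u' x = u x) \<and> (\<forall>i\<in>{0..<k}. sat M (u' \<circ> \<rho> i) \<psi>)"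
            by (simp add: \<phi> \<chi>0_def sat_FExs sat_ren[OF bij])
          then obtain u' where u': "\<And>x. x \<notin> {0..<m} \<Longrightarrow> u' x = u x" "\<And>i. i < k \<Longrightarrow> sat M (u' \<circ> \<rho> i) \<psi>"
            by (metis atLeastLessThan_iff zero_le)
          define b' where "b' = map u' [0..<m]"
          have "holds M \<psi> (b' @ c (h i))" if i: "i < k" for i
          proof -
            have "sat M (u' \<circ> \<rho> i) \<psi> \<longleftrightarrow> sat M (\<lambda>x. (b' @ c (h i)) ! x) \<psi>"
            proof (rule sat_cong)
              fix x assume "x \<in> fm_free \<psi>"
              then have x: "x < m + l" using \<psi>'(2) by auto
              show "(u' \<circ> \<rho> i) x = (b' @ c (h i)) ! x"
              proof (cases "x < m")
                case True
                then show ?thesis using \<rho>m by (simp add: b'_def nth_append)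
              next
                case False
                then have "u' (\<rho> i x) = u (\<rho> i x)" using \<rho>ge[of x i] by (intro u'(1)) auto
                also have "\<dots> = w (h i) x" using x i by (intro u\<rho>) (simp_all add: K_def)
                finally show ?thesis using False x c(1)[of "h i"]
                  by (auto simp: w_def b'_def nth_append len l_def)
              qed
            qed
            then show ?thesis using u'(2)[OF i] by (simp add: holds_def)
          qed
          moreover have "card (h ` {..<k}) = k" using h(2) by (simp add: card_image inj_on_subset)
          moreover have "length b' = m" by (simp add: b'_def)
          ultimately show False using incons[of "h ` {..<k}"] by blast
        qed
      qed
    qed
    then show ?thesis by (intro exI[of _ u]) (auto simp: u_def)
  qed
  have "\<exists>u. (\<forall>x. x \<notin> {K..<K + k * l} \<longrightarrow> u x = v x) \<and> (\<forall>\<phi>\<in>\<Sigma>. sat M u \<phi>)"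
    by (rule saturation_tuple[where Y = "{..<K + k * l}"]) (use free fm_in fip in auto)
  then obtain u where u: "\<And>x. x \<notin> {K..<K + k * l} \<Longrightarrow> u x = v x" "\<And>\<phi>. \<phi> \<in> \<Sigma> \<Longrightarrow> sat M u \<phi>" by blast
  \<comment> \<open>One assignment per copy; all of them agree on S, the places of a.\<close>
  define W where "W = (\<lambda>i. u \<circ> \<rho> i) ` {..<k}"
  have "compat X v W"
  proof (rule compatI)
    fix u' assume "u' \<in> W"
    then obtain i where i: "i < k" "u' = u \<circ> \<rho> i" by (auto simp: W_def)
    have iff: "sat M v \<chi> \<longleftrightarrow> sat M u' \<chi>" if \<chi>: "fm_in L \<chi>" "fm_free \<chi> \<subseteq> X" for \<chi>
    proof -
      have *: "sat M u' \<chi>" if "sat M v \<chi>" "fm_in L \<chi>" "fm_free \<chi> \<subseteq> X" for \<chi>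
      proof -
        have "sat M (w n) \<chi>" for n using sat_qfeq[OF that(2,3) _ q] that(1) by (simp add: X_def)
        then have "fm_ren (\<rho> i) \<chi> \<in> \<Sigma>" using that i(1) by (auto simp: \<Sigma>_def \<Sigma>1_def)
        from u(2)[OF this] show ?thesis by (simp add: i(2) sat_ren[OF bij])
      qed
      show ?thesis using *[of \<chi>] *[of "FNeg \<chi>"] \<chi> by auto
    qed
    show "qfeq X v u'" by (rule qfeqI_sat) (rule iff)
  next
    fix u1 u2 t t' assume "u1 \<in> W" "u2 \<in> W" and t: "fvars t \<subseteq> X" "fvars t' \<subseteq> X" "lv u1 t = lv u2 t'"
    then obtain i j where i: "i < k" "j < k" "u1 = u \<circ> \<rho> i" "u2 = u \<circ> \<rho> j" by (auto simp: W_def)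
    show "lv v t = lv v t'"
    proof (rule ccontr)
      assume "lv v t \<noteq> lv v t'"
      then have "(i, j, t, t') \<in> {(i, j, t, t'). i < k \<and> j < k \<and> (t, t') \<in> T}" using t(1,2) i by (simp add: T_def)
      then have "sep (i, j, t, t') \<in> \<Sigma>" unfolding \<Sigma>_def \<Sigma>2_def by blast
      from u(2)[OF this] show False using t(3) by (simp add: sep_def i comp_def)
    qed
  qed
  moreover have "u' x = u'' x" if "u' \<in> W" "u'' \<in> W" "x \<in> S" for u' u'' x
    using that \<rho>S by (auto simp: W_def)
  moreover have "v i \<in> cl (v ` (S \<union> {..<i})) \<or> v i \<notin> cl (v ` (X \<union> {..<i}))" if i: "i < m" for i
  proof -
    have im: "v ` {..<i} = set (take i b)"
      using nth_image_take[of i b "d @ a"] i by (simp add: v_def len)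
    have S': "v ` S = set a"
      using nth_image_last[of b d a] by (simp add: v_def S_def K_def len l_def)
    have "v ` {m..<m + l} = set d"
      using nth_image_mid[of b d a] by (simp add: v_def len l_def)
    moreover have "X = {m..<m + l} \<union> S" by (auto simp: X_def S_def K_def)
    ultimately have X': "v ` X = set d \<union> set a" using S' by (simp add: image_Un)
    have "v i = b ! i" using i by (simp add: v_def nth_append len)
    then show ?thesis using alt[OF i] by (simp add: image_Un im S' X' Un_ac)
  qed
  ultimately obtain e where e: "compat (X \<union> {..<m}) v (override m e ` W)"
    using tuple_extension[of X v W "{}" S m] SX by (auto simp: W_def X_def)
  \<comment> \<open>Only the first m places of u are changed. The moved tuple satisfies \<psi> with
    all k copies together, which contradicts \<chi>0.\<close>
  define u' where "u' = override m e u"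
  have "sat M u' (fm_ren (\<rho> i) \<psi>)" if i: "i < k" for i
  proof -
    have "qfeq (X \<union> {..<m}) v (override m e (u \<circ> \<rho> i))"
      using compat_qfeq[OF e] i by (auto simp: W_def)
    moreover have "fm_free \<psi> \<subseteq> X \<union> {..<m}" using \<psi>'(2) by (auto simp: X_def K_def)
    moreover have "finite (X \<union> {..<m})" by (simp add: X_def)
    ultimately have "sat M v \<psi> \<longleftrightarrow> sat M (override m e (u \<circ> \<rho> i)) \<psi>"
      using sat_qfeq[OF \<psi>'(1)] by blast
    moreover have "sat M v \<psi> \<longleftrightarrow> sat M (\<lambda>x. (b @ d) ! x) \<psi>"
      by (rule sat_cong) (use \<psi>'(2) in \<open>auto simp: v_def nth_append len l_def\<close>)
    ultimately have "sat M (override m e (u \<circ> \<rho> i)) \<psi>" using holds by (simp add: holds_def)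
    moreover have "override m e (u \<circ> \<rho> i) = u' \<circ> \<rho> i"
    proof
      fix x show "override m e (u \<circ> \<rho> i) x = (u' \<circ> \<rho> i) x"
        using \<rho>m[of x i] \<rho>ge[of x i] by (cases "x < m") (auto simp: override_def u'_def)
    qed
    ultimately show ?thesis by (simp add: sat_ren[OF bij])
  qed
  moreover have "\<forall>x. x \<notin> set [0..<m] \<longrightarrow> u' x = u x" by (simp add: u'_def override_def)
  ultimately have "\<not> sat M u \<chi>0" unfolding \<chi>0_def sat.simps(3) sat_FExs by auto
  then show False using u(2)[of \<chi>0] by (simp add: \<Sigma>_def)
qed

end

section \<open>Forking and rank\<close>

lemma forksE:
  assumes "forks L M m (\<phi>, a) A"
  obtains \<Psi> where "finite \<Psi>" "\<Psi> \<subseteq> pformulas L m UNIV" "\<And>\<psi> c. (\<psi>, c) \<in> \<Psi> \<Longrightarrow> divides L M m (\<psi>, c) A"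
    "\<And>b. length b = m \<Longrightarrow> holds M \<phi> (b @ a) \<Longrightarrow> \<exists>\<psi> c. (\<psi>, c) \<in> \<Psi> \<and> holds M \<psi> (b @ c)"
proof -
  obtain \<Psi> where \<Psi>: "finite \<Psi>" "\<Psi> \<subseteq> pformulas L m UNIV" "\<forall>\<psi>\<in>\<Psi>. divides L M m \<psi> A"
    "\<forall>b. length b = m \<and> holds M \<phi> (b @ a) \<longrightarrow> (\<exists>(\<psi>, c)\<in>\<Psi>. holds M \<psi> (b @ c))"
    using assms unfolding forks_def prod.case by (elim exE conjE) (rule that)
  show ?thesis
  proof (rule that[OF \<Psi>(1,2)])
    show "divides L M m (\<psi>, c) A" if "(\<psi>, c) \<in> \<Psi>" for \<psi> c using \<Psi>(3) that by blast
    show "\<exists>\<psi> c. (\<psi>, c) \<in> \<Psi> \<and> holds M \<psi> (b @ c)" if "length b = m" "holds M \<phi> (b @ a)" for b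
      using \<Psi>(4) that by blast
  qed
qed

context zgroup
begin

lemma cl_finite: "x \<in> cl S \<Longrightarrow> \<exists>F. finite F \<and> F \<subseteq> S \<and> x \<in> cl F"
  unfolding cl_def using finite_fvars by blast

lemma cl_subset: "x \<in> S \<Longrightarrow> x \<in> cl S"
  unfolding cl_def by (intro CollectI exI[of _ 1] exI[of _ "[(1, Some x)]"]) simp

end

context emodel
begin

lemma dset_holds:
  assumes "\<phi> \<in> formulas L (1 + length a)"
  shows "dset (set a) {x. holds M \<phi> (x # a)}"
proof -
  let ?v = "\<lambda>i. (zer # a) ! i"
  have "{x. holds M \<phi> (x # a)} = {x. sat M (?v(0 := x)) \<phi>}"
  proof -
    have "?v(0 := x) = (\<lambda>i. (x # a) ! i)" for x by (auto simp: nth_Cons split: nat.splits)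
    then show ?thesis by (simp add: holds_def)
  qed
  moreover have "?v ` (fm_free \<phi> - {0}) \<subseteq> set a"
    using assms by (fastforce simp: formulas_def nth_Cons split: nat.splits)
  moreover have "fm_in L \<phi>" using assms by (simp add: formulas_def)
  ultimately show ?thesis unfolding dset_def by blast
qed

lemma dset_mono:
  assumes "dset A S" "A \<subseteq> B"
  shows "dset B S"
proof -
  obtain \<phi> v y where "fm_in L \<phi>" "v ` (fm_free \<phi> - {y}) \<subseteq> A" "S = {c. sat M (v(y := c)) \<phi>}"
    using assms(1) unfolding dset_def by blast
  moreover from this(2) assms(2) have "v ` (fm_free \<phi> - {y}) \<subseteq> B" by (rule subset_trans)
  ultimately show ?thesis unfolding dset_def by blast
qed

text \<open>Each single equation n x = t excludes at most one element, so finitely many of them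
  cannot exhaust an infinite S; saturation does the rest.\<close>

lemma exists_generic:
  assumes "finite A" "dset A S" "infinite S"
  shows "\<exists>x\<in>S. x \<notin> cl A"
proof -
  define F where "F = {{x. n \<odot> x \<oplus> lv (\<lambda>x. x) t \<noteq> zer} | n t. n \<noteq> 0 \<and> fvars t \<subseteq> A}"
  have "\<exists>c. \<forall>T\<in>insert S F. c \<in> T"
  proof (rule dset_inter[OF assms(1)])
    fix T assume "T \<in> insert S F"
    then show "dset A T"
    proof
      assume "T \<in> F"
      then obtain n t where "fvars t \<subseteq> A" "T = {x. n \<odot> x \<oplus> lv (\<lambda>x. x) t \<noteq> zer}"
        by (auto simp: F_def)
      then show ?thesis using dset_zero[of "\<lambda>x. x" t A n] by simp
    qed (use assms(2) in simp)
  next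
    fix F\<^sub>0 assume F0: "finite F\<^sub>0" "F\<^sub>0 \<subseteq> insert S F"
    have cofin: "finite (- T)" if "T \<in> F" for T
    proof -
      obtain n t where T: "n \<noteq> 0" "T = {x. n \<odot> x \<oplus> lv (\<lambda>x. x) t \<noteq> zer}" using \<open>T \<in> F\<close> by (auto simp: F_def)
      have "- T = {x. n \<odot> x = neg (lv (\<lambda>x. x) t)}" by (auto simp: T(2) G.eq_neg_iff_add_eq_0)
      then show ?thesis using finite_smul_eq[OF T(1)] by simp
    qed
    have "finite (\<Union>T\<in>F\<^sub>0 - {S}. - T)" using F0 cofin by auto
    then have "infinite (S - (\<Union>T\<in>F\<^sub>0 - {S}. - T))" using assms(3) by simp
    then obtain x where "x \<in> S - (\<Union>T\<in>F\<^sub>0 - {S}. - T)" by (metis all_not_in_conv finite.emptyI)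
    then show "\<Inter>F\<^sub>0 \<noteq> {}" by blast
  qed
  then obtain x where x: "x \<in> S" "\<And>T. T \<in> F \<Longrightarrow> x \<in> T" by blast
  have "x \<notin> cl A"
  proof
    assume "x \<in> cl A"
    then obtain n t where n: "n \<noteq> 0" "fvars t \<subseteq> A" "n \<odot> x = lv (\<lambda>x. x) t" by (auto simp: cl_def)
    have "{x. n \<odot> x \<oplus> lv (\<lambda>x. x) (fscale (-1) t) \<noteq> zer} \<in> F" unfolding F_def using n
      by (intro CollectI exI[of _ n] exI[of _ "fscale (-1) t"]) simp
    from x(2)[OF this] show False using n(3) by simp
  qed
  then show ?thesis using x(1) by blast
qed

text \<open>A solution outside the closure of the parameters could be moved generically to a
  solution outside the closure of any given finite list, hence outside the list itself.\<close>

lemma algebraic_cl: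
  assumes alg: "algebraic M (\<phi>, a)" and \<phi>: "\<phi> \<in> formulas L (1 + length a)" and d: "holds M \<phi> (d # a)"
  shows "d \<in> cl (set a)"
proof (rule ccontr)
  assume nd: "d \<notin> cl (set a)"
  obtain cs where cs: "\<And>b. holds M \<phi> (b # a) \<Longrightarrow> b \<in> set cs" using alg by (auto simp: algebraic_def)
  define v where "v i = (d # a) ! i" for i
  define X where "X = {1..<1 + length a}"
  have vX: "v ` X = set a" using nth_image_mid[of "[d]" a "[]"] by (simp add: v_def X_def)
  obtain c' where c': "c' \<notin> cl (set cs)" "compat (insert 0 X) (v(0 := d)) ((\<lambda>w. w(0 := c')) ` {v})"
    using generic_extension[OF qfeq_compat[OF qfeq_refl[of X v]], of "set cs" d 0] nd vX by (auto simp: X_def)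
  have "qfeq (insert 0 X) (v(0 := d)) (v(0 := c'))" using compat_qfeq[OF c'(2)] by simp
  moreover have "fm_free \<phi> \<subseteq> insert 0 X" using \<phi> by (auto simp: formulas_def X_def)
  moreover have "finite (insert 0 X)" "fm_in L \<phi>" using \<phi> by (auto simp: X_def formulas_def)
  ultimately have "sat M (v(0 := d)) \<phi> \<longleftrightarrow> sat M (v(0 := c')) \<phi>" using sat_qfeq by blast
  moreover have "v(0 := x) = (\<lambda>i. (x # a) ! i)" for x by (auto simp: v_def nth_Cons split: nat.splits)
  ultimately have "holds M \<phi> (c' # a)" using d by (simp add: holds_def)
  then show False using cs cl_subset c'(1) by blast
qed

text \<open>A non-algebraic formula has a solution b outside the closure of all parameters in sight.
  It must satisfy one of the dividing formulas, although a point generic over the parameters of a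
  formula prevents that formula from dividing.\<close>

lemma forks_algebraic:
  assumes \<phi>: "\<phi> \<in> formulas L (1 + length a)" and f: "forks L M 1 (\<phi>, a) A"
  shows "algebraic M (\<phi>, a)"
proof (rule ccontr)
  assume na: "\<not> algebraic M (\<phi>, a)"
  obtain \<Psi> where \<Psi>: "finite \<Psi>" "\<Psi> \<subseteq> pformulas L 1 UNIV" "\<And>\<psi> c. (\<psi>, c) \<in> \<Psi> \<Longrightarrow> divides L M 1 (\<psi>, c) A"
    "\<And>b. length b = 1 \<Longrightarrow> holds M \<phi> (b @ a) \<Longrightarrow> \<exists>\<psi> c. (\<psi>, c) \<in> \<Psi> \<and> holds M \<psi> (b @ c)"
    by (rule forksE[OF f]) (rule that)
  define E where "E = set a \<union> (\<Union>(\<psi>, c)\<in>\<Psi>. set c)"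
  have "finite E" using \<Psi>(1) by (auto simp: E_def)
  moreover have "dset E {x. holds M \<phi> (x # a)}"
    by (rule dset_mono[OF dset_holds[OF \<phi>]]) (simp add: E_def)
  moreover have "infinite {x. holds M \<phi> (x # a)}"
  proof
    assume "finite {x. holds M \<phi> (x # a)}"
    then obtain cs where "set cs = {x. holds M \<phi> (x # a)}" using finite_list by blast
    then show False using na unfolding algebraic_def by auto
  qed
  ultimately obtain b where b: "holds M \<phi> (b # a)" "b \<notin> cl E" using exists_generic by blast
  then obtain \<psi> c where \<psi>: "(\<psi>, c) \<in> \<Psi>" "holds M \<psi> ([b] @ c)" using \<Psi>(4)[of "[b]"] by auto
  have "\<not> divides L M 1 (\<psi>, c) A"
  proof (rule not_divides[of _ _ _ "[b]" "[]"])
    show "\<psi> \<in> formulas L (1 + length c)" using \<Psi>(2) \<psi>(1) by (auto simp: pformulas_def)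
    have "set c \<subseteq> E" using \<psi>(1) by (auto simp: E_def)
    then show "[b] ! i \<in> cl (set [] \<union> set (take i [b])) \<or> [b] ! i \<notin> cl (set [] \<union> set c \<union> set (take i [b]))"
      if "i < 1" for i
      using that b(2) cl_mono[of "set c" E] by auto
  qed (use \<psi>(2) in simp_all)
  then show False using \<Psi>(3) \<psi>(1) by blast
qed

text \<open>An element algebraic over the base meets the first alternative of
  \<open>not_divides\<close>, so no formula that it satisfies divides over the base.\<close>

lemma not_type_forks_cl:
  assumes "d \<in> cl (set a)" "set a \<subseteq> B"
  shows "\<not> type_forks L M 1 (tp L M [d] B') B"
proof
  assume "type_forks L M 1 (tp L M [d] B') B"
  then obtain \<chi> a' where \<chi>: "holds M \<chi> ([d] @ a')" "forks L M 1 (\<chi>, a') B"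
    by (auto simp: type_forks_def tp_def)
  obtain \<Psi> where \<Psi>: "finite \<Psi>" "\<Psi> \<subseteq> pformulas L 1 UNIV" "\<And>\<psi> c. (\<psi>, c) \<in> \<Psi> \<Longrightarrow> divides L M 1 (\<psi>, c) B"
    "\<And>b. length b = 1 \<Longrightarrow> holds M \<chi> (b @ a') \<Longrightarrow> \<exists>\<psi> c. (\<psi>, c) \<in> \<Psi> \<and> holds M \<psi> (b @ c)"
    by (rule forksE[OF \<chi>(2)]) (rule that)
  obtain \<psi> c where \<psi>: "(\<psi>, c) \<in> \<Psi>" "holds M \<psi> ([d] @ c)" using \<Psi>(4)[of "[d]"] \<chi>(1) by auto
  have "\<not> divides L M 1 (\<psi>, c) B"
  proof (rule not_divides[of _ _ _ "[d]" a])
    show "\<psi> \<in> formulas L (1 + length c)" using \<Psi>(2) \<psi>(1) by (auto simp: pformulas_def)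
  qed (use \<psi>(2) assms in auto)
  then show False using \<Psi>(3) \<psi>(1) by blast
qed

lemma infinite_univ: "infinite (UNIV :: 'a set)"
proof -
  have "inj (\<lambda>r. r \<odot> one)" by (rule injI) (simp add: smul_cancel_left[OF one_neq_zer])
  then show ?thesis by (rule infinite_inj_image[OF infinite_UNIV_int]) simp
qed

lemma tp_cong:
  assumes "qfeq {..<length b} (\<lambda>i. b ! i) (\<lambda>i. c ! i)" "length b = length c"
  shows "tp L M b {} = tp L M c {}"
proof -
  have "holds M \<phi> b \<longleftrightarrow> holds M \<phi> c" if "\<phi> \<in> formulas L (length b)" for \<phi>
    using sat_qfeq[OF _ _ _ assms(1)] that by (simp add: holds_def formulas_def)
  then show ?thesis using assms(2) by (auto simp: tp_def pformulas_def)
qed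

text \<open>For d outside the closure of the empty set the formula x = d divides over it: the type
  of d has infinitely many realizations, and two different ones give inconsistent equations.\<close>

lemma U_rank_ge_1: "theory_U_rank_ge L \<kappa> M 1"
proof -
  have "dset {} UNIV" unfolding dset_def
    by (rule exI[of _ "FConjs []"]) auto
  then obtain d where d: "d \<notin> cl {}" using exists_generic[of "{}" UNIV] infinite_univ by auto
  \<comment> \<open>By quantifier elimination S is the set of realizations of the type of d over the
    empty set. If S were finite, a generic extension would produce a realization outside its
    closure.\<close>
  define S where "S = {x. qfeq {0 :: nat} (\<lambda>_. d) (\<lambda>_. x)}"
  have "infinite S"
  proof
    assume "finite S"
    then have "\<exists>c'. c' \<notin> cl S \<and> compat (insert (0 :: nat) {}) ((\<lambda>_. d)(0 := d)) ((\<lambda>w. w(0 := c')) ` {\<lambda>_. d})"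
      by (intro generic_extension qfeq_compat qfeq_refl) (simp_all add: d)
    then obtain c' where c': "c' \<notin> cl S" "compat (insert (0 :: nat) {}) ((\<lambda>_. d)(0 := d)) ((\<lambda>w. w(0 := c')) ` {\<lambda>_. d})"
      by blast
    have "qfeq {0 :: nat} ((\<lambda>_. d)(0 := d)) ((\<lambda>_. d)(0 := c'))" by (rule compat_qfeq[OF c'(2)]) blast
    then have "c' \<in> S" unfolding S_def using qfeq_cong[of "{0 :: nat}" "(\<lambda>_. d)(0 := d)" "\<lambda>_. d" "(\<lambda>_. d)(0 := c')" "\<lambda>_. c'"] by simp
    then show False using c'(1) cl_subset by blast
  qed
  then obtain c :: "nat \<Rightarrow> 'a" where c: "inj c" "range c \<subseteq> S" using infinite_countable_subset by blast
  have tpc: "tp L M [c i] {} = tp L M [d] {}" for i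
  proof (rule tp_cong[symmetric])
    have "qfeq {0 :: nat} (\<lambda>_. d) (\<lambda>_. c i)" using c(2) by (auto simp: S_def)
    then show "qfeq {..<length [d]} (\<lambda>j. [d] ! j) (\<lambda>j. [c i] ! j)"
      using qfeq_cong[of "{0 :: nat}" "\<lambda>_. d" "\<lambda>j. [d] ! j" "\<lambda>_. c i" "\<lambda>j. [c i] ! j"] by (simp add: lessThan_Suc)
  qed simp
  let ?\<phi> = "FEq (TVar 0) (TVar 1) :: (fsym, rsym) fm"
  have \<phi>: "?\<phi> \<in> formulas L (Suc (Suc 0))" by (auto simp: formulas_def)
  have h: "holds M ?\<phi> ([x] @ [y]) \<longleftrightarrow> x = y" for x y by (simp add: holds_def)
  have "divides L M 1 (?\<phi>, [d]) {}"
  proof -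
    have "\<not> (\<exists>b. length b = 1 \<and> (\<forall>i\<in>I. holds M ?\<phi> (b @ [c i])))" if I: "finite I" "card I = 2" for I
    proof
      assume "\<exists>b. length b = 1 \<and> (\<forall>i\<in>I. holds M ?\<phi> (b @ [c i]))"
      then obtain b where b: "length b = 1" "\<And>i. i \<in> I \<Longrightarrow> holds M ?\<phi> (b @ [c i])" by blast
      obtain x where x: "b = [x]" using b(1) by (auto simp: length_Suc_conv)
      obtain i j where ij: "i \<in> I" "j \<in> I" "i \<noteq> j" using I by (auto simp: card_2_iff)
      then have "c i = c j" using b(2)[of i] b(2)[of j] h x by simp
      then show False using c(1) ij(3) by (auto dest: injD)
    qed
    then show ?thesis unfolding divides_def prod.case
      by (intro exI[of _ 2] exI[of _ "\<lambda>i. [c i]"]) (simp add: tpc)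
  qed
  then have "forks L M 1 (?\<phi>, [d]) {}" unfolding forks_def prod.case
    using \<phi> by (intro exI[of _ "{(?\<phi>, [d])}"]) (simp add: pformulas_def)
  moreover have "(?\<phi>, [d]) \<in> tp L M [d] {d}" using \<phi> h[of d d] by (simp add: tp_def pformulas_def)
  ultimately have "type_forks L M 1 (tp L M [d] {d}) {}" unfolding type_forks_def by blast
  moreover have "tp L M [d] {} \<subseteq> tp L M [d] {d}" by (auto simp: tp_def pformulas_def)
  ultimately have "U_rank_ge L M \<kappa> 1 {} (tp L M [d] {})"
    using small_finite[of "{d}"] by (auto intro!: exI[of _ "{d}"] exI[of _ d])
  then show ?thesis unfolding theory_U_rank_ge_def using small_finite[of "{}"] by auto
qed

text \<open>After the first forking extension the type contains an algebraic formula over B. Every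
  realization then lies in the closure of B, and no further extension forks over B.\<close>

lemma not_U_rank_ge_2: "\<not> theory_U_rank_ge L \<kappa> M (Suc 1)"
proof
  assume "theory_U_rank_ge L \<kappa> M (Suc 1)"
  then obtain A B B' d1 d2 where r: "type_forks L M 1 (tp L M [d1] B) A" "tp L M [d1] B \<subseteq> tp L M [d2] B'"
    "type_forks L M 1 (tp L M [d2] B') B"
    unfolding theory_U_rank_ge_def by auto
  then obtain \<phi> a where \<phi>: "(\<phi>, a) \<in> tp L M [d1] B" "forks L M 1 (\<phi>, a) A" by (auto simp: type_forks_def)
  have f: "\<phi> \<in> formulas L (1 + length a)" "set a \<subseteq> B" using \<phi>(1) by (auto simp: tp_def pformulas_def)
  have "holds M \<phi> (d2 # a)" using \<phi>(1) r(2) by (auto simp: tp_def)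
  from algebraic_cl[OF forks_algebraic[OF f(1) \<phi>(2)] f(1) this] have "d2 \<in> cl (set a)" .
  then show False using not_type_forks_cl[OF _ f(2)] r(3) by blast
qed

text \<open>Closure is finitary: for each coordinate of b that is algebraic over A and its
  predecessors, finitely many elements of A suffice. Their union over the coordinates is the
  required base A0.\<close>

lemma supersimple: "supersimple L \<kappa> M"
  unfolding supersimple_def
proof (intro allI impI)
  fix b :: "'a list" and A :: "'a set"
  define m where "m = length b"
  have "\<exists>F. finite F \<and> F \<subseteq> A \<and> (b ! i \<in> cl (A \<union> set (take i b)) \<longrightarrow> b ! i \<in> cl (F \<union> set (take i b)))" for i
  proof (cases "b ! i \<in> cl (A \<union> set (take i b))")
    case True
    then obtain F where F: "finite F" "F \<subseteq> A \<union> set (take i b)" "b ! i \<in> cl F" using cl_finite by blast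
    have "cl F \<subseteq> cl (F \<inter> A \<union> set (take i b))" using F(2) by (intro cl_mono) blast
    then show ?thesis using F by (intro exI[of _ "F \<inter> A"]) auto
  qed auto
  then obtain F where F: "\<And>i. finite (F i)" "\<And>i. F i \<subseteq> A"
    "\<And>i. b ! i \<in> cl (A \<union> set (take i b)) \<Longrightarrow> b ! i \<in> cl (F i \<union> set (take i b))" by metis
  define A0 where "A0 = (\<Union>i<m. F i)"
  have A0: "finite A0" "A0 \<subseteq> A" using F(1,2) by (auto simp: A0_def)
  have "\<not> type_forks L M m (tp L M b A) A0"
  proof
    assume "type_forks L M m (tp L M b A) A0"
    then obtain \<phi> a where \<phi>: "(\<phi>, a) \<in> tp L M b A" "forks L M m (\<phi>, a) A0" by (auto simp: type_forks_def)
    have a: "set a \<subseteq> A" "\<phi> \<in> formulas L (m + length a)" "holds M \<phi> (b @ a)"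
      using \<phi>(1) by (auto simp: tp_def pformulas_def m_def)
    obtain \<Psi> where \<Psi>: "finite \<Psi>" "\<Psi> \<subseteq> pformulas L m UNIV" "\<And>\<psi> c. (\<psi>, c) \<in> \<Psi> \<Longrightarrow> divides L M m (\<psi>, c) A0"
      "\<And>b. length b = m \<Longrightarrow> holds M \<phi> (b @ a) \<Longrightarrow> \<exists>\<psi> c. (\<psi>, c) \<in> \<Psi> \<and> holds M \<psi> (b @ c)"
      by (rule forksE[OF \<phi>(2)]) (rule that)
    \<comment> \<open>E contains the parameters of all dividing formulas in \<Psi>. The tuple b is
      moved to b', still satisfying \<phi> over a, so that its non-algebraic coordinates become
      generic even over E.\<close>
    define E where "E = A0 \<union> (\<Union>(\<psi>, c)\<in>\<Psi>. set c)"
    have finE: "finite E" using \<Psi>(1) A0(1) by (auto simp: E_def)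
    obtain a0 where a0: "set a0 = A0" using A0(1) finite_list by blast
    define v where "v x = (b @ a @ a0) ! x" for x
    define S where "S = {m + length a..<m + length a + length a0}"
    define X where "X = {m..<m + length a} \<union> S"
    have vS: "v ` S = A0" using nth_image_last[of b a a0] a0 by (simp add: v_def S_def m_def)
    have vX: "v ` X = set a \<union> A0" using nth_image_mid[of b a a0] vS by (simp add: X_def image_Un v_def m_def)
    have vi: "v ` {..<i} = set (take i b)" if "i < m" for i
      using nth_image_take[of i b "a @ a0"] that by (simp add: v_def m_def)
    have "v i \<in> cl (v ` (S \<union> {..<i})) \<or> v i \<notin> cl (v ` (X \<union> {..<i}))" if i: "i < m" for i
    proof -
      have v: "v i = b ! i" using i by (simp add: v_def m_def nth_append)
      have "cl (F i \<union> set (take i b)) \<subseteq> cl (A0 \<union> set (take i b))" using i by (intro cl_mono) (auto simp: A0_def)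
      moreover have "cl (set a \<union> A0 \<union> set (take i b)) \<subseteq> cl (A \<union> set (take i b))" using a(1) A0(2) by (intro cl_mono) auto
      ultimately show ?thesis using F(3)[of i] by (auto simp: v image_Un vS vX vi[OF i])
    qed
    then obtain e where e: "compat (X \<union> {..<m}) v (override m e ` {v})"
      "\<And>i. i < m \<Longrightarrow> v i \<in> cl (v ` (S \<union> {..<i})) \<or> e i \<notin> cl (E \<union> e ` {..<i})"
      using tuple_extension[OF qfeq_compat[OF qfeq_refl[of X v]], of E S m] finE
      by (auto simp: X_def S_def)
    define u where "u = override m e v"
    have q: "qfeq (X \<union> {..<m}) v u" using compat_qfeq[OF e(1)] by (simp add: u_def)
    define b' where "b' = map e [0..<m]"
    have lb': "length b' = m" by (simp add: b'_def)
    have "fm_in L \<phi>" "fm_free \<phi> \<subseteq> X \<union> {..<m}" "finite (X \<union> {..<m})"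
      using a(2) by (auto simp: formulas_def X_def S_def)
    then have "sat M v \<phi> \<longleftrightarrow> sat M u \<phi>" by (rule sat_qfeq[OF _ _ _ q])
    moreover have "sat M v \<phi> \<longleftrightarrow> sat M (\<lambda>x. (b @ a) ! x) \<phi>"
      by (rule sat_cong) (use a(2) in \<open>auto simp: formulas_def v_def nth_append m_def\<close>)
    moreover have "sat M u \<phi> \<longleftrightarrow> sat M (\<lambda>x. (b' @ a) ! x) \<phi>"
      by (rule sat_cong) (use a(2) in \<open>auto simp: formulas_def u_def override_def b'_def v_def nth_append m_def\<close>)
    ultimately have "holds M \<phi> (b' @ a)" using a(3) by (simp add: holds_def)
    then obtain \<psi> c where \<psi>: "(\<psi>, c) \<in> \<Psi>" "holds M \<psi> (b' @ c)" using \<Psi>(4)[OF lb'] by auto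
    have "\<not> divides L M m (\<psi>, c) A0"
    proof (rule not_divides[of _ _ _ b' a0])
      show "\<psi> \<in> formulas L (m + length c)" using \<Psi>(2) \<psi>(1) by (auto simp: pformulas_def)
      fix i assume i: "i < m"
      have take: "set (take i b') = e ` {..<i}" using i by (auto simp: b'_def take_map)
      have bi: "b' ! i = e i" using i by (simp add: b'_def)
      have uS: "u ` (S \<union> {..<i}) = A0 \<union> e ` {..<i}"
      proof -
        have "u ` S = v ` S" by (rule image_cong) (auto simp: u_def override_def S_def)
        moreover have "u ` {..<i} = e ` {..<i}" by (rule image_cong) (use i in \<open>auto simp: u_def override_def\<close>)
        ultimately show ?thesis by (simp add: image_Un vS)
      qed
      show "b' ! i \<in> cl (set a0 \<union> set (take i b')) \<or> b' ! i \<notin> cl (set a0 \<union> set c \<union> set (take i b'))"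
        using e(2)[OF i]
      proof
        \<comment> \<open>The linear relation that makes the coordinate algebraic over A0 and its
          predecessors is part of the quantifier-free type and so survives the move from v to
          u.\<close>
        assume "v i \<in> cl (v ` (S \<union> {..<i}))"
        then obtain n t where n: "n \<noteq> 0" "fvars t \<subseteq> S \<union> {..<i}" "n \<odot> v i = lv v t" unfolding cl_image by blast
        have "fvars [(n, Some i)] \<subseteq> X \<union> {..<m}" "fvars t \<subseteq> X \<union> {..<m}" using n(2) i by (auto simp: X_def)
        from qfeq_eq[OF q this] have "n \<odot> u i = lv u t" using n(3) by simp
        then have "u i \<in> cl (u ` (S \<union> {..<i}))" unfolding cl_image using n(1,2) by blast
        moreover have "u i = e i" using i by (simp add: u_def override_def)
        ultimately show ?thesis unfolding uS by (simp add: a0 take bi)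
      next
        assume ne: "e i \<notin> cl (E \<union> e ` {..<i})"
        have "cl (A0 \<union> set c \<union> e ` {..<i}) \<subseteq> cl (E \<union> e ` {..<i})"
          using \<psi>(1) by (intro cl_mono) (auto simp: E_def)
        then show ?thesis using ne by (auto simp: a0 take bi)
      qed
    qed (use lb' \<psi>(2) a0 in auto)
    then show False using \<Psi>(3) \<psi>(1) by blast
  qed
  then show "\<exists>A\<^sub>0. finite A\<^sub>0 \<and> A\<^sub>0 \<subseteq> A \<and> \<not> type_forks L M (length b) (tp L M b A) A\<^sub>0"
    using A0 by (auto simp: m_def)
qed

lemma U_rank_1: "theory_U_rank_eq L \<kappa> M 1"
  unfolding theory_U_rank_eq_def using U_rank_ge_1 not_U_rank_ge_2 by simp

end

section \<open>The two languages as instances of \<open>emodel\<close>\<close>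

lemma monster_small_finite:
  fixes \<kappa> :: "'k rel"
  assumes "monster L T \<kappa> M" "fun_arity (L :: (fsym, 'r) lang) Zero = Some 0" "finite A"
  shows "small \<kappa> A"
proof -
  \<comment> \<open>These sentences, one for each bound variable, show that \<kappa> exceeds an
    infinite cardinal.\<close>
  have "range (\<lambda>i. FEx i FTrue) \<subseteq> formulas L 0"
    using assms(2) by (auto simp: formulas_def FTrue_def)
  moreover have "inj (\<lambda>i. FEx i (FTrue :: (fsym, 'r) fm))" by (auto simp: inj_on_def)
  ultimately have "infinite (formulas L 0)" using finite_subset finite_imageD infinite_UNIV_nat by blast
  then have "(card_of A, card_of (formulas L 0)) \<in> ordLess"
    using assms(3) by (intro finite_ordLess_infinite) (auto simp: Field_card_of card_of_well_order_on)
  moreover have "(card_of (formulas L 0), \<kappa>) \<in> ordLess" using assms(1) by (simp add: monster_def small_def)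
  ultimately show ?thesis unfolding small_def by (rule ordLess_transitive)
qed

lemma emodel_plus_Pr:
  fixes M :: "(fsym, rsym, 'a) fo_struct"
  assumes "Dickson" "monster L_plus_Pr T_plus_Pr \<kappa> M"
  shows "emodel M L_plus_Pr \<kappa>"
proof -
  interpret zmodel M by unfold_locales (use assms(2) in \<open>simp add: monster_def\<close>)
  have prm1: "rel_interp M Pr [x] \<longleftrightarrow> prm 1 x" for x by (simp add: prm_def isP_def)
  show ?thesis
  proof
    show "small \<kappa> A" if "finite A" for A :: "'a set"
      using monster_small_finite[OF assms(2) _ that] by (simp add: arity_L_plus_Pr)
    show "(f = Plus \<and> k = 2) \<or> (f = Minus \<and> k = 1 \<and> (\<forall>x. fun_interp M Minus [x] = neg x)) \<or>
      ((f = Zero \<or> f = One) \<and> k = 0)" if "fun_arity L_plus_Pr f = Some k" for f k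
      using that by (cases f) (auto simp: L_plus_Pr_def)
    show "k = 1 \<and> (\<exists>m>0. (\<forall>x. rel_interp M r [x] \<longleftrightarrow> prm m x) \<or> (\<forall>x. rel_interp M r [x] \<longleftrightarrow> dvm m x))"
      if "rel_arity L_plus_Pr r = Some k" for r k
      using that prm1 by (cases r) (auto simp: L_plus_Pr_def intro!: exI[of _ 1])
  qed (use assms in \<open>auto simp: monster_def arity_L_plus_Pr\<close>)
qed

lemma tm_in_L_star: "tm_in L_plus_Pr t \<Longrightarrow> tm_in L_star t"
  by (induction t) (auto simp: L_plus_Pr_def L_star_def list_all_iff split: fsym.splits)

lemma fm_in_L_star: "fm_in L_plus_Pr \<phi> \<Longrightarrow> fm_in L_star \<phi>"
  by (induction \<phi>)
    (auto simp: tm_in_L_star list_all_iff, auto simp: L_plus_Pr_def L_star_def split: rsym.splits)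

lemma T_plus_Pr_subset: "T_plus_Pr \<subseteq> T_star"
  using fm_in_L_star by (auto simp: T_plus_Pr_def T_star_def Th_def formulas_def)

text \<open>The extra symbols are interpreted in M as expected because their definitions in terms of
  \<open>L_plus_Pr\<close> are true in the integers and therefore belong to
  \<open>T_star\<close>.\<close>

lemma emodel_star:
  fixes M :: "(fsym, rsym, 'a) fo_struct"
  assumes D: "Dickson" and mon: "monster L_star T_star \<kappa> M"
  shows "emodel M L_star \<kappa>"
proof -
  have mod: "models M (Th L_star Z_struct)" using mon by (simp add: monster_def T_star_def)
  have "models M T_plus_Pr" using mon T_plus_Pr_subset unfolding monster_def models_def by blast
  then interpret zmodel M by unfold_locales
  have prm1: "rel_interp M Pr [x] \<longleftrightarrow> prm 1 x" for x by (simp add: prm_def isP_def)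
  have minus: "fun_interp M Minus [x] = neg x" for x
  proof -
    have "sat M (\<lambda>_. x) (FEq (TApp Plus [TVar 0, TApp Minus [TVar 0]]) (TApp Zero []))"
      by (rule Th_transfer[OF mod]) (simp add: L_star_def, simp add: Z_struct_def)
    then have "x \<oplus> fun_interp M Minus [x] = zer" by (simp add: add_def zer_def)
    then show ?thesis by (metis G.minus_unique)
  qed
  \<comment> \<open>The equivalence of the symbol and its defining formula is written with
    \<open>FNeg\<close> and \<open>FConj\<close> only and transferred in the full language
    \<open>L_star\<close>.\<close>
  have iff: "rel_interp M r [x] \<longleftrightarrow> sat M (\<lambda>_. x) \<phi>"
    if "rel_arity L_star r = Some 1" "fm_in L_plus_Pr \<phi>"
      "\<And>v. rel_interp Z_struct r [v 0] \<longleftrightarrow> sat Z_struct v \<phi>" for r \<phi> x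
  proof -
    have "sat M (\<lambda>_. x) (FConj (FNeg (FConj (FRel r [TVar 0]) (FNeg \<phi>))) (FNeg (FConj \<phi> (FNeg (FRel r [TVar 0])))))"
      by (rule Th_transfer[OF mod]) (use that fm_in_L_star in auto)
    then show ?thesis by auto
  qed
  have pm: "rel_interp M (Pr_mult n) [x] \<longleftrightarrow> prm (int n) x" if "n \<ge> 2" for n x
  proof -
    have "rel_interp Z_struct (Pr_mult n) [y] \<longleftrightarrow> Z.prm (int n) y" for y
      using that by (auto simp: Z_prm) (auto simp: Z_struct_def Prime_pm_iff)
    then show ?thesis using iff[of "Pr_mult n" "fm_prime (int n) [(1, Some 0)]" x] that by (simp add: L_star_def)
  qed
  have dm: "rel_interp M (Div_by n) [x] \<longleftrightarrow> dvm (int n) x" if "n \<ge> 2" for n x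
  proof -
    have "rel_interp Z_struct (Div_by n) [y] \<longleftrightarrow> Z.dvm (int n) y" for y
      unfolding Z_dvm by (simp add: Z_struct_def)
    then show ?thesis using iff[of "Div_by n" "fm_dvd (int n) [(1, Some 0)]" x] that by (simp add: L_star_def)
  qed
  show ?thesis
  proof
    show "small \<kappa> A" if "finite A" for A :: "'a set"
      using monster_small_finite[OF mon _ that] by (simp add: L_star_def)
    show "(f = Plus \<and> k = 2) \<or> (f = Minus \<and> k = 1 \<and> (\<forall>x. fun_interp M Minus [x] = neg x)) \<or>
      ((f = Zero \<or> f = One) \<and> k = 0)" if "fun_arity L_star f = Some k" for f k
      using that minus by (cases f) (auto simp: L_star_def)
    show "k = 1 \<and> (\<exists>m>0. (\<forall>x. rel_interp M r [x] \<longleftrightarrow> prm m x) \<or> (\<forall>x. rel_interp M r [x] \<longleftrightarrow> dvm m x))"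
      if r: "rel_arity L_star r = Some k" for r k
    proof (cases r)
      case Pr
      then show ?thesis using r prm1 by (auto simp: L_star_def intro!: exI[of _ 1])
    next
      case (Pr_mult n)
      then show ?thesis using r pm[of n] by (auto simp: L_star_def split: if_splits intro!: exI[of _ "int n"])
    next
      case (Div_by n)
      then show ?thesis using r dm[of n] by (auto simp: L_star_def split: if_splits intro!: exI[of _ "int n"])
    qed
    show "fun_arity L_star Zero = Some 0" by (simp add: L_star_def)
  qed (use D mon fm_in_L_star in \<open>auto simp: monster_def\<close>)
qed

theorem theorem3p2:
  fixes \<CC> :: "(fsym, rsym, 'a) fo_struct" and \<kappa> :: "'k rel"
    and \<CC>' :: "(fsym, rsym, 'b) fo_struct" and \<kappa>' :: "'l rel"
  assumes "Dickson"
  shows "(monster L_star T_star \<kappa> \<CC> \<longrightarrow>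
            supersimple L_star \<kappa> \<CC> \<and> theory_U_rank_eq L_star \<kappa> \<CC> 1 \<and>
            (\<forall>A a \<phi>. small \<kappa> A \<and> \<phi> \<in> formulas L_star (1 + length a) \<and>
               forks L_star \<CC> 1 (\<phi>, a) A \<longrightarrow> algebraic \<CC> (\<phi>, a))) \<and>
         (monster L_plus_Pr T_plus_Pr \<kappa>' \<CC>' \<longrightarrow>
            supersimple L_plus_Pr \<kappa>' \<CC>' \<and> theory_U_rank_eq L_plus_Pr \<kappa>' \<CC>' 1)"
proof (intro conjI impI)
  assume "monster L_star T_star \<kappa> \<CC>"
  then interpret emodel \<CC> L_star \<kappa> by (rule emodel_star[OF assms])
  show "supersimple L_star \<kappa> \<CC>" by (rule supersimple)
  show "theory_U_rank_eq L_star \<kappa> \<CC> 1" by (rule U_rank_1)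
  show "\<forall>A a \<phi>. small \<kappa> A \<and> \<phi> \<in> formulas L_star (1 + length a) \<and>
      forks L_star \<CC> 1 (\<phi>, a) A \<longrightarrow> algebraic \<CC> (\<phi>, a)"
    using forks_algebraic by blast
next
  assume "monster L_plus_Pr T_plus_Pr \<kappa>' \<CC>'"
  then interpret emodel \<CC>' L_plus_Pr \<kappa>' by (rule emodel_plus_Pr[OF assms])
  show "supersimple L_plus_Pr \<kappa>' \<CC>'" by (rule supersimple)
  show "theory_U_rank_eq L_plus_Pr \<kappa>' \<CC>' 1" by (rule U_rank_1)
qed

end
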